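(* Let $n\ge 2$. Consider the reduced random walk on the alcoves of the affine Weyl group $\tilde B_n$, with weights given by the Kac labels $a_i=2$ for $0\le i\le n-2$ and $a_{n-1}=a_n=1$. Its limiting direction is parallel to (a positive multiple of) $$\sum_{i=1}^n (2i-1)\,e_i .$$
   Context: Let $e_1,\dots,e_n$ be the standard basis of $\mathbb R^n$. The root system $B_n$ is $\Phi=\{\pm e_i\pm e_j: i<j\}\cup\{\pm e_i\}$, with simple roots $\alpha_0=e_1$, $\alpha_i=e_{i+1}-e_i$ ($1\le i\le n-1$), and highest root $\theta=e_{n-1}+e_n$. Consider the hyperplanes $H_{\alpha,k}=\{x:\langle x,\alpha\rangle=k\}$, $\alpha\in\Phi$, $k\in\mathbb Z$. The affine Weyl group is generated by the reflections in these hyperplanes. Alcoves are the connected components of the complement of the union of all $H_{\alpha,k}$; the affine group acts simply transitively on them. The fundamental alcove is $A_0=\{x:\langle x,\alpha_i\rangle>0\ (0\le i\le n-1),\ \langle x,\theta\rangle<1\}$. A facet of an alcove $wA_0$ has type $i$ ($0\le i\le n-1$) if it is the image under $w$ of the facet of $A_0$ contained in $H_{\alpha_i,0}$, and type $n$ if it is the image of the facet contained in $H_{\theta,1}$. Reduced random walk with weights $(a_0,\dots,a_n)$ (positive reals): $X_0=A_0$; given $X_t$, the next alcove $X_{t+1}$ is chosen among the alcoves adjacent to $X_t$ through a facet whose hyperplane does not separate $X_t$ from $A_0$ (i.e. has not been crossed before), the facet of type $i$ being chosen with probability proportional to $a_i$. Almost surely the walk is eventually confined to one chamber of the finite Weyl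 group $W$ (a component of the complement of $\bigcup_{\alpha}H_{\alpha,0}$). The limiting direction is the almost sure limit of $x_t/\|x_t\|$, where $x_t\in X_t$, for the walk confined to (i.e. on the event that it eventually stays in) the identity chamber $\{x:\langle x,\alpha_i\rangle>0,\ 0\le i\le n-1\}$. *)

theory Defs
  imports "HOL-Probability.Probability"
begin

text \<open>Throughout, \<open>n = CARD('n)\<close>, and \<open>e 1, \<dots>, e n\<close> enumerates the standard basis of
  \<open>real ^ 'n\<close> (the finite type \<open>'n\<close> carries no order of its own); the values of \<open>e\<close> outside
  \<open>{1..n}\<close> are irrelevant.\<close>

definition root_system_B :: "(nat \<Rightarrow> real ^ 'n) \<Rightarrow> (real ^ 'n) set" where
  "root_system_B e =
     {s *\<^sub>R e i + t *\<^sub>R e j | s t i j. s \<in> {-1, 1} \<and> t \<in> {-1, 1} \<and> 1 \<le> i \<and> i < j \<and> j \<le> CARD('n)}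
     \<union> {s *\<^sub>R e i | s i. s \<in> {-1, 1} \<and> 1 \<le> i \<and> i \<le> CARD('n)}"

definition simple_root :: "(nat \<Rightarrow> real ^ 'n) \<Rightarrow> nat \<Rightarrow> real ^ 'n" where
  "simple_root e i = (if i = 0 then e 1 else e (i + 1) - e i)"

definition highest_root :: "(nat \<Rightarrow> real ^ 'n) \<Rightarrow> real ^ 'n" where
  "highest_root e = e (CARD('n) - 1) + e (CARD('n))"

definition hyperplane :: "real ^ 'n \<Rightarrow> int \<Rightarrow> (real ^ 'n) set" where
  "hyperplane \<alpha> k = {x. x \<bullet> \<alpha> = of_int k}"

definition affine_reflection :: "real ^ 'n \<Rightarrow> int \<Rightarrow> real ^ 'n \<Rightarrow> real ^ 'n" where
  "affine_reflection \<alpha> k x = x - (2 * (x \<bullet> \<alpha> - of_int k) / (\<alpha> \<bullet> \<alpha>)) *\<^sub>R \<alpha>"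

text \<open>Reflections are involutions, so the monoid they generate is already a group.\<close>

inductive_set affine_weyl_group :: "(nat \<Rightarrow> real ^ 'n) \<Rightarrow> (real ^ 'n \<Rightarrow> real ^ 'n) set"
  for e :: "nat \<Rightarrow> real ^ 'n" where
  one: "id \<in> affine_weyl_group e"
| step: "\<lbrakk>\<alpha> \<in> root_system_B e; w \<in> affine_weyl_group e\<rbrakk>
    \<Longrightarrow> affine_reflection \<alpha> k \<circ> w \<in> affine_weyl_group e"

definition alcoves :: "(nat \<Rightarrow> real ^ 'n) \<Rightarrow> (real ^ 'n) set set" where
  "alcoves e = components (- (\<Union>\<alpha>\<in>root_system_B e. \<Union>k. hyperplane \<alpha> k))"

definition identity_chamber :: "(nat \<Rightarrow> real ^ 'n) \<Rightarrow> (real ^ 'n) set" where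
  "identity_chamber e = {x. \<forall>i<CARD('n). x \<bullet> simple_root e i > 0}"

definition fundamental_alcove :: "(nat \<Rightarrow> real ^ 'n) \<Rightarrow> (real ^ 'n) set" where
  "fundamental_alcove e =
     {x. (\<forall>i<CARD('n). x \<bullet> simple_root e i > 0) \<and> x \<bullet> highest_root e < 1}"

definition fundamental_wall :: "(nat \<Rightarrow> real ^ 'n) \<Rightarrow> nat \<Rightarrow> (real ^ 'n) set" where
  "fundamental_wall e i =
     (if i < CARD('n) then hyperplane (simple_root e i) 0 else hyperplane (highest_root e) 1)"

text \<open>\<open>F\<close> is the facet of type \<open>i \<in> {0..n}\<close> of the alcove \<open>A\<close>.  Facets are taken of the closed
  alcove, in the sense of the library's \<open>facet_of\<close>.\<close>

definition facet_of_type ::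
  "(nat \<Rightarrow> real ^ 'n) \<Rightarrow> (real ^ 'n) set \<Rightarrow> nat \<Rightarrow> (real ^ 'n) set \<Rightarrow> bool" where
  "facet_of_type e A i F \<longleftrightarrow>
     i \<le> CARD('n) \<and>
     (\<exists>w\<in>affine_weyl_group e. \<exists>F0. A = w ` fundamental_alcove e \<and>
        F0 facet_of closure (fundamental_alcove e) \<and> F0 \<subseteq> fundamental_wall e i \<and> F = w ` F0)"

definition separates :: "real ^ 'n \<Rightarrow> int \<Rightarrow> (real ^ 'n) set \<Rightarrow> (real ^ 'n) set \<Rightarrow> bool" where
  "separates \<alpha> k A B \<longleftrightarrow>
     (A \<subseteq> {x. x \<bullet> \<alpha> < of_int k} \<and> B \<subseteq> {x. x \<bullet> \<alpha> > of_int k}) \<or>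
     (A \<subseteq> {x. x \<bullet> \<alpha> > of_int k} \<and> B \<subseteq> {x. x \<bullet> \<alpha> < of_int k})"

definition admissible_step ::
  "(nat \<Rightarrow> real ^ 'n) \<Rightarrow> (real ^ 'n) set \<Rightarrow> nat \<Rightarrow> (real ^ 'n) set \<Rightarrow> bool" where
  "admissible_step e A i B \<longleftrightarrow>
     B \<in> alcoves e \<and> B \<noteq> A \<and>
     (\<exists>F. facet_of_type e A i F \<and> F facet_of closure B \<and>
        (\<exists>\<alpha>\<in>root_system_B e. \<exists>k. F \<subseteq> hyperplane \<alpha> k \<and> \<not> separates \<alpha> k A (fundamental_alcove e)))"

definition transition_prob ::
  "(nat \<Rightarrow> real ^ 'n) \<Rightarrow> (nat \<Rightarrow> real) \<Rightarrow> (real ^ 'n) set \<Rightarrow> (real ^ 'n) set \<Rightarrow> real" where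
  "transition_prob e a A B =
     (\<Sum>i | i \<le> CARD('n) \<and> admissible_step e A i B. a i) /
     (\<Sum>i | i \<le> CARD('n) \<and> (\<exists>B'. admissible_step e A i B'). a i)"

text \<open>The last clause is the Markov property with the given transition probabilities, written
  without conditioning so that path prefixes of probability zero need no special treatment.\<close>

definition reduced_random_walk ::
  "(nat \<Rightarrow> real ^ 'n) \<Rightarrow> (nat \<Rightarrow> real) \<Rightarrow> 'w measure \<Rightarrow> (nat \<Rightarrow> 'w \<Rightarrow> (real ^ 'n) set) \<Rightarrow> bool" where
  "reduced_random_walk e a M X \<longleftrightarrow>
     prob_space M \<and>
     (\<forall>t. X t \<in> measurable M (count_space (alcoves e))) \<and>
     (AE \<omega> in M. X 0 \<omega> = fundamental_alcove e) \<and>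
     (\<forall>t A. measure M {\<omega> \<in> space M. \<forall>s\<le>Suc t. X s \<omega> = A s} =
        measure M {\<omega> \<in> space M. \<forall>s\<le>t. X s \<omega> = A s} * transition_prob e a (A t) (A (Suc t)))"

text \<open>\<open>u\<close> is the almost sure limit of \<open>x\<^sub>t / \<parallel>x\<^sub>t\<parallel>\<close> for all choices of points \<open>x\<^sub>t \<in> X\<^sub>t\<close>, on the event
  that the walk eventually stays in the identity chamber.\<close>

definition limiting_direction ::
  "(nat \<Rightarrow> real ^ 'n) \<Rightarrow> 'w measure \<Rightarrow> (nat \<Rightarrow> 'w \<Rightarrow> (real ^ 'n) set) \<Rightarrow> real ^ 'n \<Rightarrow> bool" where
  "limiting_direction e M X u \<longleftrightarrow>
     (AE \<omega> in M. (\<forall>\<^sub>F t in sequentially. X t \<omega> \<subseteq> identity_chamber e) \<longrightarrow>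
        (\<forall>x. (\<forall>t. x t \<in> X t \<omega>) \<longrightarrow> (\<lambda>t. x t /\<^sub>R norm (x t)) \<longlonglongrightarrow> u))"

definition kac_label :: "nat \<Rightarrow> nat \<Rightarrow> real" where
  "kac_label n i = (if i + 2 \<le> n then 2 else 1)"

end

theory Submission
  imports Defs
begin

text \<open>
  Write an alcove as \<open>A = w A\<^sub>0\<close> with \<open>w x = c + L x\<close> in the affine Weyl group; \<open>L\<close> is a signed
  permutation, recorded by its labels \<open>l\<^sub>1 \<dots> l\<^sub>n \<in> {\<plusminus>1, \<dots>, \<plusminus>n}\<close>.  As long as the walk stays in the
  identity chamber, crossing the facet of type \<open>i\<close> is admissible exactly when the inner normal
  \<open>L \<alpha>\<^sub>i\<close> of that facet is a negative root.  On labels this is an exclusion process: a negative first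
  label becomes positive, neighbouring labels in decreasing order are exchanged, and the last two
  labels \<open>(a, b)\<close> with \<open>a + b > 0\<close> become \<open>(-b, -a)\<close>.  The probabilities of leaving the chamber
  enter the transition probabilities only through a common normalising factor.

  The coordinate \<open>x\<^sub>k\<close> of the walk stays within a bounded distance of the number of times the label \<open>-k\<close>
  has become \<open>k\<close> at the left end.  So one needs the long-run frequency of \<open>l\<^sub>1 \<le> -k\<close>, and this event
  survives the projection that replaces each label by its sign if its absolute value is at least
  \<open>k\<close> and by \<open>0\<close> otherwise.  The result is an exclusion process on words over \<open>{-1, 0, 1}\<close> with
  \<open>z = k - 1\<close> zeros.  The Kac labels make its stationary measure a matrix product
  (\<open>weight\<close>, \<open>weight_balance\<close>) whose total weight is \<open>2n choose (n + z)\<close>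
  (\<open>total_weight_closed_form\<close>).  The words that start with \<open>-1\<close> carry the total weight for length
  \<open>n - 1\<close>; the quotient of the two binomials shows that \<open>l\<^sub>1 \<le> -k\<close> has probability proportional
  to \<open>n\<^sup>2 - (k - 1)\<^sup>2\<close>.  Differences for successive \<open>k\<close> are proportional to \<open>2k - 1\<close>.

  To pass from the stationary measure to almost sure limits, solve the Poisson equation
  \<open>\<L> h = current - 2 \<cdot> 1[l\<^sub>1 \<le> -k]\<close> on words, with \<open>\<L>\<close> the generator of the process
  (\<open>words_poisson_equation\<close>).  Then the height in
  direction \<open>k\<close> plus \<open>h\<close> minus \<open>current\<close> times a clock is, up to steps outside the chamber, a
  martingale with bounded increments, hence \<open>o(t)\<close> (\<open>strong_law\<close>).  The clock adds the inverse
  total rate of each visited alcove; it is the same for all \<open>k\<close> and so drops out of the direction.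
\<close>

section \<open>Moves on signed words\<close>

text \<open>
  Right multiplication of a signed permutation by the simple reflections: a sign change of the first
  letter, the exchange of neighbours, and \<open>(a, b) \<mapsto> (-b, -a)\<close> on the last two letters for every
  \<open>i \<ge> length u\<close>.  The same formula acts on words over \<open>{-1, 0, 1}\<close>.
\<close>

definition move :: "nat \<Rightarrow> int list \<Rightarrow> int list" where
  "move i u =
     (if i = 0 then u[0 := - u ! 0]
      else if i < length u then u[i - 1 := u ! i, i := u ! (i - 1)]
      else u[length u - 2 := - u ! (length u - 1), length u - 1 := - u ! (length u - 2)])"

text \<open>
  For a signed permutation \<open>L\<close> this says that \<open>L\<close> sends the \<open>i\<close>-th wall root to a negative root.
\<close>

definition active :: "nat \<Rightarrow> int list \<Rightarrow> bool" where
  "active i u \<longleftrightarrow>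
     (if i = 0 then u ! 0 < 0
      else if i < length u then u ! i < u ! (i - 1)
      else u ! (length u - 2) + u ! (length u - 1) > 0)"

section \<open>Stationary weights of three-letter words\<close>

text \<open>
  The matrices of the matrix product, acting on vectors indexed by the naturals: with \<open>S\<close> the shift
  \<open>(S g) j = g (j + 1)\<close>, the letter \<open>1\<close> is \<open>D = 1 + S\<close>, the letter \<open>-1\<close> is its transpose
  \<open>E = 1 + S\<^sup>T\<close>, and the letter \<open>0\<close> is the projection \<open>A\<close> to index \<open>0\<close>.  Hence \<open>D E = D + E\<close>,
  \<open>D A = A\<close>, \<open>A E = A\<close>, and \<open>(E g) 0 = g 0\<close>.
\<close>

definition letter_op :: "int \<Rightarrow> (nat \<Rightarrow> real) \<Rightarrow> nat \<Rightarrow> real" where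
  "letter_op a g j =
     (if a = 0 then (if j = 0 then g 0 else 0)
      else if a > 0 then g j + g (Suc j)
      else g j + (if j = 0 then 0 else g (j - 1)))"

text \<open>
  The last letter contributes a vector: the unit vector at \<open>0\<close> for the letter \<open>0\<close>, and for \<open>1\<close> and
  \<open>-1\<close> alike the constant vector, which \<open>D\<close> doubles and \<open>A\<close> sends to the unit vector.  The component
  at index \<open>0\<close> is the stationary weight of the word.
\<close>

fun weight :: "int list \<Rightarrow> nat \<Rightarrow> real" where
  "weight [] = (\<lambda>_. 1)"
| "weight [a] = (\<lambda>j. if a = 0 \<and> j > 0 then 0 else 1)"
| "weight (a # b # u) = letter_op a (weight (b # u))"

text \<open>
  The net flow into \<open>u\<close> through the pair \<open>{u, move i u}\<close> at unit rate, as a vector.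
\<close>

definition inflow :: "nat \<Rightarrow> int list \<Rightarrow> nat \<Rightarrow> real" where
  "inflow i u j =
     (if active i (move i u) then weight (move i u) j else 0) - (if active i u then weight u j else 0)"

lemma length_move [simp]: "length (move i u) = length u"
  by (simp add: move_def)

lemma move_Cons:
  assumes "i > 0" "length u \<ge> 2"
  shows "move (Suc i) (a # u) = a # move i u" "active (Suc i) (a # u) = active i u"
  using assms by (cases i; cases u; force simp: move_def active_def nth_Cons' Suc_diff_le split: nat.splits)+

lemma letter_op_linear:
  "letter_op a (\<lambda>j. \<Sum>i\<in>I. c i * f i j) = (\<lambda>j. \<Sum>i\<in>I. c i * letter_op a (f i) j)"
  by (rule ext) (auto simp: letter_op_def sum.distrib algebra_simps)

lemma letter_op_diff: "letter_op a (\<lambda>j. f j - g j) j = letter_op a f j - letter_op a g j"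
  by (auto simp: letter_op_def)

lemma weight_Cons: "u \<noteq> [] \<Longrightarrow> weight (a # u) = letter_op a (weight u)"
  by (cases u) auto

lemma inflow_Cons:
  assumes "i > 0" "length u \<ge> 2"
  shows "inflow (Suc i) (a # u) = letter_op a (inflow i u)"
proof
  fix j
  have ne: "u \<noteq> []" "move i u \<noteq> []" using assms(2) by (auto simp flip: length_0_conv)
  have "inflow i u = (\<lambda>j. (if active i (move i u) then weight (move i u) j else 0)
       - (if active i u then weight u j else 0))" by (simp add: inflow_def fun_eq_iff)
  then show "inflow (Suc i) (a # u) j = letter_op a (inflow i u) j"
    using assms ne by (auto simp: inflow_def[of "Suc i"] move_Cons weight_Cons letter_op_diff letter_op_def)
qed

lemma letters_cases: "(a::int) \<in> {-1,0,1} \<Longrightarrow> (a = -1 \<Longrightarrow> P) \<Longrightarrow> (a = 0 \<Longrightarrow> P) \<Longrightarrow> (a = 1 \<Longrightarrow> P) \<Longrightarrow> P"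
  by auto

text \<open>
  The relations between the matrices remove one of the two exchanged letters, so that the flow is a
  difference of two terms, each of them a weight with one letter removed.
\<close>

lemma inflow_first_bond:
  assumes "a \<in> {-1,0,1}" "b \<in> {-1,0,1}" "v \<noteq> []"
  shows "inflow 1 (a # b # v) j =
    - of_int a * weight (b # v) j + of_int b * letter_op a (weight v) j"
proof -
  have mv: "move 1 (a # b # v) = b # a # v" and ac: "active 1 (a # b # v) \<longleftrightarrow> b < a"
    and ac': "active 1 (b # a # v) \<longleftrightarrow> a < b"
    using assms(3) by (auto simp: move_def active_def)
  show ?thesis
    unfolding inflow_def mv ac ac'
    by (rule letters_cases[OF assms(1)]; rule letters_cases[OF assms(2)])
       (use assms(3) in \<open>auto simp: weight_Cons letter_op_def\<close>)
qed

text \<open>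
  The Kac labels give both moves at the right end half the rate of an exchange in the bulk.  At these
  rates they jointly contribute the first of the two terms of a bond in the bulk, and nothing is left
  over at the right end.
\<close>

lemma inflow_last_pair:
  assumes "a \<in> {-1,0,1}" "b \<in> {-1,0,1}"
  shows "inflow 1 [a, b] j + inflow 2 [a, b] j = - 2 * of_int a * weight [b] j"
  by (rule letters_cases[OF assms(1)]; rule letters_cases[OF assms(2)])
       (auto simp: weight_Cons letter_op_def inflow_def move_def active_def)

lemma kac_label_Suc: "i \<ge> 1 \<Longrightarrow> kac_label (Suc n) (Suc i) = kac_label n i"
  by (simp add: kac_label_def)

lemma sum_peel_first: "(\<Sum>i=Suc 0..Suc n. f i) = f (Suc 0) + (\<Sum>i=Suc 0..n. f (Suc i) :: real)"
  by (induction n) auto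

text \<open>
  Only the term at the left end survives, because the contributions of successive bonds cancel.
\<close>

lemma inflow_telescope:
  assumes "length u \<ge> 2" "set u \<subseteq> {-1,0,1}"
  shows "(\<Sum>i=1..length u. kac_label (length u) i * inflow i u j) = - 2 * of_int (hd u) * weight (tl u) j"
  using assms
proof (induction u arbitrary: j)
  case Nil
  then show ?case by simp
next
  case (Cons a u)
  show ?case
  proof (cases "length u \<ge> 2")
    case True
    then obtain b v where u: "u = b # v" "v \<noteq> []" by (cases u) (auto simp: Suc_le_eq)
    let ?n = "length u"
    have "(\<Sum>i=1..length (a#u). kac_label (length (a#u)) i * inflow i (a#u) j)
      = kac_label (Suc ?n) 1 * inflow 1 (a#u) j
        + (\<Sum>i=1..?n. kac_label (Suc ?n) (Suc i) * inflow (Suc i) (a#u) j)"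
      by (simp only: sum_peel_first list.size One_nat_def add_Suc_right add_0_right)
    also have "\<dots> = 2 * inflow 1 (a#u) j + (\<Sum>i=1..?n. kac_label ?n i * letter_op a (inflow i u) j)"
      using True by (auto simp: kac_label_Suc inflow_Cons kac_label_def intro!: sum.cong)
    also have "(\<Sum>i=1..?n. kac_label ?n i * letter_op a (inflow i u) j)
       = letter_op a (\<lambda>j. \<Sum>i=1..?n. kac_label ?n i * inflow i u j) j"
      by (simp add: letter_op_linear)
    also have "\<dots> = letter_op a (\<lambda>j. - 2 * of_int b * weight v j) j"
      using Cons.IH[of _] Cons.prems True u by simp
    also have "2 * inflow 1 (a#u) j = 2 * (- of_int a * weight (b # v) j + of_int b * letter_op a (weight v) j)"
      using inflow_first_bond[of a b v j] Cons.prems u by auto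
    finally show ?thesis using u(1) by (simp add: letter_op_def algebra_simps split: if_splits)
  next
    case False
    then obtain b where u: "u = [b]" using Cons.prems
      by (cases u) (auto simp: Suc_le_eq)
    show ?thesis using inflow_last_pair[of a b j] Cons.prems u
      by (simp add: numeral_2_eq_2 kac_label_def)
  qed
qed

text \<open>
  The move at the left end has index \<open>0\<close>; as \<open>(E g) 0 = g 0\<close>, it absorbs the term that is left over
  by the telescoping sum.
\<close>

lemma weight_balance:
  assumes "length u \<ge> 2" "set u \<subseteq> {-1,0,1}"
  shows "(\<Sum>i\<le>length u. kac_label (length u) i * inflow i u 0) = 0"
proof -
  obtain a v where u: "u = a # v" "v \<noteq> []" using assms by (cases u; cases "tl u") auto
  have a: "a \<in> {-1,0,1}" using assms u by auto
  have 0: "inflow 0 u 0 = of_int a * weight v 0"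
    unfolding u by (rule letters_cases[OF a]) (use u in \<open>auto simp: inflow_def move_def active_def weight_Cons letter_op_def\<close>)
  have "(\<Sum>i\<le>length u. kac_label (length u) i * inflow i u 0) =
     kac_label (length u) 0 * inflow 0 u 0 + (\<Sum>i=1..length u. kac_label (length u) i * inflow i u 0)"
    by (simp add: atMost_atLeast0 sum.atLeast_Suc_atMost)
  then show ?thesis using inflow_telescope[OF assms, of 0] 0 assms u by (simp add: kac_label_def)
qed

definition words :: "nat \<Rightarrow> nat \<Rightarrow> int list set" where
  "words n z = {u. length u = n \<and> set u \<subseteq> {-1,0,1} \<and> count_list u 0 = z}"

lemma finite_words [simp]: "finite (words n z)"
proof (rule finite_subset)
  show "words n z \<subseteq> {u. set u \<subseteq> {-1,0,1} \<and> length u = n}" by (auto simp: words_def)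
qed (rule finite_lists_length_eq, simp)

lemma words_Suc: "words (Suc n) z =
   (#) 1 ` words n z \<union> (#) (-1) ` words n z \<union> (if z = 0 then {} else (#) 0 ` words n (z - 1))"
proof (rule set_eqI)
  fix u show "u \<in> words (Suc n) z \<longleftrightarrow> u \<in> (#) 1 ` words n z \<union> (#) (-1) ` words n z \<union> (if z = 0 then {} else (#) 0 ` words n (z - 1))"
    by (cases u) (auto simp: words_def)
qed

lemma sum_words_Suc:
  "(\<Sum>u\<in>words (Suc n) z. f u) = (\<Sum>u\<in>words n z. f (1 # u)) + (\<Sum>u\<in>words n z. f (- 1 # u))
     + (if z = 0 then 0 else \<Sum>u\<in>words n (z - 1). f (0 # u) :: real)"
proof -
  have i: "inj_on ((#) a) A" for a :: int and A by (auto simp: inj_on_def)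
  show ?thesis unfolding words_Suc
    by (subst sum.union_disjoint; (subst sum.union_disjoint)?) (auto simp: sum.reindex i)
qed

definition total_weight :: "nat \<Rightarrow> nat \<Rightarrow> nat \<Rightarrow> real" where
  "total_weight n z j = (\<Sum>u\<in>words n z. weight u j)"

text \<open>
  Summing over the first letter; the letter \<open>0\<close> only feeds index \<open>0\<close>, from words with one zero fewer.
\<close>

lemma total_weight_Suc:
  assumes "n \<ge> 1"
  shows "total_weight (Suc n) z j = 2 * total_weight n z j + total_weight n z (Suc j)
     + (if j = 0 then 0 else total_weight n z (j - 1))
     + (if z = 0 \<or> j > 0 then 0 else total_weight n (z - 1) 0)"
proof -
  have "u \<noteq> []" if "u \<in> words n y" for u y using that assms by (auto simp: words_def)
  then show ?thesis
    by (auto simp: total_weight_def sum_words_Suc weight_Cons letter_op_def sum.distrib)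
qed

lemma words_0: "words 0 z = (if z = 0 then {[]} else {})"
  by (auto simp: words_def)

lemma total_weight_1: "total_weight 1 z j = (if z = 0 then 2 else if z = 1 \<and> j = 0 then 1 else 0)"
  by (auto simp: total_weight_def sum_words_Suc words_0)

lemma binomial_two_steps:
  "real ((2 * n + 2) choose (k + 2)) = real (2 * n choose k) + 2 * real (2 * n choose (k + 1)) + real (2 * n choose (k + 2))"
  by (simp add: numeral_2_eq_2)

text \<open>
  At a positive index the recursion is Pascal's rule applied twice.  At index \<open>0\<close> the neighbour below
  is missing; for \<open>z \<ge> 1\<close> the words with one zero fewer take its place, and for \<open>z = 0\<close> one gets
  partial sums of binomial coefficients instead.
\<close>

lemma total_weight_closed_form:
  assumes "n \<ge> 1"
  shows "total_weight n 0 j = 2 * (\<Sum>i\<le>j. real ((2 * n - 1) choose (n + i)))"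
    and "z \<ge> 1 \<Longrightarrow> total_weight n z j = real (2 * n choose (n + z + j))"
    and "total_weight n 0 0 = real (2 * n choose n)"
proof -
  have "(\<forall>j. total_weight n 0 j = 2 * (\<Sum>i\<le>j. real ((2 * n - 1) choose (n + i)))) \<and>
      (\<forall>z\<ge>1. \<forall>j. total_weight n z j = real (2 * n choose (n + z + j))) \<and>
      total_weight n 0 0 = real (2 * n choose n)" (is "?A n \<and> ?B n \<and> ?C n")
    using assms
  proof (induction n rule: dec_induct)
    case base
    have "(\<Sum>i\<le>j. real (1 choose Suc i)) = 1" for j by (induction j) auto
    then show ?case by (auto simp: total_weight_1[unfolded One_nat_def] numeral_2_eq_2 less_Suc_eq_0_disj binomial_eq_0)
  next
    case (step n)
    have n: "n \<ge> 1" by fact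
    obtain m where m: "n = Suc m" using n by (cases n) auto
    have A: "?A (Suc n)"
    proof
      fix j
      let ?c = "\<lambda>i. real ((2 * n - 1) choose i)"
      have ch: "real ((2 * Suc n - 1) choose (Suc n + i)) = ?c (n + i - 1) + 2 * ?c (n + i) + ?c (n + i + 1)" for i
        unfolding m by (simp add: numeral_2_eq_2)
      have sym: "?c (n - 1) = ?c n"
        using binomial_symmetric[of n "2 * n - 1"] n by (simp add: m)
      have tel: "(\<Sum>i\<le>j. ?c (n + i - 1)) = ?c (n - 1) + (if j = 0 then 0 else \<Sum>i\<le>j - 1. ?c (n + i))"
      proof (cases j)
        case (Suc k)
        show ?thesis unfolding Suc by (subst sum.atMost_Suc_shift) simp
      qed simp
      have tel2: "(\<Sum>i\<le>j. ?c (n + i + 1)) = (\<Sum>i\<le>Suc j. ?c (n + i)) - ?c n"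
        by (subst sum.atMost_Suc_shift) simp
      have "(\<Sum>i\<le>j. real ((2 * Suc n - 1) choose (Suc n + i))) =
         (\<Sum>i\<le>j. ?c (n + i - 1)) + 2 * (\<Sum>i\<le>j. ?c (n + i)) + (\<Sum>i\<le>j. ?c (n + i + 1))"
        unfolding ch by (simp add: sum.distrib sum_distrib_left)
      then show "total_weight (Suc n) 0 j = 2 * (\<Sum>i\<le>j. real ((2 * Suc n - 1) choose (Suc n + i)))"
        using step.IH sym tel tel2 n by (simp add: total_weight_Suc algebra_simps)
    qed
    have B: "?B (Suc n)"
    proof (intro allI impI)
      fix z j :: nat assume z: "1 \<le> z"
      have *: "total_weight n z i = real (2 * n choose (n + z + i))" for i using step.IH z by auto
      have z': "total_weight n (z - 1) 0 = real (2 * n choose (n + (z - 1)))"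
        using step.IH z by (cases "z = 1") auto
      have "real (2 * Suc n choose (Suc n + z + j)) = real ((2 * n + 2) choose ((n + z + j - 1) + 2))"
        using z by (intro arg_cong[of _ _ real] arg_cong2[of _ _ _ _ "(choose)"]) auto
      also note binomial_two_steps
      finally show "total_weight (Suc n) z j = real (2 * Suc n choose (Suc n + z + j))"
        using z n z' by (cases j) (simp_all add: total_weight_Suc *)
    qed
    have "total_weight (Suc n) 0 0 = 2 * real ((2 * Suc n - 1) choose Suc n)" using A by simp
    also have "\<dots> = real (2 * Suc n choose Suc n)"
      using binomial_symmetric[of n "2 * Suc n - 1"] by (simp add: numeral_2_eq_2)
    finally show ?case using A B by blast
  qed
  then show "total_weight n 0 j = 2 * (\<Sum>i\<le>j. real ((2 * n - 1) choose (n + i)))"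
    and "z \<ge> 1 \<Longrightarrow> total_weight n z j = real (2 * n choose (n + z + j))"
    and "total_weight n 0 0 = real (2 * n choose n)" by auto
qed

lemma total_weight_0: "n \<ge> 1 \<Longrightarrow> total_weight n z 0 = real (2 * n choose (n + z))"
  using total_weight_closed_form(2)[of n z 0] total_weight_closed_form(3)[of n] by (cases "z = 0") auto

text \<open>
  The stationary rate of sign changes of the first letter, that is twice the stationary probability
  of the first letter \<open>-1\<close>, for words of length \<open>n\<close> with \<open>z\<close> zeros.
\<close>

definition current :: "nat \<Rightarrow> nat \<Rightarrow> real" where
  "current n z = (real n ^ 2 - real z ^ 2) / (real n * (2 * real n - 1))"

lemma total_weight_ratio:
  assumes "n \<ge> 1" "z \<le> n"
  shows "2 * total_weight n z 0 = current (Suc n) z * total_weight (Suc n) z 0"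
proof -
  have 1: "real (2 * Suc n choose (Suc n + z)) * (real n + 1 + z) * (real n + 1 - z) =
    real (2 * n + 2) * real (2 * n + 1) * real (2 * n choose (n + z))"
  proof -
    have "(2 * n + 2 choose Suc (n + z)) * Suc (n + z) = (2 * n + 2) * (2 * n + 1 choose (n + z))"
      using Suc_times_binomial_eq[of "2 * n + 1" "n + z"] by (simp add: mult.commute)
    moreover have "(2 * n + 1 choose (n + z)) * (n + 1 - z) = (2 * n + 1) * (2 * n choose (n + z))"
      using binomial_absorb_comp[of "2 * n + 1" "n + z"] assms by (simp add: mult.commute)
    moreover have "(c::nat) * a * b = p * q * r" if "c * a = p * d" "d * b = q * r" for a b c d p q r
      using that by (metis mult.assoc)
    ultimately have "(2 * n + 2 choose Suc (n + z)) * Suc (n + z) * (n + 1 - z) =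
        (2 * n + 2) * (2 * n + 1) * (2 * n choose (n + z))"
      by blast
    then have "real ((2 * n + 2 choose Suc (n + z)) * Suc (n + z) * (n + 1 - z)) =
        real ((2 * n + 2) * (2 * n + 1) * (2 * n choose (n + z)))" by presburger
    then have "real (2 * n + 2 choose Suc (n + z)) * real (Suc (n + z)) * real (n + 1 - z) =
        real (2 * n + 2) * real (2 * n + 1) * real (2 * n choose (n + z))"
      by (simp only: of_nat_mult)
    moreover have "real (n + 1 - z) = real n + 1 - z" "real (Suc (n + z)) = real n + 1 + z" using assms by auto
    ultimately show ?thesis by (simp add: add_ac)
  qed
  have pos: "real (Suc n) * (2 * real (Suc n) - 1) \<noteq> 0" by simp
  have "real (Suc n) * (2 * real (Suc n) - 1) * (2 * total_weight n z 0) =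
     (real (Suc n) ^ 2 - real z ^ 2) * total_weight (Suc n) z 0"
  proof -
    define c where "c = real (2 * Suc n choose (Suc n + z))"
    define d where "d = real (2 * n choose (n + z))"
    have "c * (real n + 1 + z) * (real n + 1 - z) = (2 * real n + 2) * (2 * real n + 1) * d"
      using 1 unfolding c_def d_def by (simp only: of_nat_add of_nat_mult of_nat_numeral of_nat_1)
    moreover have "total_weight n z 0 = d" "total_weight (Suc n) z 0 = c"
      using assms by (simp_all only: total_weight_0 c_def d_def le_SucI)
    ultimately show ?thesis by (simp add: power2_eq_square algebra_simps)
  qed
  then show ?thesis using pos unfolding current_def by (simp add: field_simps)
qed

section \<open>The Poisson equation for three-letter words\<close>

text \<open>
  Gaussian elimination, one unknown at a time: subtract multiples of an equation \<open>u0\<close> in which the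
  unknown \<open>v0\<close> occurs.  A relation among the remaining equations becomes a relation among the
  original ones by adjusting its coefficient at \<open>u0\<close>.
\<close>

lemma fredholm_alternative:
  fixes A :: "'u \<Rightarrow> 'v \<Rightarrow> real"
  assumes "finite V" "finite U"
    and "\<And>\<mu>. (\<forall>v\<in>V. (\<Sum>u\<in>U. \<mu> u * A u v) = 0) \<Longrightarrow> (\<Sum>u\<in>U. \<mu> u * \<phi> u) = 0"
  shows "\<exists>h. \<forall>u\<in>U. (\<Sum>v\<in>V. A u v * h v) = \<phi> u"
  using assms(1,3)
proof (induction V arbitrary: A \<phi> rule: finite_induct)
  case empty
  have "\<phi> u = 0" if "u \<in> U" for u
    using empty[of "\<lambda>v. if v = u then 1 else 0"] that assms(2) by (simp add: if_distrib[of "\<lambda>x. x * _"] cong: if_cong)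
  then show ?case by simp
next
  case (insert v0 V)
  show ?case
  proof (cases "\<forall>u\<in>U. A u v0 = 0")
    case True
    have "\<exists>h. \<forall>u\<in>U. (\<Sum>v\<in>V. A u v * h v) = \<phi> u"
      by (rule insert.IH, rule insert.prems) (use True in auto)
    then show ?thesis using insert.hyps True by simp
  next
    case False
    then obtain u0 where u0: "u0 \<in> U" "A u0 v0 \<noteq> 0" by blast
    define r where "r u = A u v0 / A u0 v0" for u
    have "\<exists>h. \<forall>u\<in>U. (\<Sum>v\<in>V. (A u v - r u * A u0 v) * h v) = \<phi> u - r u * \<phi> u0"
    proof (rule insert.IH)
      fix \<mu> assume \<mu>: "\<forall>v\<in>V. (\<Sum>u\<in>U. \<mu> u * (A u v - r u * A u0 v)) = 0"
      \<comment> \<open>the correction at \<open>u0\<close> that makes the lifted relation annihilate the eliminated column\<close>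
      define s where "s = (\<Sum>u\<in>U. \<mu> u * r u)"
      have *: "(\<Sum>u\<in>U. (\<mu> u - (if u = u0 then s else 0)) * g u) = (\<Sum>u\<in>U. \<mu> u * (g u - r u * g u0))" for g
      proof -
        have "(\<Sum>u\<in>U. (\<mu> u - (if u = u0 then s else 0)) * g u) =
           (\<Sum>u\<in>U. \<mu> u * g u) - (\<Sum>u\<in>U. if u = u0 then s * g u else 0)"
          by (subst sum_subtractf[symmetric]) (auto intro!: sum.cong simp: algebra_simps)
        also have "(\<Sum>u\<in>U. if u = u0 then s * g u else 0) = s * g u0"
          using u0(1) assms(2) by simp
        also have "\<dots> = (\<Sum>u\<in>U. \<mu> u * (r u * g u0))"
          unfolding s_def by (simp add: sum_distrib_right mult.assoc)
        finally show ?thesis by (simp add: sum_subtractf algebra_simps)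
      qed
      have "(\<Sum>u\<in>U. (\<mu> u - (if u = u0 then s else 0)) * \<phi> u) = 0"
      proof (rule insert.prems, rule ballI)
        fix v assume "v \<in> insert v0 V"
        then show "(\<Sum>u\<in>U. (\<mu> u - (if u = u0 then s else 0)) * A u v) = 0"
          unfolding * using \<mu> u0(2) by (auto simp: r_def)
      qed
      then show "(\<Sum>u\<in>U. \<mu> u * (\<phi> u - r u * \<phi> u0)) = 0" unfolding * .
    qed
    then obtain h where h: "\<And>u. u \<in> U \<Longrightarrow> (\<Sum>v\<in>V. (A u v - r u * A u0 v) * h v) = \<phi> u - r u * \<phi> u0"
      by blast
    define h0 where "h0 = (\<phi> u0 - (\<Sum>v\<in>V. A u0 v * h v)) / A u0 v0"
    have "(\<Sum>v\<in>insert v0 V. A u v * (h(v0 := h0)) v) = \<phi> u" if "u \<in> U" for u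
    proof -
      have "(\<Sum>v\<in>insert v0 V. A u v * (h(v0 := h0)) v) = A u v0 * h0 + (\<Sum>v\<in>V. A u v * h v)"
        using insert.hyps by (auto intro!: sum.cong)
      also have "(\<Sum>v\<in>V. A u v * h v) = \<phi> u - r u * \<phi> u0 + r u * (\<Sum>v\<in>V. A u0 v * h v)"
        using h[OF that] by (simp add: algebra_simps sum_subtractf sum_distrib_left)
      also have "A u v0 * h0 = r u * (\<phi> u0 - (\<Sum>v\<in>V. A u0 v * h v))"
        by (simp add: h0_def r_def)
      finally show ?thesis by (simp add: algebra_simps)
    qed
    then show ?thesis by blast
  qed
qed

text \<open>
  By the Fredholm alternative it suffices that every signed stationary measure \<open>\<mu>\<close> is a multiple of
  \<open>f\<close>.  For \<open>\<nu> = \<mu> / f\<close> the Dirichlet form \<open>\<Sum> a f (\<nu> (m i u) - \<nu> u)\<^sup>2\<close> over the active moves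
  vanishes, by the balance equations of \<open>f\<close> and \<open>\<mu>\<close>.  Hence \<open>\<nu>\<close> is invariant under the moves, and so
  it is constant by connectedness.
\<close>

lemma poisson_equation_solvable:
  fixes f \<phi> :: "'s \<Rightarrow> real" and a :: "'i \<Rightarrow> real"
  assumes fin: "finite \<Omega>" "finite I"
    and m: "\<And>i u. i \<in> I \<Longrightarrow> u \<in> \<Omega> \<Longrightarrow> m i u \<in> \<Omega>" "\<And>i u. i \<in> I \<Longrightarrow> u \<in> \<Omega> \<Longrightarrow> m i (m i u) = u"
    and a: "\<And>i. i \<in> I \<Longrightarrow> a i > 0" and f: "\<And>u. u \<in> \<Omega> \<Longrightarrow> f u > 0"
    and balance: "\<And>u. u \<in> \<Omega> \<Longrightarrow>
      (\<Sum>i\<in>I. a i * ((if P i (m i u) then f (m i u) else 0) - (if P i u then f u else 0))) = 0"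
    and connected: "\<And>\<nu> :: 's \<Rightarrow> real. (\<And>u i. u \<in> \<Omega> \<Longrightarrow> i \<in> I \<Longrightarrow> P i u \<Longrightarrow> \<nu> (m i u) = \<nu> u) \<Longrightarrow>
      \<exists>c. \<forall>u\<in>\<Omega>. \<nu> u = c"
    and centred: "(\<Sum>u\<in>\<Omega>. f u * \<phi> u) = 0"
  shows "\<exists>h. \<forall>u\<in>\<Omega>. (\<Sum>i\<in>I. if P i u then a i * (h (m i u) - h u) else 0) = \<phi> u"
proof -
  define A where "A u v = (\<Sum>i\<in>I. if P i u then a i * ((if v = m i u then 1 else 0) - (if v = u then 1 else 0)) else 0)" for u v
  have A: "(\<Sum>v\<in>\<Omega>. A u v * h v) = (\<Sum>i\<in>I. if P i u then a i * (h (m i u) - h u) else 0)" if u: "u \<in> \<Omega>" for u h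
  proof -
    have "(\<Sum>v\<in>\<Omega>. A u v * h v) = (\<Sum>i\<in>I. \<Sum>v\<in>\<Omega>. if P i u then (if v = m i u then a i * h v else 0) - (if v = u then a i * h v else 0) else 0)"
      unfolding A_def sum_distrib_right by (subst sum.swap) (auto intro!: sum.cong simp: algebra_simps)
    also have "\<dots> = (\<Sum>i\<in>I. if P i u then a i * (h (m i u) - h u) else 0)"
      using u m(1) fin(1) by (auto intro!: sum.cong simp: sum_subtractf algebra_simps)
    finally show ?thesis .
  qed
  have flip: "(\<Sum>u\<in>\<Omega>. \<Sum>i\<in>I. if P i u then a i * T u * g (m i u) else 0) =
     (\<Sum>v\<in>\<Omega>. g v * (\<Sum>i\<in>I. a i * (if P i (m i v) then T (m i v) else 0)))" for T g :: "'s \<Rightarrow> real"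
  proof -
    have "(\<Sum>u\<in>\<Omega>. if P i u then a i * T u * g (m i u) else 0) = (\<Sum>v\<in>\<Omega>. if P i (m i v) then a i * T (m i v) * g v else 0)"
      if "i \<in> I" for i
      by (rule sum.reindex_bij_witness[of _ "m i" "m i"]) (use m that in auto)
    then have "(\<Sum>u\<in>\<Omega>. \<Sum>i\<in>I. if P i u then a i * T u * g (m i u) else 0) =
      (\<Sum>i\<in>I. \<Sum>v\<in>\<Omega>. if P i (m i v) then a i * T (m i v) * g v else 0)"
      by (subst sum.swap) simp
    also have "\<dots> = (\<Sum>v\<in>\<Omega>. g v * (\<Sum>i\<in>I. a i * (if P i (m i v) then T (m i v) else 0)))"
      by (subst sum.swap) (auto simp: sum_distrib_left intro!: sum.cong)
    finally show ?thesis .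
  qed
  have "\<exists>h. \<forall>u\<in>\<Omega>. (\<Sum>v\<in>\<Omega>. A u v * h v) = \<phi> u"
  proof (rule fredholm_alternative[OF fin(1) fin(1)])
    fix \<mu> assume \<mu>: "\<forall>v\<in>\<Omega>. (\<Sum>u\<in>\<Omega>. \<mu> u * A u v) = 0"
    have \<mu>_bal: "(\<Sum>i\<in>I. a i * (if P i (m i v) then \<mu> (m i v) else 0)) = (\<Sum>i\<in>I. if P i v then a i * \<mu> v else 0)"
      if v: "v \<in> \<Omega>" for v
    proof -
      let ?g = "\<lambda>x. if x = v then 1 else (0::real)"
      have "0 = (\<Sum>u\<in>\<Omega>. \<mu> u * (\<Sum>w\<in>\<Omega>. A u w * ?g w))"
        using \<mu> v fin(1) by (simp add: if_distrib[of "\<lambda>x. _ * x"] cong: if_cong)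
      also have "\<dots> = (\<Sum>u\<in>\<Omega>. \<Sum>i\<in>I. if P i u then a i * \<mu> u * ?g (m i u) else 0)
          - (\<Sum>u\<in>\<Omega>. \<Sum>i\<in>I. if P i u then a i * \<mu> u * ?g u else 0)"
        by (subst sum_subtractf[symmetric], rule sum.cong[OF refl], subst sum_subtractf[symmetric], simp only: A sum_distrib_left)
           (auto intro!: sum.cong simp: algebra_simps)
      also have "(\<Sum>u\<in>\<Omega>. \<Sum>i\<in>I. if P i u then a i * \<mu> u * ?g u else 0) = (\<Sum>u\<in>\<Omega>. if u = v then (\<Sum>i\<in>I. if P i u then a i * \<mu> u else 0) else 0)"
        by (rule sum.cong) (auto intro!: sum.cong sum.neutral)
      also have "\<dots> = (\<Sum>i\<in>I. if P i v then a i * \<mu> v else 0)" using v fin(1) by simp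
      also have "(\<Sum>u\<in>\<Omega>. \<Sum>i\<in>I. if P i u then a i * \<mu> u * ?g (m i u) else 0) =
          (\<Sum>x\<in>\<Omega>. if x = v then (\<Sum>i\<in>I. a i * (if P i (m i x) then \<mu> (m i x) else 0)) else 0)"
        using flip[of \<mu> ?g] by (simp add: if_distrib[of "\<lambda>x. x * _"] cong: if_cong)
      also have "\<dots> = (\<Sum>i\<in>I. a i * (if P i (m i v) then \<mu> (m i v) else 0))" using v fin(1) by simp
      finally show ?thesis by simp
    qed
    have f_bal: "(\<Sum>i\<in>I. a i * (if P i (m i v) then f (m i v) else 0)) = (\<Sum>i\<in>I. if P i v then a i * f v else 0)"
      if "v \<in> \<Omega>" for v
    proof -
      have "(\<Sum>i\<in>I. a i * (if P i (m i v) then f (m i v) else 0)) - (\<Sum>i\<in>I. if P i v then a i * f v else 0) =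
        (\<Sum>i\<in>I. a i * ((if P i (m i v) then f (m i v) else 0) - (if P i v then f v else 0)))"
        unfolding sum_subtractf[symmetric] by (intro sum.cong) (auto simp: algebra_simps)
      then show ?thesis using balance[OF that] by simp
    qed
    define \<nu> where "\<nu> u = \<mu> u / f u" for u
    have \<mu>_eq: "\<mu> u = f u * \<nu> u" if "u \<in> \<Omega>" for u using f[OF that] by (simp add: \<nu>_def)
    \<comment> \<open>the Dirichlet form of \<open>\<nu>\<close>, which expands into three sums that cancel\<close>
    let ?Q = "\<lambda>u i. if P i u then a i * f u * (\<nu> (m i u) - \<nu> u)\<^sup>2 else 0"
    have "(\<Sum>u\<in>\<Omega>. \<Sum>i\<in>I. ?Q u i) =
       (\<Sum>u\<in>\<Omega>. \<Sum>i\<in>I. if P i u then a i * f u * (\<nu> (m i u))\<^sup>2 else 0)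
       - 2 * (\<Sum>u\<in>\<Omega>. \<Sum>i\<in>I. if P i u then a i * \<mu> u * \<nu> (m i u) else 0)
       + (\<Sum>u\<in>\<Omega>. \<Sum>i\<in>I. if P i u then a i * f u * (\<nu> u)\<^sup>2 else 0)"
      unfolding sum_distrib_left sum_subtractf[symmetric] sum.distrib[symmetric]
      by (intro sum.cong refl) (auto simp: \<mu>_eq power2_eq_square algebra_simps)
    also have "\<dots> = (\<Sum>v\<in>\<Omega>. (\<nu> v)\<^sup>2 * (\<Sum>i\<in>I. if P i v then a i * f v else 0))
       - 2 * (\<Sum>v\<in>\<Omega>. \<nu> v * (\<Sum>i\<in>I. if P i v then a i * \<mu> v else 0))
       + (\<Sum>u\<in>\<Omega>. \<Sum>i\<in>I. if P i u then a i * f u * (\<nu> u)\<^sup>2 else 0)"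
      using flip[of f "\<lambda>v. (\<nu> v)\<^sup>2"] flip[of \<mu> \<nu>] f_bal \<mu>_bal by (simp cong: sum.cong)
    also have "\<dots> = (\<Sum>v\<in>\<Omega>. \<Sum>i\<in>I. 0)"
      unfolding sum_distrib_left sum_subtractf[symmetric] sum.distrib[symmetric]
      by (intro sum.cong refl) (auto simp: \<mu>_eq power2_eq_square algebra_simps)
    finally have Q0: "(\<Sum>u\<in>\<Omega>. \<Sum>i\<in>I. ?Q u i) = 0" by simp
    have Qnn: "?Q u i \<ge> 0" if "u \<in> \<Omega>" "i \<in> I" for u i
      using a[OF that(2)] f[OF that(1)] by simp
    have "?Q u i = 0" if "u \<in> \<Omega>" "i \<in> I" for u i
    proof -
      have "(\<Sum>i\<in>I. ?Q u i) = 0"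
        using Q0 that(1) fin Qnn by (subst (asm) sum_nonneg_eq_0_iff) (auto intro!: sum_nonneg)
      then show ?thesis using that fin Qnn by (subst (asm) sum_nonneg_eq_0_iff) auto
    qed
    then have "\<nu> (m i u) = \<nu> u" if "u \<in> \<Omega>" "i \<in> I" "P i u" for u i
      using that a[OF that(2)] f[OF that(1)] by fastforce
    then obtain c where c: "\<And>u. u \<in> \<Omega> \<Longrightarrow> \<nu> u = c" using connected[of \<nu>] by blast
    have "(\<Sum>u\<in>\<Omega>. \<mu> u * \<phi> u) = c * (\<Sum>u\<in>\<Omega>. f u * \<phi> u)"
      using c \<mu>_eq by (auto simp: sum_distrib_left algebra_simps intro!: sum.cong)
    then show "(\<Sum>u\<in>\<Omega>. \<mu> u * \<phi> u) = 0" using centred by simp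
  qed
  then show ?thesis using A by auto
qed

lemma mset_abs_move:
  assumes "length u \<ge> 2" "i \<le> length u"
  shows "mset (map abs (move i u)) = mset (map abs u)"
proof -
  have swap: "mset (v[j := v ! k, k := v ! j]) = mset v" if "j < length v" "k < length v" for v :: "int list" and j k
    using that mset_swap[of k v j] by (simp add: that)
  consider "i = 0" | "i > 0" "i < length u" | "i > 0" "i = length u" using assms by linarith
  then show ?thesis
  proof cases
    case 1
    then have "map abs (move i u) = map abs u" using assms by (cases u) (auto simp: move_def)
    then show ?thesis by simp
  next
    case 2
    then show ?thesis using swap[of "i - 1" "map abs u" i] by (simp add: move_def map_update)
  next
    case 3
    then show ?thesis using swap[of "i - 2" "map abs u" "i - 1"] assms by (simp add: move_def map_update)
  qed
qed

lemma move_move: "length u \<ge> 2 \<Longrightarrow> i \<le> length u \<Longrightarrow> move i (move i u) = u"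
proof -
  assume l: "length u \<ge> 2" and i: "i \<le> length u"
  obtain k where k: "length u = Suc (Suc k)" using l by (metis Suc_le_D add_2_eq_Suc' le_Suc_ex add.commute)
  consider "i = 0" | j where "i = Suc j" "Suc j < length u" | "i > 0" "\<not> i < length u"
    by (metis not0_implies_Suc zero_less_Suc)
  then show ?thesis
    by cases (rule nth_equalityI; simp add: move_def k nth_list_update)+
qed

lemma words_abs: "u \<in> words n z \<longleftrightarrow> length u = n \<and> set (map abs u) \<subseteq> {0,1} \<and> count (mset (map abs u)) 0 = z"
proof -
  have "count (mset (map abs u)) 0 = count_list u 0" by (induction u) auto
  moreover have "set (map abs u) \<subseteq> {0,1} \<longleftrightarrow> set u \<subseteq> {-1,0,1}"   proof -
    have "\<bar>x\<bar> \<in> {0,1} \<longleftrightarrow> x \<in> {-1,0,1}" for x :: int by (simp add: abs_if; presburger)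
    then show ?thesis unfolding set_map by blast
  qed
  ultimately show ?thesis by (auto simp: words_def)
qed

lemma move_in_words:
  assumes "u \<in> words n z" "n \<ge> 2" "i \<le> n"
  shows "move i u \<in> words n z"
proof -
  have m: "mset (map abs (move i u)) = mset (map abs u)"
    using assms by (intro mset_abs_move) (auto simp: words_def)
  then have "set (map abs (move i u)) = set (map abs u)" by (metis set_mset_mset)
  with m show ?thesis using assms(1) unfolding words_abs by simp
qed

lemma active_or_fixed:
  assumes l: "length u \<ge> 2"
  shows "active i u \<or> active i (move i u) \<or> move i u = u"
proof -
  obtain k where k: "length u = Suc (Suc k)" using l by (metis Suc_le_D add_2_eq_Suc' le_Suc_ex add.commute)
  consider "i = 0" | j where "i = Suc j" "Suc j < length u" | "i > 0" "\<not> i < length u"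
    by (metis not0_implies_Suc zero_less_Suc)
  then have "\<not> active i u \<Longrightarrow> \<not> active i (move i u) \<Longrightarrow> move i u = u"
    by cases (rule nth_equalityI; auto simp: move_def active_def k nth_list_update split: if_splits)+
  then show ?thesis by blast
qed

text \<open>
  Exchanges of neighbours generate all rearrangements, and a letter \<open>-1\<close> can be moved to the front,
  turned into \<open>1\<close> and moved back.  So every word reaches the word with all zeros in front of all ones.
\<close>

lemma words_connected:
  fixes \<nu> :: "int list \<Rightarrow> real"
  assumes n: "n \<ge> 2"
    and inv: "\<And>u i. u \<in> words n z \<Longrightarrow> i \<le> n \<Longrightarrow> active i u \<Longrightarrow> \<nu> (move i u) = \<nu> u"
  shows "\<exists>c. \<forall>u\<in>words n z. \<nu> u = c"
proof -
  have inv': "\<nu> (move i u) = \<nu> u" if u: "u \<in> words n z" and i: "i \<le> n" for u i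
  proof -
    have l: "length u = n" using u by (simp add: words_def)
    consider "active i u" | "active i (move i u)" | "move i u = u" using active_or_fixed[of u i] l n by auto
    then show ?thesis
    proof cases
      case 2
      then show ?thesis using inv[OF move_in_words[OF u n i] i] move_move[of u i] l n i by simp
    qed (use inv[OF u i] in auto)
  qed
  have swap: "\<nu> (p @ x # y # q) = \<nu> (p @ y # x # q)" if "p @ x # y # q \<in> words n z" for p x y q
  proof -
    have "move (Suc (length p)) (p @ x # y # q) = p @ y # x # q"
      by (simp add: move_def nth_append list_update_append)
    moreover have "Suc (length p) \<le> n" using that by (auto simp: words_def)
    ultimately show ?thesis using inv'[OF that] by metis
  qed
  have words_perm: "p \<in> words n z \<longleftrightarrow> q \<in> words n z" if "mset p = mset q" for p q
    using that unfolding words_abs by (metis mset_map mset_eq_length set_mset_mset)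
  have shift: "\<nu> (p @ x # w @ q) = \<nu> (p @ w @ x # q)" if "p @ x # w @ q \<in> words n z" for p x w q
    using that
  proof (induction w arbitrary: p)
    case (Cons y w)
    have "\<nu> (p @ x # y # w @ q) = \<nu> (p @ y # x # w @ q)" using swap[of p x y "w @ q"] Cons.prems by simp
    moreover have "(p @ [y]) @ x # w @ q \<in> words n z"
      using Cons.prems words_perm[of "p @ x # (y # w) @ q" "(p @ [y]) @ x # w @ q"] by simp
    ultimately show ?case using Cons.IH[of "p @ [y]"] by simp
  qed simp
  have cnt0: "count_list (replicate k (0::int)) 0 = k" "count_list (replicate k (1::int)) 0 = 0" for k
    by (induction k) auto
  define canon where "canon u = replicate (count_list u (0::int)) 0 @ replicate (length u - count_list u 0) (1::int)" for u
  have "\<nu> (p @ u) = \<nu> (p @ canon u)" if "p @ u \<in> words n z" for p u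
    using that
  proof (induction u arbitrary: p)
    case Nil
    then show ?case by (simp add: canon_def)
  next
    case (Cons a u)
    let ?k = "count_list u 0"
    have k: "?k \<le> length u" by (rule count_le_length)
    have a: "a \<in> {-1,0,1}" using Cons.prems by (auto simp: words_def)
    have 1: "\<nu> (p @ a # u) = \<nu> (p @ a # canon u)" using Cons.IH[of "p @ [a]"] Cons.prems by simp
    have cnt: "length (canon u) = length u" "set (canon u) \<subseteq> {-1,0,1}" "count_list (canon u) 0 = ?k"
      using k cnt0 by (auto simp: canon_def)
    have w: "p @ a # canon u \<in> words n z" using Cons.prems cnt by (auto simp: words_def)
    have pos: "\<nu> (p @ 1 # canon u) = \<nu> (p @ canon (1 # u))" if "p @ 1 # canon u \<in> words n z"
      using shift[of p 1 "replicate ?k 0" "replicate (length u - ?k) 1"] that k by (simp add: canon_def Suc_diff_le)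
    show ?case
    proof (rule letters_cases[OF a])
      assume "a = 0" then show ?thesis using 1 by (simp add: canon_def)
    next
      assume "a = 1" then show ?thesis using 1 w pos by simp
    next
      assume a: "a = -1"
      have w1: "[] @ 1 # p @ canon u \<in> words n z" and w2: "[] @ -1 # p @ canon u \<in> words n z"
        and w3: "p @ 1 # canon u \<in> words n z"
        using w a by (auto simp: words_def)
      have "\<nu> (p @ -1 # canon u) = \<nu> (-1 # p @ canon u)" using shift[OF w2] by simp
      also have "\<dots> = \<nu> (1 # p @ canon u)" using inv'[of "1 # p @ canon u" 0] w1 by (simp add: move_def)
      also have "\<dots> = \<nu> (p @ 1 # canon u)" using shift[OF w1] by simp
      also have "\<dots> = \<nu> (p @ canon (1 # u))" using pos w3 by simp
      finally show ?thesis using 1 a by (simp add: canon_def)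
    qed
  qed
  from this[of "[]"] show ?thesis by (auto simp: words_def canon_def)
qed

lemma weight_pos: "weight u 0 > 0"
proof -
  have "weight u 0 > 0 \<and> (\<forall>j. weight u j \<ge> 0)"
    by (induction u rule: weight.induct) (auto simp: letter_op_def add_pos_nonneg)
  then show ?thesis ..
qed

text \<open>
  Dropping an initial \<open>-1\<close> preserves the weight, so the words that start with \<open>-1\<close> contribute the
  total weight for length \<open>n\<close>.
\<close>

lemma sum_weight_first_minus:
  assumes "n \<ge> 1" "z \<le> n"
  shows "(\<Sum>u\<in>words (Suc n) z. weight u 0 * (current (Suc n) z - (if u ! 0 = -1 then 2 else 0))) = 0"
proof -
  have ne: "u \<noteq> []" if "u \<in> words n y" for u y using that assms by (auto simp: words_def)
  have "(\<Sum>u\<in>words (Suc n) z. weight u 0 * (current (Suc n) z - (if u ! 0 = -1 then 2 else 0))) =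
     current (Suc n) z * total_weight (Suc n) z 0 - (\<Sum>u\<in>words (Suc n) z. if u ! 0 = -1 then 2 * weight u 0 else 0)"
    unfolding total_weight_def sum_distrib_left sum_subtractf[symmetric] by (intro sum.cong) (auto simp: algebra_simps)
  also have "(\<Sum>u\<in>words (Suc n) z. if u ! 0 = -1 then 2 * weight u 0 else 0) = 2 * total_weight n z 0"
    using ne by (simp add: sum_words_Suc total_weight_def sum_distrib_left weight_Cons letter_op_def)
  finally show ?thesis using total_weight_ratio[OF assms] by simp
qed

text \<open>
  The left-hand side is the generator of the process on words, in which an active move \<open>i\<close> has rate
  \<open>kac_label n i\<close>, applied to \<open>h\<close>.
\<close>

definition solves_poisson :: "nat \<Rightarrow> nat \<Rightarrow> (int list \<Rightarrow> real) \<Rightarrow> bool" where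
  "solves_poisson n z h \<longleftrightarrow> (\<forall>u\<in>words n z.
     (\<Sum>i\<le>n. if active i u then kac_label n i * (h (move i u) - h u) else 0)
       = current n z - (if u ! 0 = -1 then 2 else 0))"

lemma words_poisson_equation:
  assumes "n \<ge> 2" "z < n"
  shows "\<exists>h. solves_poisson n z h"
  unfolding solves_poisson_def
proof (rule poisson_equation_solvable[where f = "\<lambda>u. weight u 0"])
  show "move i u \<in> words n z" if "i \<in> {..n}" "u \<in> words n z" for i u
    using that assms move_in_words by auto
  show "move i (move i u) = u" if "i \<in> {..n}" "u \<in> words n z" for i u
    using that assms by (intro move_move) (auto simp: words_def)
  show "kac_label n i > 0" for i by (simp add: kac_label_def)
  show "(\<Sum>i\<le>n. kac_label n i * ((if active i (move i u) then weight (move i u) 0 else 0)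
     - (if active i u then weight u 0 else 0))) = 0" if "u \<in> words n z" for u
    using weight_balance[of u] that assms by (simp add: words_def inflow_def)
  show "\<exists>c. \<forall>u\<in>words n z. \<nu> u = c"
    if "\<And>u i. u \<in> words n z \<Longrightarrow> i \<in> {..n} \<Longrightarrow> active i u \<Longrightarrow> \<nu> (move i u) = \<nu> u" for \<nu> :: "int list \<Rightarrow> real"
    using words_connected[OF assms(1), of z \<nu>] that by simp
  show "(\<Sum>u\<in>words n z. weight u 0 * (current n z - (if u ! 0 = -1 then 2 else 0))) = 0"
    using sum_weight_first_minus[of "n - 1" z] assms by simp
qed (auto simp: weight_pos)

section \<open>Coarsening signed permutations to three-letter words\<close>

text \<open>
  The projection of labels to signs that forgets all labels of absolute value below \<open>k\<close>; being odd and
  monotone, it is compatible with the moves.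
\<close>

definition coarsen :: "nat \<Rightarrow> int \<Rightarrow> int" where
  "coarsen k a = (if \<bar>a\<bar> \<ge> int k then sgn a else 0)"

lemma coarsen_uminus: "coarsen k (- a) = - coarsen k a"
  by (simp add: coarsen_def)

lemma coarsen_mono: "a \<le> b \<Longrightarrow> coarsen k a \<le> coarsen k b"
  by (auto simp: coarsen_def sgn_if)

lemma coarsen_letter: "coarsen k a \<in> {-1, 0, 1}"
  by (auto simp: coarsen_def sgn_if)

lemma coarsen_eq_0: "k \<ge> 1 \<Longrightarrow> coarsen k a = 0 \<longleftrightarrow> \<bar>a\<bar> < int k"
  by (auto simp: coarsen_def sgn_if)

lemma move_coarsen:
  assumes "length u \<ge> 2" "i \<le> length u"
  shows "move i (map (coarsen k) u) = map (coarsen k) (move i u)"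
proof -
  have l: "length u - 2 < length u" "length u - 1 < length u" "0 < length u" using assms(1) by auto
  then have ne: "u \<noteq> []" by auto
  consider "i = 0" | "0 < i" "i < length u" "i - 1 < length u" | "i = length u" using assms by linarith
  then show ?thesis by cases (use l ne in \<open>simp_all add: move_def map_update coarsen_uminus\<close>)
qed

lemma active_coarsen:
  assumes "length u \<ge> 2" "i \<le> length u" "active i (map (coarsen k) u)"
  shows "active i u"
proof -
  have l: "length u - 2 < length u" "length u - 1 < length u" "0 < length u" using assms by auto
  consider "i = 0" | "0 < i" "i < length u" | "i = length u" using assms by linarith
  then show ?thesis
  proof cases
    case 1
    then have "coarsen k (u ! 0) < 0" using assms(3) l by (simp add: active_def)
    then show ?thesis using 1 coarsen_mono[of 0 "u ! 0" k] by (auto simp: active_def coarsen_def not_less split: if_splits)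
  next
    case 2
    then have "coarsen k (u ! i) < coarsen k (u ! (i - 1))" using assms(3) by (simp add: active_def)
    then have "u ! i < u ! (i - 1)" using coarsen_mono[of "u ! (i - 1)" "u ! i" k] by linarith
    then show ?thesis using 2 by (simp add: active_def)
  next
    case 3
    let ?a = "u ! (length u - 2)" and ?b = "u ! (length u - 1)"
    have "coarsen k ?a + coarsen k ?b > 0" using assms(1,3) 3 l by (simp add: active_def)
    then have "coarsen k (- ?b) < coarsen k ?a" by (simp add: coarsen_uminus)
    then have "- ?b < ?a" using coarsen_mono[of ?a "- ?b" k] by linarith
    then have "0 < ?a + ?b" by simp
    then show ?thesis using 3 l unfolding active_def by simp
  qed
qed

lemma active_move_inactive:
  assumes "length u \<ge> 2" "i \<le> length u" "active i u"
  shows "\<not> active i (move i u)"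
proof -
  obtain m where m: "length u = Suc (Suc m)" using assms(1) by (metis Suc_le_D add_2_eq_Suc' le_Suc_ex add.commute)
  consider "i = 0" | j where "i = Suc j" "Suc j < length u" | "i > 0" "\<not> i < length u"
    by (metis not0_implies_Suc zero_less_Suc)
  then show ?thesis
    by cases (use assms(3) in \<open>auto simp: active_def move_def m nth_list_update\<close>)
qed

text \<open>
  An active move of the labels is invisible after coarsening unless it is active there too, so
  (with \<open>active_coarsen\<close>) the coarsened process is again Markovian.
\<close>

lemma coarse_step_cases:
  assumes "length u \<ge> 2" "i \<le> length u" "active i u"
  shows "active i (map (coarsen k) u) \<or> map (coarsen k) (move i u) = map (coarsen k) u"
proof -
  have "\<not> active i (map (coarsen k) (move i u))"
    using active_coarsen[of "move i u" i k] active_move_inactive[OF assms] assms by auto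
  then show ?thesis
    using active_or_fixed[of "map (coarsen k) u" i] assms move_coarsen[of u i k] by auto
qed

definition minus_count :: "int list \<Rightarrow> real" where
  "minus_count u = sum_list (map (\<lambda>a. if a = -1 then 1 else 0) u)"

lemma minus_count_update:
  "k < length u \<Longrightarrow> minus_count (u[k := a]) = minus_count u + (if a = -1 then 1 else 0) - (if u ! k = -1 then 1 else 0)"
proof (induction u arbitrary: k)
  case (Cons b u)
  then show ?case by (cases k) (auto simp: minus_count_def)
qed simp

lemma minus_count_bounds: "0 \<le> minus_count u" "minus_count u \<le> length u"
  by (induction u) (auto simp: minus_count_def)

text \<open>
  The gain at the right end is also the gain of the lattice part of an alcove there, which is why the
  difference of the two only sees the left end.
\<close>

lemma minus_count_move:
  assumes "length u \<ge> 2" "i \<le> length u" "set u \<subseteq> {-1,0,1}"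
  shows "minus_count (move i u) = minus_count u +
    (if i = 0 then u ! 0 else if i < length u then 0 else u ! (length u - 2) + u ! (length u - 1))"
proof -
  have letter: "(if - a = -1 then 1 else 0) - (if a = -1 then 1 else 0) = real_of_int a" if "a \<in> set u" for a
    using that assms(3) by auto
  have l: "length u - 2 < length u" "length u - 1 < length u" "0 < length u" "length u - 2 \<noteq> length u - 1" using assms by auto
  consider "i = 0" | "0 < i" "i < length u" | "i = length u" using assms by linarith
  then show ?thesis
  proof cases
    case 1
    have "minus_count (move i u) = minus_count u + ((if - u ! 0 = -1 then 1 else 0) - (if u ! 0 = -1 then 1 else 0))"
      using 1 l by (simp add: move_def minus_count_update)
    then show ?thesis using letter[of "u ! 0"] l 1 by simp
  next
    case 2
    then show ?thesis by (simp add: move_def minus_count_update)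
  next
    case 3
    let ?a = "u ! (length u - 2)" and ?b = "u ! (length u - 1)"
    have "minus_count (move i u) = minus_count u + ((if - ?a = -1 then 1 else 0) - (if ?a = -1 then 1 else 0))
       + ((if - ?b = -1 then 1 else 0) - (if ?b = -1 then 1 else 0))"
      using 3 l assms(1) by (simp add: move_def minus_count_update)
    then show ?thesis using letter[of ?a] letter[of ?b] l 3 assms(1) by simp
  qed
qed

section \<open>A strong law for Markov paths\<close>

text \<open>
  Between \<open>m\<^sup>2\<close> and \<open>(m + 1)\<^sup>2\<close> the sequence changes by at most \<open>2 m C\<close>, which is \<open>o(m\<^sup>2)\<close>.
\<close>

lemma tendsto_0_from_squares:
  fixes w :: "nat \<Rightarrow> real"
  assumes incr: "\<And>t. \<bar>w (Suc t) - w t\<bar> \<le> C"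
    and sq: "(\<lambda>m. w (m ^ 2) / real (m ^ 2)) \<longlonglongrightarrow> 0"
  shows "(\<lambda>t. w t / real t) \<longlonglongrightarrow> 0"
proof (rule LIMSEQ_I)
  fix r :: real assume r: "r > 0"
  have C: "C \<ge> 0" using incr[of 0] by linarith
  have steps: "\<bar>w (s + d) - w s\<bar> \<le> real d * C" for s d
  proof (induction d)
    case (Suc d)
    then show ?case using incr[of "s + d"] by (simp add: algebra_simps)
  qed simp
  obtain m1 where m1: "\<And>m. m \<ge> m1 \<Longrightarrow> \<bar>w (m ^ 2) / real (m ^ 2)\<bar> < r / 2"
    using LIMSEQ_D[OF sq, of "r / 2"] r by auto
  obtain m2 :: nat where m2: "real m2 > 4 * C / r" using reals_Archimedean2 by blast
  define m0 where "m0 = Suc (max m1 m2)"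
  have "norm (w t / real t - 0) < r" if t: "t \<ge> m0 ^ 2" for t
  proof -
    have bnd: "\<forall>y. y ^ 2 \<le> t \<longrightarrow> y \<le> t" by (metis power2_nat_le_imp_le)
    define m where "m = (GREATEST y. y ^ 2 \<le> t)"
    have m: "m ^ 2 \<le> t" unfolding m_def by (rule GreatestI_nat[of _ m0 t]) (use t bnd in auto)
    have mm0: "m \<ge> m0" unfolding m_def by (rule Greatest_le_nat[of _ _ t]) (use t bnd in auto)
    have "\<not> Suc m ^ 2 \<le> t"
      using Greatest_le_nat[of "\<lambda>y. y ^ 2 \<le> t" "Suc m" t] bnd unfolding m_def by fastforce
    then have d: "t - m ^ 2 \<le> 2 * m" by (simp add: power2_eq_square algebra_simps)
    have mpos: "m > 0" using mm0 by (simp add: m0_def)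
    have tpos: "t > 0" using m mpos by (metis gr_zeroI le_zero_eq power_eq_0_iff not_gr0 zero_less_numeral)
    have "\<bar>w t\<bar> \<le> \<bar>w (m ^ 2)\<bar> + real (t - m ^ 2) * C"
      using steps[of "m ^ 2" "t - m ^ 2"] m by simp
    also have "\<dots> \<le> \<bar>w (m ^ 2)\<bar> + real (2 * m) * C"
      using d C by (intro add_left_mono mult_right_mono of_nat_mono) auto
    also have "\<dots> < r / 2 * real (m ^ 2) + r / 2 * real (m ^ 2)"
    proof (rule add_less_le_mono)
      show "\<bar>w (m ^ 2)\<bar> < r / 2 * real (m ^ 2)"
        using m1[of m] mm0 mpos by (simp add: m0_def abs_divide divide_less_eq)
      have "4 * C / r < real m" using m2 mm0 by (simp add: m0_def)
      then have "4 * C \<le> r * real m" using r by (simp add: field_simps)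
      then have "4 * C * real m \<le> r * real m * real m" by (rule mult_right_mono) simp
      then show "real (2 * m) * C \<le> r / 2 * real (m ^ 2)" by (simp add: power2_eq_square algebra_simps)
    qed
    also have "\<dots> = r * real (m ^ 2)" by simp
    also have "\<dots> \<le> r * real t" using m r by (intro mult_left_mono of_nat_mono) auto
    finally show ?thesis using tpos by (simp add: abs_divide divide_less_eq)
  qed
  then show "\<exists>no. \<forall>n\<ge>no. norm (w n / real n - 0) < r" by blast
qed

lemma bounded_over_index_tendsto_0:
  fixes b :: "nat \<Rightarrow> real"
  assumes "\<forall>\<^sub>F t in sequentially. \<bar>b t\<bar> \<le> C"
  shows "(\<lambda>t. b t / real t) \<longlonglongrightarrow> 0"
proof (rule tendsto_rabs_zero_cancel, rule tendsto_sandwich[of "\<lambda>_. 0" _ _ "\<lambda>t. C / real t"])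
  show "\<forall>\<^sub>F t in sequentially. \<bar>b t / real t\<bar> \<le> C / real t"
    using assms by eventually_elim (simp add: divide_right_mono)
  show "(\<lambda>t. C / real t) \<longlonglongrightarrow> 0" by (rule lim_const_over_n)
qed simp_all

text \<open>
  The Markov property is stated for path prefixes.  The kernel \<open>K\<close> is used only through its values on
  the class \<open>R\<close> of reachable states, where it has finite support.
\<close>

locale markov_path = prob_space M for M :: "'w measure" +
  fixes X :: "nat \<Rightarrow> 'w \<Rightarrow> 'a" and S :: "'a set" and K :: "'a \<Rightarrow> 'a \<Rightarrow> real"
    and x0 :: 'a and R :: "'a set" and nb :: "'a \<Rightarrow> 'a set"
  assumes countable_S: "countable S"
    and measurable_X [measurable]: "\<And>t. X t \<in> measurable M (count_space S)"
    and markov: "\<And>t A. measure M {\<omega> \<in> space M. \<forall>s\<le>Suc t. X s \<omega> = A s} =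
        measure M {\<omega> \<in> space M. \<forall>s\<le>t. X s \<omega> = A s} * K (A t) (A (Suc t))"
    and start: "AE \<omega> in M. X 0 \<omega> = x0"
    and x0_R: "x0 \<in> R"
    and finite_nb: "\<And>A. A \<in> R \<Longrightarrow> finite (nb A)"
    and nb_R: "\<And>A. A \<in> R \<Longrightarrow> nb A \<subseteq> R"
    and K_nb: "\<And>A B. A \<in> R \<Longrightarrow> B \<notin> nb A \<Longrightarrow> K A B = 0"
begin

definition prefix :: "nat \<Rightarrow> 'w \<Rightarrow> 'a list" where
  "prefix t \<omega> = map (\<lambda>s. X s \<omega>) [0..<Suc t]"

definition cyl :: "nat \<Rightarrow> 'a list \<Rightarrow> 'w set" where
  "cyl t l = {\<omega> \<in> space M. prefix t \<omega> = l}"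

text \<open>
  A finite set of paths that carries the law of the first \<open>t\<close> steps, so that expectations are finite
  sums.
\<close>

fun paths :: "nat \<Rightarrow> 'a list set" where
  "paths 0 = {[x0]}"
| "paths (Suc t) = (\<Union>l\<in>paths t. (\<lambda>B. l @ [B]) ` nb (last l))"

lemma X_in_S: "\<omega> \<in> space M \<Longrightarrow> X t \<omega> \<in> S"
  using measurable_space[OF measurable_X] by simp

lemma prefix_Suc: "prefix (Suc t) \<omega> = prefix t \<omega> @ [X (Suc t) \<omega>]"
  by (simp add: prefix_def)

lemma length_prefix [simp]: "length (prefix t \<omega>) = Suc t"
  by (simp add: prefix_def)

lemma paths_props: "l \<in> paths t \<Longrightarrow> length l = Suc t \<and> set l \<subseteq> R \<and> l \<noteq> []"
proof (induction t arbitrary: l)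
  case (Suc t)
  then obtain l' B where "l' \<in> paths t" "l = l' @ [B]" "B \<in> nb (last l')" by auto
  then show ?case using Suc.IH[of l'] nb_R[of "last l'"] last_in_set[of l'] by fastforce
qed (simp add: x0_R)

lemma last_path_R: "l \<in> paths t \<Longrightarrow> last l \<in> R"
  using paths_props last_in_set by blast

lemma finite_paths: "finite (paths t)"
  by (induction t) (auto intro: finite_nb last_path_R)

lemma cyl_eq:
  assumes "length l = Suc t"
  shows "cyl t l = {\<omega> \<in> space M. \<forall>s\<le>t. X s \<omega> = l ! s}"
  using assms by (auto simp: cyl_def prefix_def list_eq_iff_nth_eq less_Suc_eq_le nth_append simp del: upt_Suc)

lemma measurable_prefix: "prefix t \<in> measurable M (count_space (lists S))"
proof (subst measurable_count_space_eq_countable, goal_cases countable measurable)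
  case countable
  show "countable (lists S)" using countable_S by (rule countable_lists)
next
  case measurable
  show ?case
  proof (intro conjI ballI)
    show "prefix t \<in> space M \<rightarrow> lists S" using X_in_S by (auto simp: prefix_def)
    fix l
  have "prefix t -` {l} \<inter> space M = cyl t l" by (auto simp: cyl_def)
  also have "\<dots> \<in> sets M"
  proof (cases "length l = Suc t")
    case True
    have "{\<omega> \<in> space M. X s \<omega> = a} \<in> sets M" for s a
    proof -
      have "X s -` ({a} \<inter> S) \<inter> space M \<in> sets M" by (rule measurable_sets[OF measurable_X]) auto
      also have "X s -` ({a} \<inter> S) \<inter> space M = {\<omega> \<in> space M. X s \<omega> = a}" using X_in_S by auto
      finally show ?thesis .
    qed
    then have "{\<omega> \<in> space M. \<forall>s\<in>{..t}. X s \<omega> = l ! s} \<in> sets M"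
      by (intro sets.sets_Collect_finite_All) auto
    then show ?thesis unfolding cyl_eq[OF True] by simp
  next
    case False
    then have "cyl t l = {}" by (auto simp: cyl_def)
    then show ?thesis by simp
  qed
  finally show "prefix t -` {l} \<inter> space M \<in> sets M" .
  qed
qed

lemma measurable_cyl [measurable]: "cyl t l \<in> sets M"
proof -
  have "prefix t -` ({l} \<inter> lists S) \<inter> space M \<in> sets M"
    by (rule measurable_sets[OF measurable_prefix]) auto
  also have "prefix t -` ({l} \<inter> lists S) \<inter> space M = cyl t l"
    using measurable_space[OF measurable_prefix] by (auto simp: cyl_def)
  finally show ?thesis .
qed

lemma borel_measurable_prefix [measurable]: "(\<lambda>\<omega>. G (prefix t \<omega>)) \<in> borel_measurable M"
  by (rule measurable_compose[OF measurable_prefix]) simp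

lemma measure_cyl_Suc:
  assumes "l \<in> paths t"
  shows "measure M (cyl (Suc t) (l @ [B])) = measure M (cyl t l) * K (last l) B"
proof -
  have l: "length l = Suc t" "l \<noteq> []" using paths_props[OF assms] by auto
  have 1: "cyl (Suc t) (l @ [B]) = {\<omega> \<in> space M. \<forall>s\<le>Suc t. X s \<omega> = (l @ [B]) ! s}"
    using l by (intro cyl_eq) simp
  have 2: "cyl t l = {\<omega> \<in> space M. \<forall>s\<le>t. X s \<omega> = (l @ [B]) ! s}"
    using l by (auto simp: cyl_eq nth_append less_Suc_eq_le)
  show ?thesis unfolding 1 2 markov using l by (simp add: nth_append last_conv_nth)
qed

lemma AE_prefix: "AE \<omega> in M. prefix t \<omega> \<in> paths t"
proof (induction t)
  case 0
  then show ?case using start by (simp add: prefix_def)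
next
  case (Suc t)
  have null: "AE \<omega> in M. \<omega> \<notin> cyl (Suc t) (l @ [B])" if "l \<in> paths t" "B \<in> S - nb (last l)" for l B
  proof (rule AE_not_in)
    have "measure M (cyl (Suc t) (l @ [B])) = 0"
      using measure_cyl_Suc[OF that(1)] K_nb[OF last_path_R[OF that(1)]] that by auto
    then show "cyl (Suc t) (l @ [B]) \<in> null_sets M"
      by (intro null_setsI) (auto simp: emeasure_eq_measure)
  qed
  have "AE \<omega> in M. \<forall>l\<in>paths t. \<forall>B\<in>S - nb (last l). \<omega> \<notin> cyl (Suc t) (l @ [B])"
    using finite_paths countable_S null
    by (intro AE_ball_countable' ) (auto intro: countable_finite)
  then show ?case using Suc AE_space
    by eventually_elim (use X_in_S in \<open>force simp: cyl_def prefix_Suc\<close>)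
qed

lemma expectation_prefix:
  fixes G :: "'a list \<Rightarrow> real"
  shows "integrable M (\<lambda>\<omega>. G (prefix t \<omega>))"
    and "expectation (\<lambda>\<omega>. G (prefix t \<omega>)) = (\<Sum>l\<in>paths t. G l * measure M (cyl t l))"
proof -
  have ae: "AE \<omega> in M. G (prefix t \<omega>) = (\<Sum>l\<in>paths t. G l * indicator (cyl t l) \<omega>)"
    using AE_prefix[of t] AE_space
  proof eventually_elim
    case (elim \<omega>)
    have "(\<Sum>l\<in>paths t. G l * indicator (cyl t l) \<omega>) = (\<Sum>l\<in>paths t. if l = prefix t \<omega> then G l else 0)"
      using elim by (intro sum.cong) (auto simp: cyl_def indicator_def)
    then show ?case using elim finite_paths by simp
  qed
  have int: "integrable M (\<lambda>\<omega>. \<Sum>l\<in>paths t. G l * indicator (cyl t l) \<omega>)"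
    by (intro Bochner_Integration.integrable_sum integrable_mult_right)
       (auto intro!: integrable_real_indicator simp: emeasure_eq_measure)
  show "integrable M (\<lambda>\<omega>. G (prefix t \<omega>))"
    by (rule integrable_cong_AE_imp[OF int]) (use ae in \<open>auto elim: eventually_mono\<close>)
  have "expectation (\<lambda>\<omega>. G (prefix t \<omega>)) = expectation (\<lambda>\<omega>. \<Sum>l\<in>paths t. G l * indicator (cyl t l) \<omega>)"
    by (rule integral_cong_AE) (use ae in auto)
  also have "\<dots> = (\<Sum>l\<in>paths t. G l * measure M (cyl t l))"
    by (subst Bochner_Integration.integral_sum)
       (auto intro!: integrable_real_indicator integrable_mult_right simp: emeasure_eq_measure)
  finally show "expectation (\<lambda>\<omega>. G (prefix t \<omega>)) = (\<Sum>l\<in>paths t. G l * measure M (cyl t l))" .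
qed

lemma AE_path: "AE \<omega> in M. \<forall>t. X t \<omega> \<in> R \<and> X (Suc t) \<omega> \<in> nb (X t \<omega>)"
proof -
  have "AE \<omega> in M. \<forall>t. prefix (Suc t) \<omega> \<in> paths (Suc t)"
    using AE_prefix by (subst AE_all_countable) blast
  then show ?thesis
  proof eventually_elim
    case (elim \<omega>)
    show ?case
    proof
      fix t
      obtain l B where lB: "l \<in> paths t" "prefix (Suc t) \<omega> = l @ [B]" "B \<in> nb (last l)"
        using elim[rule_format, of t] by auto
      moreover have "last (prefix t \<omega>) = X t \<omega>" by (simp add: prefix_def)
      ultimately show "X t \<omega> \<in> R \<and> X (Suc t) \<omega> \<in> nb (X t \<omega>)"
        using last_path_R[OF lB(1)] by (auto simp: prefix_Suc)
    qed
  qed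
qed

text \<open>
  The sum is a martingale with bounded increments, so its second moment at time \<open>t\<close> is at most \<open>C\<^sup>2 t\<close>.
  Along the squares the second moments of the averages are summable, hence the averages tend to \<open>0\<close>
  almost surely along the squares, and the increments between squares are negligible.
\<close>

lemma strong_law:
  fixes Y :: "'a \<Rightarrow> 'a \<Rightarrow> real"
  assumes bounded: "\<And>A B. \<bar>Y A B\<bar> \<le> C"
    and centred: "\<And>A. A \<in> R \<Longrightarrow> (\<Sum>B\<in>nb A. K A B * Y A B) = 0"
  shows "AE \<omega> in M. (\<lambda>t. (\<Sum>s<t. Y (X s \<omega>) (X (Suc s) \<omega>)) / real t) \<longlonglongrightarrow> 0"
proof -
  define W where "W t \<omega> = (\<Sum>s<t. Y (X s \<omega>) (X (Suc s) \<omega>))" for t \<omega>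
  define V where "V l = (\<Sum>s<length l - 1. Y (l ! s) (l ! Suc s))" for l
  have C: "C \<ge> 0" using bounded[of undefined undefined] by linarith
  have WV: "W t \<omega> = V (prefix t \<omega>)" for t \<omega>
    unfolding W_def V_def by (auto simp: prefix_def nth_append simp del: upt_Suc intro!: sum.cong)
  have [measurable]: "W t \<in> borel_measurable M" for t
    using borel_measurable_prefix[of V t] by (simp add: WV[abs_def])
  have E2: "integrable M (\<lambda>\<omega>. (W t \<omega>)\<^sup>2) \<and> expectation (\<lambda>\<omega>. (W t \<omega>)\<^sup>2) \<le> C\<^sup>2 * real t" for t
  proof (induction t)
    case 0
    then show ?case by (simp add: W_def)
  next
    case (Suc t)
    define G where "G l = V (butlast l) * Y (l ! t) (l ! Suc t)" for l
    have Y2: "(Y A B)\<^sup>2 \<le> C\<^sup>2" for A B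
      using bounded[of A B] by (metis abs_ge_zero power2_abs power_mono)
    let ?Y = "\<lambda>\<omega>. Y (X t \<omega>) (X (Suc t) \<omega>)"
    have G: "G (prefix (Suc t) \<omega>) = W t \<omega> * ?Y \<omega>" for \<omega>
      unfolding G_def WV by (simp add: prefix_Suc nth_append) (simp add: prefix_def nth_append)
    have Yp: "?Y \<omega> = (\<lambda>l. Y (l ! t) (l ! Suc t)) (prefix (Suc t) \<omega>)" for \<omega>
      by (auto simp: prefix_def nth_append)
    \<comment> \<open>orthogonality of the increments: condition on the prefix of length \<open>t\<close>\<close>
    have "expectation (\<lambda>\<omega>. W t \<omega> * ?Y \<omega>) = (\<Sum>l\<in>paths (Suc t). G l * measure M (cyl (Suc t) l))"
      unfolding G[symmetric] by (rule expectation_prefix(2))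
    also have "\<dots> = (\<Sum>l\<in>paths t. \<Sum>B\<in>nb (last l). G (l @ [B]) * measure M (cyl (Suc t) (l @ [B])))"
      unfolding paths.simps using finite_paths finite_nb[OF last_path_R]
      by (subst sum.UNION_disjoint) (auto simp: sum.reindex inj_on_def)
    also have "\<dots> = (\<Sum>l\<in>paths t. V l * measure M (cyl t l) * (\<Sum>B\<in>nb (last l). K (last l) B * Y (last l) B))"
      unfolding sum_distrib_left
    proof (intro sum.cong refl)
      fix l B assume l: "l \<in> paths t"
      have "length l = Suc t" "l \<noteq> []" using paths_props[OF l] by auto
      then show "G (l @ [B]) * measure M (cyl (Suc t) (l @ [B])) =
          V l * measure M (cyl t l) * (K (last l) B * Y (last l) B)"
        unfolding measure_cyl_Suc[OF l] by (simp add: G_def nth_append last_conv_nth)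
    qed
    also have "\<dots> = 0" using centred last_path_R by (intro sum.neutral) auto
    finally have cross: "expectation (\<lambda>\<omega>. W t \<omega> * ?Y \<omega>) = 0" .
    have i1: "integrable M (\<lambda>\<omega>. W t \<omega> * ?Y \<omega>)"
      unfolding G[symmetric] by (rule expectation_prefix(1))
    have i2: "integrable M (\<lambda>\<omega>. (?Y \<omega>)\<^sup>2)" unfolding Yp by (rule expectation_prefix(1))
    have "(W (Suc t) \<omega>)\<^sup>2 = (W t \<omega>)\<^sup>2 + 2 * (W t \<omega> * ?Y \<omega>) + (?Y \<omega>)\<^sup>2" for \<omega>
      by (simp add: W_def power2_eq_square algebra_simps)
    moreover have "expectation (\<lambda>\<omega>. (?Y \<omega>)\<^sup>2) \<le> expectation (\<lambda>\<omega>. C\<^sup>2)"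
      by (intro integral_mono i2) (auto intro: Y2)
    ultimately show ?case using Suc i1 i2 cross by (simp add: algebra_simps prob_space)
  qed
  \<comment> \<open>squared averages along the square times\<close>
  define T where "T m \<omega> = (W (Suc m ^ 2) \<omega> / real (Suc m ^ 2))\<^sup>2" for m \<omega>
  have [measurable]: "T m \<in> borel_measurable M" for m unfolding T_def by measurable
  have ET: "(\<integral>\<^sup>+ \<omega>. ennreal (T m \<omega>) \<partial>M) \<le> ennreal (C\<^sup>2 * (1 / real (Suc m) ^ 2))" for m
  proof -
    have "integrable M (T m)" unfolding T_def power_divide using E2 by (intro integrable_divide) auto
    then have "(\<integral>\<^sup>+ \<omega>. ennreal (T m \<omega>) \<partial>M) = ennreal (expectation (T m))"
      by (rule nn_integral_eq_integral) (simp add: T_def)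
    also have "expectation (T m) = expectation (\<lambda>\<omega>. (W (Suc m ^ 2) \<omega>)\<^sup>2) / (real (Suc m ^ 2))\<^sup>2"
      unfolding T_def power_divide by simp
    also have "\<dots> \<le> C\<^sup>2 * real (Suc m ^ 2) / (real (Suc m ^ 2))\<^sup>2"
      using conjunct2[OF E2[of "Suc m ^ 2"]] by (rule divide_right_mono) simp
    also have "\<dots> = C\<^sup>2 * (1 / real (Suc m) ^ 2)"
      unfolding of_nat_power by (simp add: power2_eq_square del: of_nat_Suc)
    finally show ?thesis by (simp add: ennreal_leI)
  qed
  have summ: "summable (\<lambda>m. C\<^sup>2 * (1 / real (Suc m) ^ 2))"
    using inverse_power_summable[of 2, where 'a = real]
    by (intro summable_mult) (subst summable_Suc_iff, simp add: divide_inverse)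
  have "(\<integral>\<^sup>+ \<omega>. (\<Sum>m. ennreal (T m \<omega>)) \<partial>M) = (\<Sum>m. \<integral>\<^sup>+ \<omega>. ennreal (T m \<omega>) \<partial>M)"
    by (rule nn_integral_suminf) measurable
  also have "\<dots> \<le> (\<Sum>m. ennreal (C\<^sup>2 * (1 / real (Suc m) ^ 2)))"
    by (intro suminf_le ET) auto
  also have "\<dots> = ennreal (\<Sum>m. C\<^sup>2 * (1 / real (Suc m) ^ 2))"
    by (rule suminf_ennreal2[OF _ summ]) auto
  finally have "(\<integral>\<^sup>+ \<omega>. (\<Sum>m. ennreal (T m \<omega>)) \<partial>M) \<noteq> \<infinity>"
    using ennreal_less_top neq_top_trans by (metis infinity_ennreal_def ennreal_neq_top)
  then have "AE \<omega> in M. (\<Sum>m. ennreal (T m \<omega>)) \<noteq> \<infinity>"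
    by (intro nn_integral_noteq_infinite) measurable
  then have "AE \<omega> in M. (\<lambda>t. W t \<omega> / real t) \<longlonglongrightarrow> 0"
  proof eventually_elim
    case (elim \<omega>)
    have "summable (\<lambda>m. T m \<omega>)"
      by (rule summable_suminf_not_top) (use elim in \<open>auto simp: T_def\<close>)
    then have "(\<lambda>m. T m \<omega>) \<longlonglongrightarrow> 0" by (rule summable_LIMSEQ_zero)
    then have "(\<lambda>m. W (Suc m ^ 2) \<omega> / real (Suc m ^ 2)) \<longlonglongrightarrow> 0"
      unfolding T_def by (simp only: power_tendsto_0_iff zero_less_numeral)
    then have sq: "(\<lambda>m. W (m ^ 2) \<omega> / real (m ^ 2)) \<longlonglongrightarrow> 0" by (rule LIMSEQ_imp_Suc)
    show ?case by (rule tendsto_0_from_squares[OF _ sq, of C]) (simp add: W_def bounded)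
  qed
  then show ?thesis by (simp add: W_def)
qed

end

section \<open>The root system in coordinates\<close>

text \<open>
  Carrying \<open>n\<close> as a parameter keeps the coordinate arguments free of the type-level cardinality.
\<close>

locale root_frame =
  fixes e :: "nat \<Rightarrow> real ^ 'n" and n :: nat
  assumes n_card: "n = CARD('n)" and n2: "n \<ge> 2" and bij_e: "bij_betw e {1..n} Basis"
begin

definition axis_vectors :: "(real ^ 'n) set" where
  "axis_vectors = e ` {1..n} \<union> (\<lambda>i. - e i) ` {1..n}"

text \<open>
  Pairing with \<open>rho\<close> turns a basis vector into its index; a root is positive if and only if its
  product with \<open>rho\<close> is.  In particular \<open>lin w (e j) \<bullet> rho\<close> is the label of \<open>w\<close> at position \<open>j\<close>.
\<close>

definition rho :: "real ^ 'n" where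
  "rho = (\<Sum>i=1..n. real i *\<^sub>R e i)"

text \<open>
  Pairing with \<open>ones\<close> gives the coordinate sum, whose parity cuts out the coroot lattice.
\<close>

definition ones :: "real ^ 'n" where
  "ones = (\<Sum>i=1..n. e i)"

abbreviation \<Phi> :: "(real ^ 'n) set" where "\<Phi> \<equiv> root_system_B e"
abbreviation A0 :: "(real ^ 'n) set" where "A0 \<equiv> fundamental_alcove e"
abbreviation G :: "(real ^ 'n \<Rightarrow> real ^ 'n) set" where "G \<equiv> affine_weyl_group e"

lemma inner_e: "i \<in> {1..n} \<Longrightarrow> j \<in> {1..n} \<Longrightarrow> e i \<bullet> e j = (if i = j then 1 else 0)"
proof -
  assume ij: "i \<in> {1..n}" "j \<in> {1..n}"
  then have "e i \<in> Basis" "e j \<in> Basis" using bij_betwE[OF bij_e] by auto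
  moreover have "e i = e j \<longleftrightarrow> i = j" using inj_on_eq_iff[OF bij_betw_imp_inj_on[OF bij_e] ij] .
  ultimately show ?thesis by (simp add: inner_Basis)
qed

lemma coordinate_sum: "j \<in> {1..n} \<Longrightarrow> (\<Sum>i=1..n. c i *\<^sub>R e i) \<bullet> e j = c j"
proof -
  assume j: "j \<in> {1..n}"
  have "(\<Sum>i=1..n. c i *\<^sub>R e i) \<bullet> e j = (\<Sum>i=1..n. if i = j then c i else 0)"
    unfolding inner_sum_left using j by (intro sum.cong) (auto simp: inner_e)
  then show ?thesis using j by simp
qed

lemma expand: "x = (\<Sum>i=1..n. (x \<bullet> e i) *\<^sub>R e i)"
  using sum.reindex_bij_betw[OF bij_e, of "\<lambda>b. (x \<bullet> b) *\<^sub>R b"] euclidean_representation[of x] by simp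

lemma coord_eqI: "(\<And>i. i \<in> {1..n} \<Longrightarrow> x \<bullet> e i = y \<bullet> e i) \<Longrightarrow> x = y"
  by (rule trans[OF expand[of x] trans[OF _ expand[of y, symmetric]]]) (rule sum.cong, simp_all)

lemma rho_e: "j \<in> {1..n} \<Longrightarrow> rho \<bullet> e j = real j"
  unfolding rho_def by (rule coordinate_sum)

lemma ones_e: "j \<in> {1..n} \<Longrightarrow> ones \<bullet> e j = 1"
  unfolding ones_def using coordinate_sum[of j "\<lambda>_. 1"] by simp

lemma axis_cases:
  assumes "b \<in> axis_vectors"
  obtains i where "i \<in> {1..n}" "b = e i" | i where "i \<in> {1..n}" "b = - e i"
  using assms by (auto simp: axis_vectors_def)

lemma axis_uminus: "b \<in> axis_vectors \<Longrightarrow> - b \<in> axis_vectors"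
  by (auto simp: axis_vectors_def)

lemma e_axis: "i \<in> {1..n} \<Longrightarrow> e i \<in> axis_vectors"
  by (auto simp: axis_vectors_def)

lemma axis_inner: "b \<in> axis_vectors \<Longrightarrow> c \<in> axis_vectors \<Longrightarrow> b = c \<and> b \<bullet> c = 1 \<or> b = - c \<and> b \<bullet> c = -1 \<or> b \<bullet> c = 0"
  by (elim axis_cases) (auto simp: inner_e split: if_splits)

lemma axis_unit: "b \<in> axis_vectors \<Longrightarrow> b \<bullet> b = 1"
  by (elim axis_cases) (auto simp: inner_e)

lemma axis_ones: "b \<in> axis_vectors \<Longrightarrow> b \<bullet> ones = 1 \<or> b \<bullet> ones = -1"
  by (elim axis_cases) (auto simp: ones_e inner_commute[of _ ones])

lemma axis_Ints: "b \<in> axis_vectors \<Longrightarrow> c \<in> axis_vectors \<Longrightarrow> b \<bullet> c \<in> \<int>"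
  using axis_inner[of b c] by auto

lemma roots_eq: "\<Phi> = axis_vectors \<union> {b + c | b c. b \<in> axis_vectors \<and> c \<in> axis_vectors \<and> b \<bullet> c = 0}"
proof (rule set_eqI, rule iffI)
  fix x assume "x \<in> \<Phi>"
  then consider s t i j where "x = s *\<^sub>R e i + t *\<^sub>R e j" "s \<in> {-1,1::real}" "t \<in> {-1,1::real}" "1 \<le> i" "i < j" "j \<le> n"
    | s i where "x = s *\<^sub>R e i" "s \<in> {-1,1::real}" "1 \<le> i" "i \<le> n"
    unfolding root_system_B_def n_card[symmetric] by blast
  then show "x \<in> axis_vectors \<union> {b + c | b c. b \<in> axis_vectors \<and> c \<in> axis_vectors \<and> b \<bullet> c = 0}"
  proof cases
    case 1
    then have "s *\<^sub>R e i \<in> axis_vectors" "t *\<^sub>R e j \<in> axis_vectors" "(s *\<^sub>R e i) \<bullet> (t *\<^sub>R e j) = 0"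
      by (auto simp: axis_vectors_def inner_e)
    then show ?thesis using 1(1) by blast
  next
    case 2
    then show ?thesis by (auto simp: axis_vectors_def)
  qed
next
  fix x assume x: "x \<in> axis_vectors \<union> {b + c | b c. b \<in> axis_vectors \<and> c \<in> axis_vectors \<and> b \<bullet> c = 0}"
  have ax: "\<exists>s i. b = s *\<^sub>R e i \<and> s \<in> {-1,1::real} \<and> i \<in> {1..n}" if "b \<in> axis_vectors" for b
  proof (cases rule: axis_cases[OF that])
    case (1 i)
    then show ?thesis by (intro exI[of _ 1] exI[of _ i]) auto
  next
    case (2 i)
    then show ?thesis by (intro exI[of _ "-1"] exI[of _ i]) auto
  qed
  have pair: "s *\<^sub>R e i + t *\<^sub>R e j \<in> \<Phi>" if "s \<in> {-1,1}" "t \<in> {-1,1}" "1 \<le> i" "i < j" "j \<le> n" for s t i j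
    unfolding root_system_B_def n_card[symmetric]
    by (intro UnI1 CollectI exI[of _ s] exI[of _ t] exI[of _ i] exI[of _ j] conjI refl that)
  from x consider "x \<in> axis_vectors" | b c where "x = b + c" "b \<in> axis_vectors" "c \<in> axis_vectors" "b \<bullet> c = 0"
    by blast
  then show "x \<in> \<Phi>"
  proof cases
    case 1
    then show ?thesis using ax[of x] unfolding root_system_B_def n_card[symmetric] by auto
  next
    case 2
    obtain s i where b: "b = s *\<^sub>R e i" "s \<in> {-1,1::real}" "i \<in> {1..n}" using ax[OF 2(2)] by blast
    obtain t j where c: "c = t *\<^sub>R e j" "t \<in> {-1,1::real}" "j \<in> {1..n}" using ax[OF 2(3)] by blast
    have "i \<noteq> j" using 2(4) b c by (auto simp: inner_e)
    then show ?thesis using pair[of s t i j] pair[of t s j i] b c 2(1) by (cases "i < j") (auto simp: add.commute)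
  qed
qed

lemma roots_uminus: "\<gamma> \<in> \<Phi> \<Longrightarrow> - \<gamma> \<in> \<Phi>"
proof -
  assume "\<gamma> \<in> \<Phi>"
  then consider "\<gamma> \<in> axis_vectors" | b c where "\<gamma> = b + c" "b \<in> axis_vectors" "c \<in> axis_vectors" "b \<bullet> c = 0"
    unfolding roots_eq by blast
  then show ?thesis
  proof cases
    case 2
    have "- \<gamma> = - b + - c" "- b \<in> axis_vectors" "- c \<in> axis_vectors" "(- b) \<bullet> (- c) = 0"
      using 2 axis_uminus by auto
    then show ?thesis unfolding roots_eq by blast
  qed (auto simp: roots_eq axis_uminus)
qed

lemma finite_roots: "finite \<Phi>"
proof -
  have "finite axis_vectors" by (simp add: axis_vectors_def)
  moreover have "\<Phi> \<subseteq> axis_vectors \<union> (\<lambda>(b, c). b + c) ` (axis_vectors \<times> axis_vectors)"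
    unfolding roots_eq by auto
  ultimately show ?thesis by (meson finite_SigmaI finite_Un finite_imageI finite_subset)
qed

lemma positive_root_cases:
  assumes "\<gamma> \<in> \<Phi>"
  obtains (axis) s i where "\<gamma> = s *\<^sub>R e i" "s \<in> {-1,1::real}" "i \<in> {1..n}"
  | (pair) s t i j where "\<gamma> = s *\<^sub>R (e j + t *\<^sub>R e i)" "s \<in> {-1,1::real}" "t \<in> {-1,1::real}" "i \<in> {1..n}" "j \<in> {1..n}" "i < j"
proof -
  consider s t i j where "\<gamma> = s *\<^sub>R e i + t *\<^sub>R e j" "s \<in> {-1,1::real}" "t \<in> {-1,1::real}" "1 \<le> i" "i < j" "j \<le> n"
    | s i where "\<gamma> = s *\<^sub>R e i" "s \<in> {-1,1::real}" "1 \<le> i" "i \<le> n"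
    using assms unfolding root_system_B_def n_card[symmetric] by blast
  then show thesis
  proof cases
    case 1
    then have "\<gamma> = t *\<^sub>R (e j + (s * t) *\<^sub>R e i)" "s * t \<in> {-1,1}" by (auto simp: algebra_simps)
    then show ?thesis using pair[of t j "s * t" i] 1 by auto
  next
    case 2
    then show ?thesis using axis[of s i] by auto
  qed
qed

lemma root_rho_sign:
  assumes "\<gamma> \<in> \<Phi>"
  shows "\<gamma> \<bullet> rho \<noteq> 0"
  using assms by (cases rule: positive_root_cases) (auto simp: inner_add_left inner_add_right inner_diff_right rho_e inner_commute[of _ rho])

text \<open>
  The inner normals of the fundamental alcove: its walls are uniformly \<open>x \<bullet> wall_root i = wall_level i\<close>
  with the alcove above, the last one being \<open>x \<bullet> (- \<theta>) = - 1\<close>.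
\<close>

definition wall_root :: "nat \<Rightarrow> real ^ 'n" where
  "wall_root i = (if i < n then simple_root e i else - highest_root e)"

definition wall_level :: "nat \<Rightarrow> int" where
  "wall_level i = (if i < n then 0 else - 1)"

definition wall_reflection :: "nat \<Rightarrow> real ^ 'n \<Rightarrow> real ^ 'n" where
  "wall_reflection i = affine_reflection (wall_root i) (wall_level i)"

lemma wall_root_simps:
  "wall_root 0 = e 1"
  "0 < i \<Longrightarrow> i < n \<Longrightarrow> wall_root i = e (Suc i) - e i"
  "wall_root n = - e (n - 1) - e n"
  using n2 by (auto simp: wall_root_def simple_root_def highest_root_def n_card[symmetric])

lemma wall_root_in_roots: "i \<le> n \<Longrightarrow> wall_root i \<in> \<Phi>"
proof -
  assume i: "i \<le> n"
  consider "i = 0" | "0 < i" "i < n" | "i = n" using i by linarith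
  then show ?thesis
  proof cases
    case 1
    then show ?thesis using n2 e_axis by (simp add: roots_eq wall_root_simps)
  next
    case 2
    have "e (Suc i) \<bullet> - e i = 0" "e (Suc i) \<in> axis_vectors" "- e i \<in> axis_vectors" "wall_root i = e (Suc i) + - e i"
      using 2 by (auto simp: inner_e wall_root_simps intro!: e_axis axis_uminus)
    then show ?thesis unfolding roots_eq by blast
  next
    case 3
    have "(- e (n - 1)) \<bullet> (- e n) = 0" "- e (n - 1) \<in> axis_vectors" "- e n \<in> axis_vectors" "wall_root i = - e (n - 1) + - e n"
      using 3 n2 by (auto simp: inner_e wall_root_simps intro!: e_axis axis_uminus)
    then show ?thesis unfolding roots_eq by blast
  qed
qed

lemma fundamental_wall_eq: "i \<le> n \<Longrightarrow> fundamental_wall e i = {x. x \<bullet> wall_root i = wall_level i}"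
  by (auto simp: fundamental_wall_def hyperplane_def wall_root_def wall_level_def n_card[symmetric])

lemma A0_eq: "A0 = {x. \<forall>i\<le>n. x \<bullet> wall_root i > wall_level i}"
  unfolding fundamental_alcove_def n_card[symmetric] wall_root_def wall_level_def
  by (auto simp: le_less)

lemma chamber_coords:
  assumes "x \<in> identity_chamber e" "i \<in> {1..n}" "j \<in> {1..n}"
  shows "x \<bullet> e i > 0" and "i < j \<Longrightarrow> x \<bullet> e i < x \<bullet> e j"
proof -
  have s: "x \<bullet> e k < x \<bullet> e (Suc k)" if "1 \<le> k" "k < n" for k
    using assms(1) that by (auto simp: identity_chamber_def n_card[symmetric] simple_root_def inner_diff_right dest!: spec[of _ k])
  have m: "x \<bullet> e i < x \<bullet> e j" if "i < j" "1 \<le> i" "j \<le> n" for i j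
    using that(1,3)
  proof (induction j)
    case (Suc j)
    then show ?case using s[of j] that(2) by (cases "i = j") auto
  qed simp
  then show "i < j \<Longrightarrow> x \<bullet> e i < x \<bullet> e j" using assms by auto
  have "x \<bullet> e 1 > 0" using assms(1) n2 by (auto simp: identity_chamber_def n_card[symmetric] simple_root_def dest!: spec[of _ 0])
  then show "x \<bullet> e i > 0" using m[of 1 i] assms(2) by (cases "i = 1") auto
qed

lemma A0_in_chamber: "A0 \<subseteq> identity_chamber e"
  by (auto simp: fundamental_alcove_def identity_chamber_def)

lemma chamber_positive_root:
  assumes "x \<in> identity_chamber e" "\<gamma> \<in> \<Phi>" "\<gamma> \<bullet> rho > 0"
  shows "x \<bullet> \<gamma> > 0"
  using assms(2)
proof (cases rule: positive_root_cases)
  case (axis s i)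
  then show ?thesis using assms(3) chamber_coords[OF assms(1) axis(3) axis(3)]
    by (auto simp: rho_e inner_commute[of _ rho])
next
  case (pair s t i j)
  then show ?thesis using assms(3) chamber_coords[OF assms(1) pair(4,5)] chamber_coords[OF assms(1) pair(5,4)]
    by (auto simp: rho_e inner_commute[of _ rho] inner_add_right inner_diff_right)
qed

lemma A0_positive_root:
  assumes "x \<in> A0" "\<gamma> \<in> \<Phi>" "\<gamma> \<bullet> rho > 0"
  shows "0 < x \<bullet> \<gamma>" "x \<bullet> \<gamma> < 1"
proof -
  have C: "x \<in> identity_chamber e" using assms(1) A0_in_chamber by auto
  show "0 < x \<bullet> \<gamma>" by (rule chamber_positive_root[OF C assms(2,3)])
  have top: "x \<bullet> e (n - 1) + x \<bullet> e n < 1"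
    using assms(1) by (simp add: fundamental_alcove_def highest_root_def n_card inner_add_right)
  have le: "x \<bullet> e i \<le> x \<bullet> e j" if "i \<in> {1..n}" "j \<in> {1..n}" "i \<le> j" for i j
    using chamber_coords(2)[OF C that(1,2)] that(3) by (cases "i = j") auto
  have pos: "x \<bullet> e i > 0" if "i \<in> {1..n}" for i using chamber_coords(1)[OF C that that] .
  show "x \<bullet> \<gamma> < 1"
    using assms(2)
  proof (cases rule: positive_root_cases)
    case (axis s i)
    then have "\<gamma> = e i" using assms(3) by (auto simp: rho_e inner_commute[of _ rho])
    moreover have "x \<bullet> e i \<le> x \<bullet> e n" "x \<bullet> e (n - 1) > 0" using le[of i n] pos[of "n - 1"] axis(3) n2 by auto
    ultimately show ?thesis using top by simp
  next
    case (pair s t i j)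
    then have "s = 1" using assms(3) by (auto simp: rho_e inner_commute[of _ rho] inner_add_right inner_diff_right)
    moreover have "x \<bullet> e j \<le> x \<bullet> e n" "x \<bullet> e i \<le> x \<bullet> e (n - 1)" "x \<bullet> e i > 0" "x \<bullet> e j > 0"
      using le[of j n] le[of i "n - 1"] pos[of i] pos[of j] pair(4-6) by auto
    ultimately show ?thesis using pair(1,3) top by (auto simp: inner_add_right inner_diff_right)
  qed
qed

section \<open>Alcoves as regions of constant floors\<close>

definition regular :: "real ^ 'n \<Rightarrow> bool" where
  "regular x \<longleftrightarrow> (\<forall>\<gamma>\<in>\<Phi>. x \<bullet> \<gamma> \<notin> \<int>)"

text \<open>
  Alcoves are the classes of equal integer parts of all root products; this form is preserved by every
  isometry that permutes roots and translates root products by integers.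
\<close>

definition region :: "real ^ 'n \<Rightarrow> (real ^ 'n) set" where
  "region p = {y. regular y \<and> (\<forall>\<gamma>\<in>\<Phi>. \<lfloor>y \<bullet> \<gamma>\<rfloor> = \<lfloor>p \<bullet> \<gamma>\<rfloor>)}"

lemma complement_hyperplanes: "- (\<Union>\<alpha>\<in>\<Phi>. \<Union>k. hyperplane \<alpha> k) = {x. regular x}"
  by (auto simp: regular_def hyperplane_def Ints_def)

lemma convex_region: "convex (region p)"
proof -
  have "region p = (\<Inter>\<gamma>\<in>\<Phi>. {y. \<gamma> \<bullet> y > \<lfloor>p \<bullet> \<gamma>\<rfloor>} \<inter> {y. \<gamma> \<bullet> y < \<lfloor>p \<bullet> \<gamma>\<rfloor> + 1})"
  proof (intro set_eqI iffI)
    fix y assume y: "y \<in> region p"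
    have "\<lfloor>p \<bullet> \<gamma>\<rfloor> < y \<bullet> \<gamma> \<and> y \<bullet> \<gamma> < \<lfloor>p \<bullet> \<gamma>\<rfloor> + 1" if "\<gamma> \<in> \<Phi>" for \<gamma>
    proof -
      have "y \<bullet> \<gamma> \<noteq> of_int \<lfloor>y \<bullet> \<gamma>\<rfloor>" using y that unfolding region_def regular_def by (metis (mono_tags, lifting) Ints_of_int mem_Collect_eq)
      moreover have "\<lfloor>y \<bullet> \<gamma>\<rfloor> = \<lfloor>p \<bullet> \<gamma>\<rfloor>" using y that unfolding region_def by auto
      ultimately show ?thesis by linarith
    qed
    then show "y \<in> (\<Inter>\<gamma>\<in>\<Phi>. {y. \<gamma> \<bullet> y > \<lfloor>p \<bullet> \<gamma>\<rfloor>} \<inter> {y. \<gamma> \<bullet> y < \<lfloor>p \<bullet> \<gamma>\<rfloor> + 1})"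
      by (simp add: inner_commute)
  next
    fix y assume y: "y \<in> (\<Inter>\<gamma>\<in>\<Phi>. {y. \<gamma> \<bullet> y > \<lfloor>p \<bullet> \<gamma>\<rfloor>} \<inter> {y. \<gamma> \<bullet> y < \<lfloor>p \<bullet> \<gamma>\<rfloor> + 1})"
    have "y \<bullet> \<gamma> \<notin> \<int> \<and> \<lfloor>y \<bullet> \<gamma>\<rfloor> = \<lfloor>p \<bullet> \<gamma>\<rfloor>" if "\<gamma> \<in> \<Phi>" for \<gamma>
    proof -
      have "\<lfloor>p \<bullet> \<gamma>\<rfloor> < y \<bullet> \<gamma>" "y \<bullet> \<gamma> < \<lfloor>p \<bullet> \<gamma>\<rfloor> + 1" using y that by (auto simp: inner_commute)
      moreover from this have "\<lfloor>y \<bullet> \<gamma>\<rfloor> = \<lfloor>p \<bullet> \<gamma>\<rfloor>" by linarith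
      ultimately show ?thesis by (metis Ints_cases floor_of_int less_irrefl)
    qed
    then show "y \<in> region p" by (simp add: region_def regular_def)
  qed
  then show ?thesis
    by (auto intro!: convex_INT convex_Int convex_halfspace_gt convex_halfspace_lt)
qed

text \<open>
  A region is convex, and a connected set without integral root products cannot change an integer part,
  by the intermediate value theorem.
\<close>

lemma connected_component_regular:
  assumes "regular x"
  shows "connected_component_set {x. regular x} x = region x"
proof
  show "region x \<subseteq> connected_component_set {x. regular x} x"
    by (rule connected_component_maximal)
       (use assms convex_region in \<open>auto simp: region_def intro!: convex_connected\<close>)
  show "connected_component_set {x. regular x} x \<subseteq> region x"
  proof
    fix y assume "y \<in> connected_component_set {x. regular x} x"
    then obtain T where T: "connected T" "T \<subseteq> {x. regular x}" "x \<in> T" "y \<in> T"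
      by (auto simp: connected_component_def)
    have "\<lfloor>y \<bullet> \<gamma>\<rfloor> = \<lfloor>x \<bullet> \<gamma>\<rfloor>" if g: "\<gamma> \<in> \<Phi>" for \<gamma>
    proof (rule ccontr)
      have hit: False if "u \<in> T" "v \<in> T" "\<lfloor>u \<bullet> \<gamma>\<rfloor> < \<lfloor>v \<bullet> \<gamma>\<rfloor>" for u v
      proof -
        have "\<exists>z\<in>T. z \<bullet> \<gamma> = of_int \<lfloor>v \<bullet> \<gamma>\<rfloor>"
          using connected_ivt_hyperplane[OF T(1) that(1,2), of \<gamma> "of_int \<lfloor>v \<bullet> \<gamma>\<rfloor>"] that(3)
          by (auto simp: inner_commute) linarith
        then obtain z where "z \<in> T" "z \<bullet> \<gamma> \<in> \<int>" by (metis Ints_of_int)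
        then show False using T(2) g by (auto simp: regular_def)
      qed
      assume "\<lfloor>y \<bullet> \<gamma>\<rfloor> \<noteq> \<lfloor>x \<bullet> \<gamma>\<rfloor>"
      then show False using hit[of x y] hit[of y x] T by linarith
    qed
    then show "y \<in> region x" using T by (auto simp: region_def)
  qed
qed

lemma alcove_is_region: "B \<in> alcoves e \<Longrightarrow> x \<in> B \<Longrightarrow> regular x \<and> B = region x"
  unfolding alcoves_def complement_hyperplanes components_def
  by (auto simp: connected_component_regular) (auto simp: region_def)

lemma region_is_alcove: "regular x \<Longrightarrow> region x \<in> alcoves e"
  unfolding alcoves_def complement_hyperplanes components_def
  using connected_component_regular by blast

text \<open>
  An explicit point of the fundamental alcove.
\<close>

definition base :: "real ^ 'n" where
  "base = (1 / (2 * real n)) *\<^sub>R rho"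

lemma A0_coordsI:
  assumes "x \<bullet> e 1 > 0" "\<And>i. 1 \<le> i \<Longrightarrow> i < n \<Longrightarrow> x \<bullet> e i < x \<bullet> e (Suc i)" "x \<bullet> e (n - 1) + x \<bullet> e n < 1"
  shows "x \<in> A0"
  using assms by (auto simp: fundamental_alcove_def n_card[symmetric] simple_root_def highest_root_def inner_diff_right inner_add_right)

lemma scaled_rho_in_A0:
  assumes "0 < t" "t * (2 * real n - 1) < 1"
  shows "t *\<^sub>R rho \<in> A0"
proof (rule A0_coordsI)
  show "(t *\<^sub>R rho) \<bullet> e (n - 1) + (t *\<^sub>R rho) \<bullet> e n < 1"
    using assms n2 by (simp add: rho_e of_nat_diff algebra_simps)
qed (use assms n2 in \<open>auto simp: rho_e\<close>)

lemma base_in_A0: "base \<in> A0"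
  unfolding base_def using n2 by (intro scaled_rho_in_A0) (auto simp: field_simps)

lemma A0_floor:
  assumes "x \<in> A0" "\<gamma> \<in> \<Phi>"
  shows "x \<bullet> \<gamma> \<notin> \<int>" "\<lfloor>x \<bullet> \<gamma>\<rfloor> = (if \<gamma> \<bullet> rho > 0 then 0 else - 1)"
proof -
  have *: "(0 < x \<bullet> \<gamma> \<and> x \<bullet> \<gamma> < 1 \<and> \<gamma> \<bullet> rho > 0) \<or> (-1 < x \<bullet> \<gamma> \<and> x \<bullet> \<gamma> < 0 \<and> \<gamma> \<bullet> rho < 0)"
    using A0_positive_root[OF assms(1), of \<gamma>] A0_positive_root[OF assms(1), of "- \<gamma>"] assms(2) roots_uminus[OF assms(2)]
      root_rho_sign[OF assms(2)] by (cases "\<gamma> \<bullet> rho > 0") auto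
  then show f: "\<lfloor>x \<bullet> \<gamma>\<rfloor> = (if \<gamma> \<bullet> rho > 0 then 0 else - 1)" by (auto; linarith)
  show "x \<bullet> \<gamma> \<notin> \<int>"
    using * by (auto elim!: Ints_cases)
qed

lemma A0_region: "p \<in> A0 \<Longrightarrow> A0 = region p"
proof (intro set_eqI iffI)
  fix x assume "p \<in> A0" "x \<in> A0"
  then show "x \<in> region p" by (simp add: region_def regular_def A0_floor)
next
  fix x assume p: "p \<in> A0" and x: "x \<in> region p"
  show "x \<in> A0" unfolding A0_eq
  proof (clarify)
    fix i assume i: "i \<le> n"
    have "\<lfloor>x \<bullet> wall_root i\<rfloor> = \<lfloor>p \<bullet> wall_root i\<rfloor>" "x \<bullet> wall_root i \<notin> \<int>"
      using x wall_root_in_roots[OF i] by (auto simp: region_def regular_def)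
    moreover have "\<lfloor>p \<bullet> wall_root i\<rfloor> \<ge> wall_level i"
      using p i unfolding A0_eq by (auto simp: le_floor_iff less_imp_le)
    ultimately show "wall_level i < x \<bullet> wall_root i"
      by (metis Ints_of_int le_floor_iff order_le_less)
  qed
qed

section \<open>Affine symmetries and the uniqueness of alcove representations\<close>

definition lin :: "(real ^ 'n \<Rightarrow> real ^ 'n) \<Rightarrow> real ^ 'n \<Rightarrow> real ^ 'n" where
  "lin w x = w x - w 0"

text \<open>
  Signed permutations followed by a translation in the coroot lattice, that is by an integral vector with even
  coordinate sum.  Parity matters: the translations by arbitrary integral vectors produce the
  symmetry that exchanges the last two wall types and fixes the fundamental alcove.
\<close>

definition affine_sym :: "(real ^ 'n \<Rightarrow> real ^ 'n) \<Rightarrow> bool" where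
  "affine_sym w \<longleftrightarrow> orthogonal_transformation (lin w) \<and> lin w ` axis_vectors \<subseteq> axis_vectors \<and>
     (\<forall>b\<in>axis_vectors. w 0 \<bullet> b \<in> \<int>) \<and> (\<exists>m::int. w 0 \<bullet> ones = 2 * of_int m)"

lemma reflection_eq:
  "affine_reflection \<alpha> k x = x - ((2 / (\<alpha> \<bullet> \<alpha>)) * (x \<bullet> \<alpha> - of_int k)) *\<^sub>R \<alpha>"
  by (simp add: affine_reflection_def)

lemma reflection_shape:
  "affine_reflection \<alpha> k x = affine_reflection \<alpha> 0 x + ((2 / (\<alpha> \<bullet> \<alpha>)) * of_int k) *\<^sub>R \<alpha>"
  unfolding reflection_eq by (simp only: right_diff_distrib scaleR_left_diff_distrib) simp

lemma linear_reflection: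
  fixes \<alpha> :: "real ^ 'n"
  shows "linear (affine_reflection \<alpha> 0)"
proof (rule linearI)
  fix x y :: "real ^ 'n" and c :: real
  show "affine_reflection \<alpha> 0 (x + y) = affine_reflection \<alpha> 0 x + affine_reflection \<alpha> 0 y"
    unfolding reflection_eq by (simp add: inner_add_left distrib_left scaleR_left_distrib)
  show "affine_reflection \<alpha> 0 (c *\<^sub>R x) = c *\<^sub>R affine_reflection \<alpha> 0 x"
    unfolding reflection_eq by (simp add: scaleR_right_diff_distrib mult.left_commute)
qed

lemma orthogonal_reflection:
  fixes \<alpha> :: "real ^ 'n"
  shows "orthogonal_transformation (affine_reflection \<alpha> 0)"
  unfolding orthogonal_transformation_def
proof (intro conjI allI linear_reflection)
  fix v w
  define t where "t = 2 / (\<alpha> \<bullet> \<alpha>)"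
  have t: "t * t * (\<alpha> \<bullet> \<alpha>) = 2 * t" by (cases "\<alpha> = 0") (simp_all add: t_def)
  have "affine_reflection \<alpha> 0 v \<bullet> affine_reflection \<alpha> 0 w =
     v \<bullet> w - 2 * t * (v \<bullet> \<alpha>) * (w \<bullet> \<alpha>) + (t * t * (\<alpha> \<bullet> \<alpha>)) * (v \<bullet> \<alpha>) * (w \<bullet> \<alpha>)"
    unfolding reflection_eq t_def[symmetric]
    by (simp add: inner_diff_left inner_diff_right inner_commute[of \<alpha> v] inner_commute[of \<alpha> w] algebra_simps)
  then show "affine_reflection \<alpha> 0 v \<bullet> affine_reflection \<alpha> 0 w = v \<bullet> w" unfolding t by simp
qed

lemma reflection_axis:
  assumes "\<alpha> \<in> \<Phi>" "b \<in> axis_vectors"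
  shows "affine_reflection \<alpha> 0 b \<in> axis_vectors"
proof -
  consider "\<alpha> \<in> axis_vectors" | c d where "\<alpha> = c + d" "c \<in> axis_vectors" "d \<in> axis_vectors" "c \<bullet> d = 0"
    using assms(1) unfolding roots_eq by blast
  then show ?thesis
  proof cases
    case 1
    have "affine_reflection \<alpha> 0 b = b - (2 * (b \<bullet> \<alpha>)) *\<^sub>R \<alpha>"
      using axis_unit[OF 1] by (simp add: affine_reflection_def)
    note eq = this
    consider "b = \<alpha>" "b \<bullet> \<alpha> = 1" | "b = - \<alpha>" "b \<bullet> \<alpha> = -1" | "b \<bullet> \<alpha> = 0"
      using axis_inner[OF assms(2) 1] by blast
    then show ?thesis
      by cases (use eq axis_uminus[OF assms(2)] assms(2) in \<open>simp_all add: scaleR_2\<close>)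
  next
    case 2
    have cc: "c \<bullet> c = 1" "d \<bullet> d = 1" using axis_unit 2 by auto
    then have "\<alpha> \<bullet> \<alpha> = 2" using 2(1,4) by (simp add: inner_add_left inner_add_right inner_commute[of d c])
    then have eq: "affine_reflection \<alpha> 0 b = b - (b \<bullet> c + b \<bullet> d) *\<^sub>R (c + d)"
      using 2(1) by (simp add: affine_reflection_def inner_add_right)
    have dc: "d \<bullet> c = 0" using 2(4) by (simp add: inner_commute)
    consider "b = c" | "b = - c" | "b = d" | "b = - d" | "b \<bullet> c = 0" "b \<bullet> d = 0"
      using axis_inner[OF assms(2) 2(2)] axis_inner[OF assms(2) 2(3)] by blast
    then show ?thesis
      by cases (use eq cc dc 2 axis_uminus assms(2) in \<open>simp_all\<close>)
  qed
qed

lemma affine_sym_id: "affine_sym id"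
  by (auto simp: affine_sym_def lin_def[abs_def] intro!: exI[of _ 0])

lemma lin_reflection_comp: "lin (affine_reflection \<alpha> k \<circ> w) = affine_reflection \<alpha> 0 \<circ> lin w"
  by (rule ext) (simp add: lin_def reflection_shape[of \<alpha> k] linear_diff[OF linear_reflection])

lemma root_axis_Ints: "\<alpha> \<in> \<Phi> \<Longrightarrow> b \<in> axis_vectors \<Longrightarrow> \<alpha> \<bullet> b \<in> \<int>"
  unfolding roots_eq by (elim UnE CollectE exE conjE) (simp_all add: inner_add_left axis_Ints)

text \<open>
  A reflection subtracts an integral multiple of the root from a lattice vector; the multiple is even for the
  roots \<open>\<plusminus>e i\<close>, and the other roots have an even coordinate sum.
\<close>

lemma lattice_reflection:
  assumes "\<alpha> \<in> \<Phi>" and c: "\<forall>b\<in>axis_vectors. c \<bullet> b \<in> \<int>" and even: "c \<bullet> ones = 2 * of_int m"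
  shows "(\<forall>b\<in>axis_vectors. affine_reflection \<alpha> k c \<bullet> b \<in> \<int>) \<and>
    (\<exists>m::int. affine_reflection \<alpha> k c \<bullet> ones = 2 * of_int m)"
proof -
  consider "\<alpha> \<in> axis_vectors" | b d where "\<alpha> = b + d" "b \<in> axis_vectors" "d \<in> axis_vectors" "b \<bullet> d = 0"
    using assms(1) unfolding roots_eq by blast
  then obtain j :: int where j: "affine_reflection \<alpha> k c = c - of_int j *\<^sub>R \<alpha>" "\<exists>l::int. of_int j * (\<alpha> \<bullet> ones) = 2 * of_int l"
  proof cases
    case 1
    obtain i where i: "c \<bullet> \<alpha> = of_int i" using c 1 by (auto elim: Ints_cases)
    have "affine_reflection \<alpha> k c = c - of_int (2 * (i - k)) *\<^sub>R \<alpha>"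
      using axis_unit[OF 1] i by (simp add: affine_reflection_def)
    moreover have "\<exists>l::int. of_int (2 * (i - k)) * (\<alpha> \<bullet> ones) = 2 * of_int l"
      using axis_ones[OF 1] by (auto intro: exI[of _ "i - k"] exI[of _ "k - i"])
    ultimately show ?thesis using that by blast
  next
    case 2
    obtain i where i1: "c \<bullet> b = of_int i" using c 2(2) by (meson Ints_cases)
    obtain i' where i2: "c \<bullet> d = of_int i'" using c 2(3) by (meson Ints_cases)
    note i = i1 i2
    have "\<alpha> \<bullet> \<alpha> = 2" using 2 axis_unit[OF 2(2)] axis_unit[OF 2(3)] by (simp add: inner_add_left inner_add_right inner_commute)
    then have "affine_reflection \<alpha> k c = c - of_int (i + i' - k) *\<^sub>R \<alpha>"
      using i 2 by (simp add: affine_reflection_def inner_add_right)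
    moreover have "\<exists>l::int. of_int (i + i' - k) * (\<alpha> \<bullet> ones) = 2 * of_int l"
    proof -
      have "\<alpha> \<bullet> ones = 2 \<or> \<alpha> \<bullet> ones = 0 \<or> \<alpha> \<bullet> ones = -2"
        using axis_ones[OF 2(2)] axis_ones[OF 2(3)] 2(1) by (auto simp: inner_add_left)
      then show ?thesis by (auto intro: exI[of _ "i + i' - k"] exI[of _ 0] exI[of _ "k - i - i'"])
    qed
    ultimately show ?thesis using that by blast
  qed
  have "\<alpha> \<bullet> b \<in> \<int>" if "b \<in> axis_vectors" for b
    using root_axis_Ints[OF assms(1) that] .
  then have "affine_reflection \<alpha> k c \<bullet> b \<in> \<int>" if "b \<in> axis_vectors" for b
    using that c unfolding j(1) by (auto simp: inner_diff_left intro!: Ints_diff Ints_mult)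
  moreover obtain l :: int where "of_int j * (\<alpha> \<bullet> ones) = 2 * of_int l" using j(2) by blast
  then have "affine_reflection \<alpha> k c \<bullet> ones = 2 * of_int (m - l)"
    unfolding j(1) by (simp add: inner_diff_left even)
  ultimately show ?thesis by blast
qed

lemma affine_weyl_sym: "w \<in> G \<Longrightarrow> affine_sym w"
proof (induction rule: affine_weyl_group.induct)
  case one
  show ?case by (rule affine_sym_id)
next
  case (step \<alpha> w k)
  obtain m :: int where m: "w 0 \<bullet> ones = 2 * of_int m" using step by (auto simp: affine_sym_def)
  have "orthogonal_transformation (lin (affine_reflection \<alpha> k \<circ> w))"
    unfolding lin_reflection_comp
    using step by (intro orthogonal_transformation_compose orthogonal_reflection) (simp add: affine_sym_def)
  moreover have "lin (affine_reflection \<alpha> k \<circ> w) ` axis_vectors \<subseteq> axis_vectors"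
    unfolding lin_reflection_comp using step reflection_axis by (auto simp: affine_sym_def)
  moreover have "\<forall>b\<in>axis_vectors. w 0 \<bullet> b \<in> \<int>" using step by (simp add: affine_sym_def)
  note lattice_reflection[OF step(1) this m, of k]
  ultimately show ?case unfolding affine_sym_def comp_apply[of _ w] by blast
qed

text \<open>
  The definition multiplies by reflections on the left; walks multiply on the right.
\<close>

lemma group_right_reflection: "w \<in> G \<Longrightarrow> \<alpha> \<in> \<Phi> \<Longrightarrow> w \<circ> affine_reflection \<alpha> k \<in> G"
proof (induction rule: affine_weyl_group.induct)
  case one
  then show ?case using affine_weyl_group.step[OF _ affine_weyl_group.one, of \<alpha> e k] by simp
next
  case (step \<beta> w j)
  then have "w \<circ> affine_reflection \<alpha> k \<in> G" by blast
  from affine_weyl_group.step[OF step(1) this, of j] show ?case by (simp only: comp_assoc)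
qed

lemma group_comp: "w \<in> G \<Longrightarrow> v \<in> G \<Longrightarrow> w \<circ> v \<in> G"
proof (induction rule: affine_weyl_group.induct)
  case (step \<beta> w j)
  then have "w \<circ> v \<in> G" by blast
  from affine_weyl_group.step[OF step(1) this, of j] show ?case by (simp only: comp_assoc)
qed simp

lemma reflection_involution: "affine_reflection \<alpha> k (affine_reflection \<alpha> k x) = x"
proof (cases "\<alpha> = 0")
  case False
  define r where "r = 2 * (x \<bullet> \<alpha> - of_int k) / (\<alpha> \<bullet> \<alpha>)"
  have r: "affine_reflection \<alpha> k x = x - r *\<^sub>R \<alpha>" by (simp add: affine_reflection_def r_def)
  have "2 * ((x - r *\<^sub>R \<alpha>) \<bullet> \<alpha> - of_int k) / (\<alpha> \<bullet> \<alpha>) = - r"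
    using False by (simp add: r_def inner_diff_left field_simps)
  then have "affine_reflection \<alpha> k (x - r *\<^sub>R \<alpha>) = (x - r *\<^sub>R \<alpha>) - (- r) *\<^sub>R \<alpha>"
    unfolding affine_reflection_def by (simp only:)
  then show ?thesis unfolding r by simp
qed (simp add: affine_reflection_def)

lemma group_inverse: "w \<in> G \<Longrightarrow> \<exists>v\<in>G. v \<circ> w = id"
proof (induction rule: affine_weyl_group.induct)
  case one
  show ?case by (rule bexI[OF _ affine_weyl_group.one]) simp
next
  case (step \<alpha> w k)
  then obtain v where v: "v \<in> G" "v \<circ> w = id" by blast
  have "(v \<circ> affine_reflection \<alpha> k) \<circ> (affine_reflection \<alpha> k \<circ> w) = id"
    using v(2) by (simp add: fun_eq_iff reflection_involution)
  then show ?case using group_right_reflection[OF v(1) step(1)] by blast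
qed

lemma sym_facts:
  assumes "affine_sym w"
  shows "linear (lin w)" "lin w x \<bullet> lin w y = x \<bullet> y" "surj (lin w)" "inj (lin w)" "surj w" "inj w"
    "b \<in> axis_vectors \<Longrightarrow> lin w b \<in> axis_vectors" "lin w ` axis_vectors = axis_vectors"
    "\<gamma> \<in> \<Phi> \<Longrightarrow> lin w \<gamma> \<in> \<Phi>" "lin w ` \<Phi> = \<Phi>" "\<gamma> \<in> \<Phi> \<Longrightarrow> w 0 \<bullet> \<gamma> \<in> \<int>"
proof -
  have o: "orthogonal_transformation (lin w)" using assms by (simp add: affine_sym_def)
  show l: "linear (lin w)" using o by (rule orthogonal_transformation_linear)
  show ip: "lin w x \<bullet> lin w y = x \<bullet> y" for x y using o by (simp add: orthogonal_transformation_def)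
  show s: "surj (lin w)" using o by (rule orthogonal_transformation_surj)
  show i: "inj (lin w)" using o by (rule orthogonal_transformation_inj)
  have w: "w = (+) (w 0) \<circ> lin w" by (simp add: fun_eq_iff lin_def)
  show "inj w" using i by (auto simp: inj_def lin_def)
  show "surj w"
  proof (unfold surj_def, intro allI)
    fix y
    obtain x where "y - w 0 = lin w x" using s by blast
    then show "\<exists>x. y = w x" by (auto simp: lin_def)
  qed
  show ax: "lin w b \<in> axis_vectors" if "b \<in> axis_vectors" for b using assms that by (auto simp: affine_sym_def)
  have "finite axis_vectors" by (simp add: axis_vectors_def)
  then show axs: "lin w ` axis_vectors = axis_vectors"
    using ax by (intro endo_inj_surj inj_on_subset[OF i subset_UNIV]) blast+
  show ro: "lin w \<gamma> \<in> \<Phi>" if "\<gamma> \<in> \<Phi>" for \<gamma>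
    using that unfolding roots_eq
  proof (elim UnE CollectE exE conjE)
    fix b c assume "\<gamma> = b + c" "b \<in> axis_vectors" "c \<in> axis_vectors" "b \<bullet> c = 0"
    then have "lin w \<gamma> = lin w b + lin w c" "lin w b \<in> axis_vectors" "lin w c \<in> axis_vectors" "lin w b \<bullet> lin w c = 0"
      using linear_add[OF l] ax ip by auto
    then show "lin w \<gamma> \<in> axis_vectors \<union> {b + c |b c. b \<in> axis_vectors \<and> c \<in> axis_vectors \<and> b \<bullet> c = 0}" by blast
  qed (use ax in auto)
  show "lin w ` \<Phi> = \<Phi>"
    using ro by (intro endo_inj_surj finite_roots inj_on_subset[OF i subset_UNIV]) blast
  show "w 0 \<bullet> \<gamma> \<in> \<int>" if "\<gamma> \<in> \<Phi>"
    using that assms unfolding roots_eq affine_sym_def by (auto simp: inner_add_right intro!: Ints_add)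
qed

lemma inner_image:
  assumes "affine_sym w"
  shows "w x \<bullet> lin w \<delta> = x \<bullet> \<delta> + w 0 \<bullet> lin w \<delta>"
proof -
  have "w x \<bullet> lin w \<delta> = lin w x \<bullet> lin w \<delta> + w 0 \<bullet> lin w \<delta>" by (simp add: lin_def inner_diff_left)
  then show ?thesis using sym_facts(2)[OF assms] by simp
qed

lemma image_level:
  assumes "affine_sym w" "\<delta> \<in> \<Phi>"
  shows "\<exists>k::int. \<forall>x. w x \<bullet> lin w \<delta> = x \<bullet> \<delta> + of_int k"
proof -
  have "w 0 \<bullet> lin w \<delta> \<in> \<int>" using sym_facts(11)[OF assms(1) sym_facts(9)[OF assms]] .
  then obtain k where "w 0 \<bullet> lin w \<delta> = of_int k" by (rule Ints_cases)
  then have "w x \<bullet> lin w \<delta> = x \<bullet> \<delta> + of_int k" for x using inner_image[OF assms(1), of x \<delta>] by linarith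
  then show ?thesis by blast
qed

lemma image_region:
  assumes "affine_sym w"
  shows "w ` region p = region (w p)"
proof -
  have roots: "(\<forall>\<gamma>\<in>\<Phi>. P \<gamma>) \<longleftrightarrow> (\<forall>\<delta>\<in>\<Phi>. P (lin w \<delta>))" for P
  proof -
    have "(\<forall>\<gamma>\<in>lin w ` \<Phi>. P \<gamma>) \<longleftrightarrow> (\<forall>\<delta>\<in>\<Phi>. P (lin w \<delta>))" by blast
    then show ?thesis unfolding sym_facts(10)[OF assms] .
  qed
  have reg: "regular (w x) \<longleftrightarrow> regular x" for x
  proof -
    have "w x \<bullet> lin w \<delta> \<in> \<int> \<longleftrightarrow> x \<bullet> \<delta> \<in> \<int>" if d: "\<delta> \<in> \<Phi>" for \<delta>
    proof -
      obtain k :: int where k: "\<forall>x. w x \<bullet> lin w \<delta> = x \<bullet> \<delta> + of_int k" using image_level[OF assms d] ..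
      show ?thesis unfolding k[rule_format] by simp
    qed
    then show ?thesis unfolding regular_def roots[of "\<lambda>\<gamma>. w x \<bullet> \<gamma> \<notin> \<int>"] by blast
  qed
  have same: "(\<forall>\<gamma>\<in>\<Phi>. \<lfloor>w x \<bullet> \<gamma>\<rfloor> = \<lfloor>w p \<bullet> \<gamma>\<rfloor>) \<longleftrightarrow> (\<forall>\<gamma>\<in>\<Phi>. \<lfloor>x \<bullet> \<gamma>\<rfloor> = \<lfloor>p \<bullet> \<gamma>\<rfloor>)" for x
  proof -
    have "\<lfloor>w x \<bullet> lin w \<delta>\<rfloor> = \<lfloor>w p \<bullet> lin w \<delta>\<rfloor> \<longleftrightarrow> \<lfloor>x \<bullet> \<delta>\<rfloor> = \<lfloor>p \<bullet> \<delta>\<rfloor>" if d: "\<delta> \<in> \<Phi>" for \<delta>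
    proof -
      obtain k :: int where k: "\<forall>x. w x \<bullet> lin w \<delta> = x \<bullet> \<delta> + of_int k" using image_level[OF assms d] ..
      show ?thesis unfolding k[rule_format] by simp
    qed
    then show ?thesis unfolding roots[of "\<lambda>\<gamma>. \<lfloor>w x \<bullet> \<gamma>\<rfloor> = \<lfloor>w p \<bullet> \<gamma>\<rfloor>"] by blast
  qed
  have mem: "w x \<in> region (w p) \<longleftrightarrow> x \<in> region p" for x
    unfolding region_def mem_Collect_eq by (simp only: reg same)
  show ?thesis
  proof (intro subset_antisym subsetI)
    fix y assume "y \<in> region (w p)"
    moreover obtain x where "y = w x" by (rule surjE[OF sym_facts(5)[OF assms], of y])
    ultimately show "y \<in> w ` region p" using mem by blast
  qed (use mem in blast)
qed

lemma image_A0_alcove: "affine_sym w \<Longrightarrow> w ` A0 \<in> alcoves e"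
proof -
  assume w: "affine_sym w"
  have "w ` A0 = region (w base)" unfolding A0_region[OF base_in_A0] by (rule image_region[OF w])
  moreover have "regular (w base)"
  proof -
    have "base \<in> region base" using base_in_A0 unfolding A0_region[OF base_in_A0] .
    then have "w base \<in> region (w base)" using image_region[OF w] by blast
    then show ?thesis by (simp add: region_def)
  qed
  ultimately show ?thesis using region_is_alcove by simp
qed

text \<open>
  The segment from a point that satisfies the weak inequalities to an interior point lies in the alcove,
  except for its starting point.
\<close>

lemma closure_A0: "closure A0 = {x. \<forall>i\<le>n. x \<bullet> wall_root i \<ge> wall_level i}" (is "_ = ?P")
proof
  have "closed ?P"
  proof -
    have "?P = (\<Inter>i\<in>{..n}. {x. wall_root i \<bullet> x \<ge> wall_level i})" by (auto simp: inner_commute)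
    then show ?thesis by (auto intro!: closed_INT closed_halfspace_ge)
  qed
  then show "closure A0 \<subseteq> ?P" by (intro closure_minimal) (auto simp: A0_eq less_imp_le)
  show "?P \<subseteq> closure A0"
  proof
    fix x assume x: "x \<in> ?P"
    have inside: "x + t *\<^sub>R (base - x) \<in> A0" if t: "0 < t" "t \<le> 1" for t
      unfolding A0_eq
    proof (intro CollectI allI impI)
      fix i assume i: "i \<le> n"
      define a where "a = x \<bullet> wall_root i - wall_level i"
      define b where "b = base \<bullet> wall_root i - wall_level i"
      have ab: "a \<ge> 0" "b > 0" using x i base_in_A0 by (auto simp: A0_eq a_def b_def)
      have "(x + t *\<^sub>R (base - x)) \<bullet> wall_root i - wall_level i = (1 - t) * a + t * b"
        unfolding a_def b_def by (simp add: inner_add_left inner_diff_left algebra_simps)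
      also have "\<dots> > 0" using ab t by (intro add_nonneg_pos mult_nonneg_nonneg mult_pos_pos) auto
      finally show "(x + t *\<^sub>R (base - x)) \<bullet> wall_root i > wall_level i" by simp
    qed
    have "(\<lambda>m. x + inverse (real (Suc m)) *\<^sub>R (base - x)) \<longlonglongrightarrow> x + 0 *\<^sub>R (base - x)"
      by (intro tendsto_add tendsto_const tendsto_scaleR LIMSEQ_inverse_real_of_nat)
    moreover have "x + inverse (real (Suc m)) *\<^sub>R (base - x) \<in> A0" for m
      by (rule inside) (auto simp: inverse_le_1_iff)
    ultimately show "x \<in> closure A0"
      unfolding closure_sequential by (intro exI[of _ "\<lambda>m. x + inverse (real (Suc m)) *\<^sub>R (base - x)"]) simp
  qed
qed

lemma zero_in_closure_A0: "0 \<in> closure A0"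
  by (simp add: closure_A0 wall_level_def)

lemma continuous_sym: "affine_sym w \<Longrightarrow> continuous_on UNIV w"
proof -
  assume w: "affine_sym w"
  have "continuous_on UNIV (\<lambda>x. w 0 + lin w x)"
    by (intro continuous_on_add continuous_on_const linear_continuous_on) (use sym_facts(1)[OF w] in \<open>simp add: linear_conv_bounded_linear\<close>)
  then show ?thesis by (simp add: lin_def)
qed

lemma increasing_is_identity:
  fixes f :: "nat \<Rightarrow> nat"
  assumes "\<And>i. i \<in> {1..n} \<Longrightarrow> f i \<in> {1..n}" "\<And>i. 1 \<le> i \<Longrightarrow> i < n \<Longrightarrow> f i < f (Suc i)" "i \<in> {1..n}"
  shows "f i = i"
proof (rule antisym)
  have up: "i \<le> f i" if "1 \<le> i" "i \<le> n" for i using that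
  proof (induction i)
    case (Suc i)
    then show ?case using assms(2)[of i] assms(1)[of "Suc i"] by (cases "i = 0") auto
  qed simp
  then show "i \<le> f i" using assms(3) by auto
  have down: "f (n - k) \<le> n - k" if "k < n" for k using that
  proof (induction k)
    case 0
    then show ?case using assms(1)[of n] by auto
  next
    case (Suc k)
    then show ?case using assms(2)[of "n - Suc k"] by (cases "n - Suc k = 0") (simp_all add: Suc_diff_Suc)
  qed
  show "f i \<le> i" using down[of "n - i"] assms(3) by auto
qed

text \<open>
  The vertex \<open>0\<close> of the alcove goes to an integral point of its closure, which is \<open>0\<close> or the last
  basis vector; parity leaves only \<open>0\<close>.  A signed permutation that fixes the alcove keeps the
  coordinates of an interior point positive and increasing, so it is the identity.
\<close>

lemma stabilizer_trivial:
  assumes u: "affine_sym u" and stab: "u ` A0 = A0"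
  shows "u = id"
proof -
  have "u 0 \<in> closure A0"
  proof -
    have "u ` closure A0 \<subseteq> closure (u ` A0)"
      by (rule image_closure_subset[OF continuous_on_subset[OF continuous_sym[OF u]]]) (auto simp: closure_subset)
    then show ?thesis using stab zero_in_closure_A0 by auto
  qed
  then have cl: "u 0 \<bullet> wall_root i \<ge> wall_level i" if "i \<le> n" for i using that by (simp add: closure_A0)
  have ints: "u 0 \<bullet> e i \<in> \<int>" if "i \<in> {1..n}" for i using u e_axis[OF that] by (auto simp: affine_sym_def)
  have first: "u 0 \<bullet> e 1 \<ge> 0" using cl[of 0] n2 by (simp add: wall_root_simps wall_level_def)
  have mono: "u 0 \<bullet> e i \<le> u 0 \<bullet> e (Suc i)" if "1 \<le> i" "i < n" for i
    using cl[of i] that by (simp add: wall_root_simps wall_level_def inner_diff_right)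
  have top: "u 0 \<bullet> e (n - 1) + u 0 \<bullet> e n \<le> 1" using cl[of n] n2 by (simp add: wall_root_simps wall_level_def inner_diff_right)
  have le: "u 0 \<bullet> e i \<le> u 0 \<bullet> e j" if "1 \<le> i" "i \<le> j" "j \<le> n" for i j
    using that(2,3)
  proof (induction j rule: dec_induct)
    case (step j)
    then show ?case using mono[of j] that(1) by auto
  qed simp
  have nonneg: "u 0 \<bullet> e i \<ge> 0" if "i \<in> {1..n}" for i using le[of 1 i] first that by auto
  obtain p where p: "u 0 \<bullet> e (n - 1) = of_int p" using Ints_cases[OF ints[of "n - 1"]] n2 by fastforce
  obtain q where q: "u 0 \<bullet> e n = of_int q" using Ints_cases[OF ints[of n]] n2 by fastforce
  have pq: "0 \<le> p" "p \<le> q" "p + q \<le> 1"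
  proof -
    have "0 \<le> (of_int p :: real)" using nonneg[of "n - 1"] n2 p by auto
    then show "0 \<le> p" by simp
    have "(of_int p :: real) \<le> of_int q" using mono[of "n - 1"] n2 p q by simp
    then show "p \<le> q" by simp
    have "(of_int (p + q) :: real) \<le> 1" using top p q by simp
    then show "p + q \<le> 1" by linarith
  qed
  then have p0: "p = 0" by linarith
  have low: "u 0 \<bullet> e i = 0" if "i \<in> {1..n-1}" for i
    using nonneg[of i] le[of i "n - 1"] that p p0 by auto
  obtain m :: int where "u 0 \<bullet> ones = 2 * of_int m" using u by (auto simp: affine_sym_def)
  moreover have "u 0 \<bullet> ones = of_int q"
  proof -
    have "{1..n} = insert n {1..n-1}" using n2 by auto
    then have "u 0 \<bullet> ones = u 0 \<bullet> e n + (\<Sum>i=1..n-1. u 0 \<bullet> e i)"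
      unfolding ones_def inner_sum_right using n2 by auto
    then show ?thesis using low q by simp
  qed
  ultimately have "of_int q = (of_int (2 * m) :: real)" by simp
  then have "q = 2 * m" by (simp only: of_int_eq_iff)
  then have q0: "q = 0" using pq by presburger
  have c0: "u 0 = 0"
  proof (rule coord_eqI)
    fix i assume i: "i \<in> {1..n}"
    show "u 0 \<bullet> e i = 0 \<bullet> e i" using low[of i] q q0 i by (cases "i = n") auto
  qed
  have ue: "lin u = u" using c0 by (simp add: lin_def fun_eq_iff)
  note f = sym_facts[OF u, unfolded ue]
  \<comment> \<open>up to the scaling of \<open>base\<close>, the coordinates of \<open>u base\<close> are the labels of the preimages of the basis vectors\<close>
  have ub: "u base \<in> A0" using stab base_in_A0 by blast
  have pre: "\<exists>b\<in>axis_vectors. u b = e j" if "j \<in> {1..n}" for j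
    using f(8) e_axis[OF that] by (metis imageE)
  then obtain b where b: "\<And>j. j \<in> {1..n} \<Longrightarrow> b j \<in> axis_vectors" "\<And>j. j \<in> {1..n} \<Longrightarrow> u (b j) = e j" by metis
  have coord: "u base \<bullet> e j = (1 / (2 * real n)) * (rho \<bullet> b j)" if "j \<in> {1..n}" for j
    using f(2)[of base "b j"] b(2)[OF that] by (simp add: base_def)
  have C: "u base \<in> identity_chamber e" using ub A0_in_chamber by auto
  have "\<exists>i\<in>{1..n}. b j = e i" if j: "j \<in> {1..n}" for j
  proof (cases rule: axis_cases[OF b(1)[OF j]])
    case (2 i)
    then have "rho \<bullet> b j \<le> 0" by (simp add: rho_e)
    moreover have "u base \<bullet> e j > 0" using chamber_coords(1)[OF C j j] .
    ultimately show ?thesis using coord[OF j] by (auto simp: zero_less_divide_iff)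
  qed auto
  then obtain g where g: "\<And>j. j \<in> {1..n} \<Longrightarrow> g j \<in> {1..n}" "\<And>j. j \<in> {1..n} \<Longrightarrow> b j = e (g j)" by metis
  have gj: "g j = j" if "j \<in> {1..n}" for j
  proof (rule increasing_is_identity[OF g(1) _ that])
    fix i assume i: "1 \<le> i" "i < n"
    have "u base \<bullet> e i < u base \<bullet> e (Suc i)" using chamber_coords(2)[OF C, of i "Suc i"] i by auto
    then have "rho \<bullet> b i < rho \<bullet> b (Suc i)" using coord[of i] coord[of "Suc i"] i by (auto simp: divide_less_cancel)
    then show "g i < g (Suc i)" using g[of i] g[of "Suc i"] i by (auto simp: rho_e)
  qed
  have fix_e: "u (e j) = e j" if "j \<in> {1..n}" for j using b(2)[OF that] g(2)[OF that] gj[OF that] by simp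
  show "u = id"
  proof
    fix x show "u x = id x"
    proof (rule coord_eqI)
      fix i assume "i \<in> {1..n}"
      then show "u x \<bullet> e i = id x \<bullet> e i" using f(2)[of x "e i"] fix_e by simp
    qed
  qed
qed

text \<open>
  This makes the type of a facet well defined.
\<close>

lemma alcove_representation_unique:
  assumes "w \<in> G" "w' \<in> G" "w ` A0 = w' ` A0"
  shows "w = w'"
proof -
  obtain v where v: "v \<in> G" "v \<circ> w' = id" using group_inverse[OF assms(2)] by blast
  have "(v \<circ> w) ` A0 = (v \<circ> w') ` A0" unfolding image_comp[symmetric] using assms(3) by (rule arg_cong)
  then have "v \<circ> w = id" using v by (intro stabilizer_trivial affine_weyl_sym group_comp assms) auto
  then have "v (w x) = v (w' x)" for x using v(2) by (metis comp_apply)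
  then show ?thesis using sym_facts(6)[OF affine_weyl_sym[OF v(1)]] by (auto simp: inj_def fun_eq_iff)
qed

section \<open>Walls and facets\<close>

definition wall_face :: "nat \<Rightarrow> (real ^ 'n) set" where
  "wall_face i = closure A0 \<inter> fundamental_wall e i"

text \<open>
  A point in the relative interior of the \<open>i\<close>-th facet, obtained from multiples of \<open>rho\<close> by letting
  the coordinates \<open>i\<close> and \<open>i + 1\<close> coincide (the first one vanish for \<open>i = 0\<close>, the last two add up
  to \<open>1\<close> for \<open>i = n\<close>).
\<close>

definition wall_point :: "nat \<Rightarrow> real ^ 'n" where
  "wall_point i = (if i < n then (\<Sum>j=1..n. ((real j - (if j > i then 1 else 0)) / (2 * real n)) *\<^sub>R e j)
     else (1 / (2 * real n - 1)) *\<^sub>R rho)"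

lemma wall_point_coord:
  assumes "j \<in> {1..n}"
  shows "i < n \<Longrightarrow> wall_point i \<bullet> e j = (real j - (if j > i then 1 else 0)) / (2 * real n)"
    and "wall_point n \<bullet> e j = real j / (2 * real n - 1)"
  unfolding wall_point_def using coordinate_sum[OF assms] rho_e[OF assms] by simp_all

lemma wall_point_on_wall:
  assumes i: "i \<le> n"
  shows "wall_point i \<bullet> wall_root i = wall_level i"
    and "j \<le> n \<Longrightarrow> j \<noteq> i \<Longrightarrow> wall_point i \<bullet> wall_root j > wall_level j"
proof -
  let ?s = "\<lambda>j. wall_point i \<bullet> wall_root j"
  define c where "c = (if i < n then 1 / (2 * real n) else 1 / (2 * real n - 1))"
  have c: "c > 0" using n2 by (auto simp: c_def)
  define d :: "nat \<Rightarrow> real" where "d j = real j - (if i < j then 1 else 0)" for j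
  have X: "wall_point i \<bullet> e j = c * d j" if j: "j \<in> {1..n}" for j
  proof (cases "i < n")
    case True
    then show ?thesis using wall_point_coord(1)[OF j True] by (simp add: c_def d_def)
  next
    case False
    then have "i = n" "\<not> i < j" using i j by auto
    then show ?thesis using wall_point_coord(2)[OF j] by (simp add: c_def d_def)
  qed
  have s0: "?s 0 = c * d 1" using X[of 1] n2 by (simp add: wall_root_simps)
  have sj: "?s j = c * (d (Suc j) - d j)" if "0 < j" "j < n" for j
    using X[of j] X[of "Suc j"] that by (simp add: wall_root_simps inner_diff_right right_diff_distrib)
  have sn: "?s n = - c * (d (n - 1) + d n)"
    using X[of "n - 1"] X[of n] n2 by (simp add: wall_root_simps inner_diff_right distrib_left)
  have d1: "d 1 = (if i = 0 then 0 else 1)" by (auto simp: d_def)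
  have dj: "d (Suc j) - d j = (if i = j then 0 else 1)" for j by (auto simp: d_def)
  have dn: "c * (d (n - 1) + d n) < 1" if "i < n"
  proof -
    have "d (n - 1) + d n < 2 * real n" using that n2 by (auto simp: d_def of_nat_diff)
    then show ?thesis using that n2 by (simp add: c_def)
  qed
  have dn': "c * (d (n - 1) + d n) = 1" if "i = n" using that n2 by (simp add: c_def d_def of_nat_diff)
  consider "i = 0" | "0 < i" "i < n" | "i = n" using assms by linarith
  then show "?s i = wall_level i"
    by cases (use n2 s0 d1 sj[of i] dj[of i] sn dn' in \<open>simp_all add: wall_level_def\<close>)
  assume j: "j \<le> n" "j \<noteq> i"
  consider "j = 0" | "0 < j" "j < n" | "j = n" using j by linarith
  then show "?s j > wall_level j"
    by cases (use n2 s0 d1 sj[of j] dj[of j] sn dn c j i in \<open>simp_all add: wall_level_def\<close>)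
qed

lemma wall_point_in_face: "i \<le> n \<Longrightarrow> wall_point i \<in> wall_face i"
  using wall_point_on_wall[of i]
  by (auto simp: wall_face_def closure_A0 fundamental_wall_eq) (metis order_le_less)

text \<open>
  No hyperplane other than the wall itself passes through the chosen point.
\<close>

lemma wall_point_generic:
  assumes i: "i \<le> n" and g: "\<gamma> \<in> \<Phi>" and int: "wall_point i \<bullet> \<gamma> \<in> \<int>"
  shows "\<gamma> = wall_root i \<or> \<gamma> = - wall_root i"
  using g
proof (cases rule: positive_root_cases)
  case (axis s j)
  then have intj: "wall_point i \<bullet> e j \<in> \<int>" using int by (auto simp: inner_minus_right)
  obtain k where k: "wall_point i \<bullet> e j = of_int k" using intj by (rule Ints_cases)
  show ?thesis
  proof (cases "i = n")
    case True
    have "0 < real j / (2 * real n - 1)" "real j / (2 * real n - 1) < 1" using axis(3) n2 by (auto simp: field_simps)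
    then have "0 < k" "k < 1" using k True wall_point_coord(2)[OF axis(3)] by auto
    then show ?thesis by simp
  next
    case False
    then have c: "wall_point i \<bullet> e j = (real j - (if j > i then 1 else 0)) / (2 * real n)"
      using i wall_point_coord(1)[OF axis(3)] by simp
    have "0 \<le> wall_point i \<bullet> e j" "wall_point i \<bullet> e j < 1" unfolding c using axis(3) n2 by (auto simp: field_simps)
    then have "k = 0" using k by auto
    then have "real j - (if j > i then 1 else 0) = 0" using k c n2 by simp
    then have "j = 1" "i = 0" using axis(3) by (auto split: if_splits)
    then show ?thesis using axis(1,2) by (auto simp: wall_root_simps)
  qed
next
  case (pair s t a b)
  have intj: "wall_point i \<bullet> (e b + t *\<^sub>R e a) \<in> \<int>" using int pair(1,2) by (auto simp: inner_minus_right)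
  obtain k where k: "wall_point i \<bullet> (e b + t *\<^sub>R e a) = of_int k" using intj by (rule Ints_cases)
  have t: "t = 1 \<or> t = -1" using pair(3) by auto
  show ?thesis
  proof (cases "i = n")
    case True
    have c: "of_int k = (real b + t * real a) / (2 * real n - 1)"
      using k wall_point_coord(2)[OF pair(4)] wall_point_coord(2)[OF pair(5)] True
      by (simp add: inner_add_right add_divide_distrib)
    have "0 < real b + t * real a" using t pair(4-6) by auto
    moreover have "2 * real n - 1 > 0" using n2 by simp
    ultimately have "(0::real) < of_int k" unfolding c by (rule divide_pos_pos)
    then have "0 < k" by simp
    have "real b + t * real a \<le> 2 * real n - 1" using t pair(4-6) by auto
    then have "(real b + t * real a) / (2 * real n - 1) \<le> 1" using n2 by (simp add: divide_le_eq_1)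
    then have "real_of_int k \<le> 1" unfolding c .
    then have "k = 1" using \<open>0 < k\<close> by simp
    then have e1: "real b + t * real a = 2 * real n - 1" using c n2 by (simp add: field_simps)
    then have "t = 1" using t pair(4-6) n2 by auto
    then have "real (b + a + 1) = real (2 * n)" using e1 by simp
    then have "b + a + 1 = 2 * n" by (simp only: of_nat_eq_iff)
    then have "b = n" "a = n - 1" using pair(4-6) by auto
    then show ?thesis using \<open>t = 1\<close> pair(1,2) True by (auto simp: wall_root_simps)
  next
    case False
    let ?f = "\<lambda>j. real j - (if j > i then 1 else 0)"
    have c: "of_int k = (?f b + t * ?f a) / (2 * real n)"
      using k i False wall_point_coord(1)[OF pair(4), of i] wall_point_coord(1)[OF pair(5), of i]
      by (simp add: inner_add_right add_divide_distrib)
    have f: "0 \<le> ?f a" "?f a \<le> ?f b" "?f a + ?f b < 2 * real n" "?f a = ?f b \<longleftrightarrow> b = Suc a \<and> a = i"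
      "?f a + ?f b > 0"
      using pair(4-6) by auto
    have "0 \<le> (?f b + t * ?f a) / (2 * real n)" "(?f b + t * ?f a) / (2 * real n) < 1"
      using t f n2 by (auto simp: field_simps)
    then have "k = 0" using c by linarith
    then have z: "?f b + t * ?f a = 0" using c n2 by simp
    then have "t = -1" using t f by auto
    then have "b = Suc a" "a = i" using z f(4) by auto
    then show ?thesis using \<open>t = -1\<close> pair(1,2,4) False i by (auto simp: wall_root_simps)
  qed
qed

lemma open_A0: "open A0"
proof -
  have "A0 = (\<Inter>i\<in>{..n}. {x. wall_root i \<bullet> x > wall_level i})" by (auto simp: A0_eq inner_commute)
  then show ?thesis by (auto intro!: open_INT open_halfspace_gt)
qed

lemma convex_closure_A0: "convex (closure A0)"
  by (intro convex_closure) (simp add: A0_region[OF base_in_A0] convex_region)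

lemma wall_root_nonzero: "i \<le> n \<Longrightarrow> wall_root i \<noteq> 0"
  using root_rho_sign[OF wall_root_in_roots, of i] by auto

text \<open>
  Near the chosen point the wall face is an open piece of the wall, so it has codimension one.  A facet
  inside the wall is a face of this face with the same dimension, so it is all of it.
\<close>

lemma wall_face_facet:
  assumes i: "i \<le> n"
  shows "wall_face i facet_of closure A0"
    and "aff_dim (wall_face i) = int n - 1"
    and "F facet_of closure A0 \<Longrightarrow> F \<subseteq> fundamental_wall e i \<Longrightarrow> F = wall_face i"
proof -
  have wall: "fundamental_wall e i = {x. wall_root i \<bullet> x = wall_level i}"
    using fundamental_wall_eq[OF i] by (simp add: inner_commute)
  have face: "wall_face i face_of closure A0"
    unfolding wall_face_def wall
    by (rule face_of_Int_supporting_hyperplane_ge[OF convex_closure_A0])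
       (use i in \<open>auto simp: closure_A0 inner_commute\<close>)
  have dw: "aff_dim (fundamental_wall e i) = int n - 1"
    unfolding wall using wall_root_nonzero[OF i] by (simp add: aff_dim_hyperplane n_card)
  \<comment> \<open>an open set on which all inequalities but the \<open>i\<close>-th are strict\<close>
  define U where "U = (\<Inter>j\<in>{..n}-{i}. {x. wall_root j \<bullet> x > wall_level j})"
  have U: "open U" unfolding U_def by (intro open_INT) (auto intro: open_halfspace_gt)
  have pU: "wall_point i \<in> fundamental_wall e i \<inter> U"
    using wall_point_on_wall[OF i] unfolding U_def fundamental_wall_eq[OF i] by (auto simp: inner_commute)
  have "aff_dim (fundamental_wall e i \<inter> U) = aff_dim (fundamental_wall e i)"
    by (rule aff_dim_convex_Int_open) (use pU U in \<open>auto simp: wall convex_hyperplane\<close>)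
  moreover have "fundamental_wall e i \<inter> U \<subseteq> wall_face i"
  proof
    fix x assume x: "x \<in> fundamental_wall e i \<inter> U"
    have "x \<bullet> wall_root j \<ge> wall_level j" if "j \<le> n" for j
      using x that unfolding U_def fundamental_wall_eq[OF i]
      by (cases "j = i") (auto simp: inner_commute less_imp_le)
    then show "x \<in> wall_face i" using x by (simp add: wall_face_def closure_A0)
  qed
  ultimately have "aff_dim (wall_face i) \<ge> int n - 1" using dw aff_dim_subset by metis
  moreover have "aff_dim (wall_face i) \<le> int n - 1"
    using aff_dim_subset[of "wall_face i" "fundamental_wall e i"] dw by (simp add: wall_face_def)
  ultimately show d: "aff_dim (wall_face i) = int n - 1" by simp
  have dA: "aff_dim (closure A0) = int n"
    using aff_dim_open[OF open_A0] base_in_A0 by (auto simp: n_card)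
  show "wall_face i facet_of closure A0"
    unfolding facet_of_def using face d dA wall_point_in_face[OF i] by auto
  show "F = wall_face i" if F: "F facet_of closure A0" "F \<subseteq> fundamental_wall e i"
  proof (rule ccontr)
    assume ne: "F \<noteq> wall_face i"
    have FG: "F \<subseteq> wall_face i" using F facet_of_imp_subset by (auto simp: wall_face_def)
    have "F face_of wall_face i"
      by (rule face_of_subset[OF facet_of_imp_face_of[OF F(1)] FG]) (simp add: wall_face_def)
    then have "aff_dim F < aff_dim (wall_face i)"
      using face_of_aff_dim_lt[OF face_of_imp_convex[OF face] _ ne] by blast
    moreover have "aff_dim F = int n - 1" using F(1) dA by (simp add: facet_of_def)
    ultimately show False using d by simp
  qed
qed

lemma sym_image: "w ` S = (+) (w 0) ` (lin w ` S)"
  by (auto simp: lin_def image_image)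

lemma facet_of_image:
  assumes "affine_sym w" "F facet_of S"
  shows "w ` F facet_of w ` S"
proof -
  note f = sym_facts(1,4)[OF assms(1)]
  have "lin w ` F face_of lin w ` S" using face_of_linear_image[OF f] assms(2) by (auto simp: facet_of_def)
  then have "w ` F face_of w ` S" unfolding sym_image[of w F] sym_image[of w S] by simp
  moreover have "aff_dim (w ` T) = aff_dim T" for T
    unfolding sym_image[of w T] aff_dim_translation_eq using f by (rule aff_dim_injective_linear_image)
  ultimately show ?thesis using assms(2) by (simp add: facet_of_def)
qed

lemma closure_sym_image: "affine_sym w \<Longrightarrow> closure (w ` S) = w ` closure S"
  unfolding sym_image[of w S] sym_image[of w "closure S"] closure_translation
  using closure_injective_linear_image[OF sym_facts(1,4), of w S] by simp

lemma wall_reflection_fixes: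
  assumes "i \<le> n" "x \<in> fundamental_wall e i"
  shows "wall_reflection i x = x"
  using assms by (simp add: wall_reflection_def affine_reflection_def fundamental_wall_eq)

lemma wall_reflection_group: "w \<in> G \<Longrightarrow> i \<le> n \<Longrightarrow> w \<circ> wall_reflection i \<in> G"
  unfolding wall_reflection_def by (rule group_right_reflection[OF _ wall_root_in_roots])

lemma wall_reflection_level:
  assumes "i \<le> n"
  shows "wall_reflection i x \<bullet> wall_root i - wall_level i = - (x \<bullet> wall_root i - wall_level i)"
  using wall_root_nonzero[OF assms]
  by (simp add: wall_reflection_def affine_reflection_def inner_diff_left)

abbreviation neighbour :: "(real ^ 'n \<Rightarrow> real ^ 'n) \<Rightarrow> nat \<Rightarrow> (real ^ 'n) set" where
  "neighbour w i \<equiv> (w \<circ> wall_reflection i) ` A0"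

lemma neighbour_facet:
  assumes w: "w \<in> G" and i: "i \<le> n"
  shows "w ` wall_face i facet_of closure (neighbour w i)"
proof -
  have s: "affine_sym (w \<circ> wall_reflection i)" by (rule affine_weyl_sym[OF wall_reflection_group[OF w i]])
  have "(w \<circ> wall_reflection i) ` wall_face i = w ` wall_face i"
    using wall_reflection_fixes[OF i] by (force simp: wall_face_def)
  then show ?thesis
    using facet_of_image[OF s wall_face_facet(1)[OF i]] closure_sym_image[OF s, of A0] by simp
qed

lemma neighbour_ne:
  assumes w: "w \<in> G" and i: "i \<le> n"
  shows "neighbour w i \<noteq> w ` A0"
proof
  assume "neighbour w i = w ` A0"
  then have eq: "w \<circ> wall_reflection i = w"
    by (rule alcove_representation_unique[OF wall_reflection_group[OF w i] w])
  have "w (wall_reflection i base) = w base" using fun_cong[OF eq, of base] by simp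
  then have "wall_reflection i base = base"
    using sym_facts(6)[OF affine_weyl_sym[OF w]] by (simp add: inj_eq)
  then have "base \<bullet> wall_root i = wall_level i" using wall_reflection_level[OF i, of base] by simp
  then show False using base_in_A0 i by (auto simp: A0_eq)
qed

lemma facet_of_type_iff:
  assumes w: "w \<in> G"
  shows "facet_of_type e (w ` A0) i F \<longleftrightarrow> i \<le> n \<and> F = w ` wall_face i"
proof
  assume "facet_of_type e (w ` A0) i F"
  then obtain v F0 where i: "i \<le> n" and v: "v \<in> G" "w ` A0 = v ` A0"
    and F: "F0 facet_of closure A0" "F0 \<subseteq> fundamental_wall e i" "F = v ` F0"
    unfolding facet_of_type_def n_card[symmetric] by blast
  show "i \<le> n \<and> F = w ` wall_face i"
    using i alcove_representation_unique[OF w v] wall_face_facet(3)[OF i F(1,2)] F(3) by simp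
next
  assume "i \<le> n \<and> F = w ` wall_face i"
  then show "facet_of_type e (w ` A0) i F"
    unfolding facet_of_type_def n_card[symmetric]
    using w wall_face_facet(1)[of i] by (auto simp: wall_face_def)
qed

definition inner_normal :: "(real ^ 'n \<Rightarrow> real ^ 'n) \<Rightarrow> nat \<Rightarrow> real ^ 'n" where
  "inner_normal w i = lin w (wall_root i)"

text \<open>
  The level at which the \<open>i\<close>-th wall of \<open>w A0\<close> meets its inner normal.
\<close>

definition wall_height :: "(real ^ 'n \<Rightarrow> real ^ 'n) \<Rightarrow> nat \<Rightarrow> int" where
  "wall_height w i = wall_level i + \<lfloor>w 0 \<bullet> inner_normal w i\<rfloor>"

lemma inner_normal_root: "w \<in> G \<Longrightarrow> i \<le> n \<Longrightarrow> inner_normal w i \<in> \<Phi>"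
  unfolding inner_normal_def by (rule sym_facts(9)[OF affine_weyl_sym wall_root_in_roots])

lemma wall_height_diff:
  assumes w: "w \<in> G" and i: "i \<le> n"
  shows "w x \<bullet> inner_normal w i - wall_height w i = x \<bullet> wall_root i - wall_level i"
proof -
  have "w 0 \<bullet> inner_normal w i \<in> \<int>" by (rule sym_facts(11)[OF affine_weyl_sym[OF w] inner_normal_root[OF w i]])
  then obtain k where k: "w 0 \<bullet> inner_normal w i = of_int k" by (rule Ints_cases)
  have "real_of_int \<lfloor>w 0 \<bullet> inner_normal w i\<rfloor> = w 0 \<bullet> inner_normal w i" unfolding k by simp
  moreover have "w x \<bullet> inner_normal w i = x \<bullet> wall_root i + w 0 \<bullet> inner_normal w i"
    unfolding inner_normal_def by (rule inner_image[OF affine_weyl_sym[OF w]])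
  ultimately show ?thesis unfolding wall_height_def of_int_add by linarith
qed

lemma face_at_height:
  assumes w: "w \<in> G" and i: "i \<le> n" and x: "x \<in> w ` wall_face i"
  shows "x \<bullet> inner_normal w i = wall_height w i"
proof -
  obtain y where y: "x = w y" "y \<in> wall_face i" using x by blast
  then have "y \<bullet> wall_root i = wall_level i" by (simp add: wall_face_def fundamental_wall_eq[OF i])
  then show ?thesis using wall_height_diff[OF w i, of y] y(1) by simp
qed

lemma alcove_above_wall:
  assumes w: "w \<in> G" and i: "i \<le> n" and x: "x \<in> w ` A0"
  shows "x \<bullet> inner_normal w i > wall_height w i"
proof -
  obtain y where y: "x = w y" "y \<in> A0" using x by blast
  then have "y \<bullet> wall_root i > wall_level i" using i by (simp add: A0_eq)
  then show ?thesis using wall_height_diff[OF w i, of y] y(1) by simp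
qed

lemma neighbour_below_wall:
  assumes w: "w \<in> G" and i: "i \<le> n" and x: "x \<in> neighbour w i"
  shows "x \<bullet> inner_normal w i < wall_height w i"
proof -
  obtain y where y: "x = w (wall_reflection i y)" "y \<in> A0" using x by auto
  then have "y \<bullet> wall_root i > wall_level i" using i by (simp add: A0_eq)
  then show ?thesis
    using wall_height_diff[OF w i, of "wall_reflection i y"] wall_reflection_level[OF i, of y] y(1) by simp
qed

lemma facet_point_generic:
  assumes w: "w \<in> G" and i: "i \<le> n" and g: "\<gamma> \<in> \<Phi>" "w (wall_point i) \<bullet> \<gamma> \<in> \<int>"
  shows "\<gamma> = inner_normal w i \<or> \<gamma> = - inner_normal w i"
proof -
  have s: "affine_sym w" by (rule affine_weyl_sym[OF w])
  obtain \<delta> where d: "\<delta> \<in> \<Phi>" "\<gamma> = lin w \<delta>" using sym_facts(10)[OF s] g(1) by blast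
  obtain j :: int where j: "\<forall>x. w x \<bullet> lin w \<delta> = x \<bullet> \<delta> + of_int j" using image_level[OF s d(1)] ..
  have "wall_point i \<bullet> \<delta> = w (wall_point i) \<bullet> \<gamma> - of_int j" using j d(2) by simp
  then have "wall_point i \<bullet> \<delta> \<in> \<int>" using g(2) by simp
  then have "\<delta> = wall_root i \<or> \<delta> = - wall_root i" by (rule wall_point_generic[OF i d(1)])
  then show ?thesis using d(2) linear_neg[OF sym_facts(1)[OF s]] by (auto simp: inner_normal_def)
qed

lemma facet_point_in: "i \<le> n \<Longrightarrow> w (wall_point i) \<in> w ` wall_face i"
  using wall_point_in_face by blast

lemma facet_hyperplane:
  assumes w: "w \<in> G" and i: "i \<le> n" and a: "\<alpha> \<in> \<Phi>" "w ` wall_face i \<subseteq> hyperplane \<alpha> k"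
  shows "(\<alpha> = inner_normal w i \<and> k = wall_height w i) \<or> (\<alpha> = - inner_normal w i \<and> k = - wall_height w i)"
proof -
  let ?q = "w (wall_point i)"
  have qa: "?q \<bullet> \<alpha> = of_int k" using a(2) facet_point_in[OF i, of w] by (auto simp: hyperplane_def)
  have qb: "?q \<bullet> inner_normal w i = of_int (wall_height w i)"
    by (rule face_at_height[OF w i facet_point_in[OF i]])
  have "\<alpha> = inner_normal w i \<or> \<alpha> = - inner_normal w i" by (rule facet_point_generic[OF w i a(1)]) (simp add: qa)
  moreover have "k = wall_height w i" if "\<alpha> = inner_normal w i"
  proof -
    have "real_of_int k = real_of_int (wall_height w i)" using qa qb that by simp
    then show ?thesis by simp
  qed
  moreover have "k = - wall_height w i" if "\<alpha> = - inner_normal w i"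
  proof -
    have "real_of_int k = real_of_int (- wall_height w i)" using qa qb that by simp
    then show ?thesis by (simp only: of_int_eq_iff)
  qed
  ultimately show ?thesis by blast
qed

text \<open>
  For a regular point this says that at most the \<open>i\<close>-th wall of \<open>w A0\<close> lies between the point and the chosen
  facet point.
\<close>

definition beside_wall :: "(real ^ 'n \<Rightarrow> real ^ 'n) \<Rightarrow> nat \<Rightarrow> real ^ 'n \<Rightarrow> bool" where
  "beside_wall w i y \<longleftrightarrow>
     (\<forall>\<gamma>\<in>\<Phi>. \<gamma> \<noteq> inner_normal w i \<and> \<gamma> \<noteq> - inner_normal w i \<longrightarrow> \<lfloor>y \<bullet> \<gamma>\<rfloor> = \<lfloor>w (wall_point i) \<bullet> \<gamma>\<rfloor>) \<and>
     \<bar>y \<bullet> inner_normal w i - wall_height w i\<bar> < 1"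

text \<open>
  These are finitely many open conditions that hold at the facet point, which lies in the closure
  of the given set.
\<close>

lemma beside_wall_exists:
  assumes w: "w \<in> G" and i: "i \<le> n" and B: "w ` wall_face i \<subseteq> closure B"
  shows "\<exists>y\<in>B. beside_wall w i y"
proof -
  let ?\<beta> = "inner_normal w i" and ?q = "w (wall_point i)"
  have ev1: "\<forall>\<^sub>F y in nhds ?q. \<forall>\<gamma>\<in>\<Phi>. \<gamma> \<noteq> ?\<beta> \<and> \<gamma> \<noteq> - ?\<beta> \<longrightarrow> \<lfloor>y \<bullet> \<gamma>\<rfloor> = \<lfloor>?q \<bullet> \<gamma>\<rfloor>"
  proof (rule eventually_ball_finite[OF finite_roots], rule ballI)
    fix \<gamma> assume g: "\<gamma> \<in> \<Phi>"
    show "\<forall>\<^sub>F y in nhds ?q. \<gamma> \<noteq> ?\<beta> \<and> \<gamma> \<noteq> - ?\<beta> \<longrightarrow> \<lfloor>y \<bullet> \<gamma>\<rfloor> = \<lfloor>?q \<bullet> \<gamma>\<rfloor>"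
    proof (cases "?q \<bullet> \<gamma> \<in> \<int>")
      case False
      let ?U = "{y. \<gamma> \<bullet> y > \<lfloor>?q \<bullet> \<gamma>\<rfloor>} \<inter> {y. \<gamma> \<bullet> y < \<lfloor>?q \<bullet> \<gamma>\<rfloor> + 1}"
      have "?q \<bullet> \<gamma> \<noteq> of_int \<lfloor>?q \<bullet> \<gamma>\<rfloor>" using False by (metis Ints_of_int)
      then have "?q \<in> ?U" by (simp add: inner_commute[of \<gamma> ?q]) linarith
      moreover have "open ?U" by (intro open_Int open_halfspace_gt open_halfspace_lt)
      moreover have "\<lfloor>y \<bullet> \<gamma>\<rfloor> = \<lfloor>?q \<bullet> \<gamma>\<rfloor>" if "y \<in> ?U" for y
        using that by (simp add: inner_commute[of \<gamma> y]) linarith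
      ultimately show ?thesis unfolding eventually_nhds by blast
    next
      case True
      then have "\<gamma> = ?\<beta> \<or> \<gamma> = - ?\<beta>" by (rule facet_point_generic[OF w i g])
      then have "\<not> (\<gamma> \<noteq> ?\<beta> \<and> \<gamma> \<noteq> - ?\<beta>)" by blast
      then show ?thesis by (simp only: simp_thms eventually_True)
    qed
  qed
  have "open ({y. ?\<beta> \<bullet> y > of_int (wall_height w i) - 1} \<inter> {y. ?\<beta> \<bullet> y < of_int (wall_height w i) + 1})"
    (is "open ?W") by (intro open_Int open_halfspace_gt open_halfspace_lt)
  moreover have "?q \<in> ?W"
    using face_at_height[OF w i facet_point_in[OF i]] by (simp add: inner_commute[of ?\<beta> ?q])
  ultimately have ev2: "\<forall>\<^sub>F y in nhds ?q. y \<in> ?W" unfolding eventually_nhds by blast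
  let ?P = "\<lambda>y. (\<forall>\<gamma>\<in>\<Phi>. \<gamma> \<noteq> ?\<beta> \<and> \<gamma> \<noteq> - ?\<beta> \<longrightarrow> \<lfloor>y \<bullet> \<gamma>\<rfloor> = \<lfloor>?q \<bullet> \<gamma>\<rfloor>) \<and> y \<in> ?W"
  have "\<exists>V. open V \<and> ?q \<in> V \<and> (\<forall>y\<in>V. ?P y)"
    using eventually_conj[OF ev1 ev2] unfolding eventually_nhds .
  then obtain V where V: "open V" "?q \<in> V" and V': "\<forall>y\<in>V. ?P y" by (elim exE conjE) (rule that)
  have "?q \<in> closure B" by (rule subsetD[OF B facet_point_in[OF i]])
  then have "V \<inter> B \<noteq> {}" using open_Int_closure_eq_empty[OF V(1), of B] V(2) by (metis IntI empty_iff)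
  then obtain y where y: "y \<in> V" "y \<in> B" by (metis IntE all_not_in_conv)
  have "\<bar>y \<bullet> ?\<beta> - wall_height w i\<bar> < 1"
  proof -
    have "y \<in> ?W" using bspec[OF V' y(1)] by (rule conjunct2)
    then have "y \<bullet> ?\<beta> > of_int (wall_height w i) - 1" "y \<bullet> ?\<beta> < of_int (wall_height w i) + 1"
      unfolding Int_iff mem_Collect_eq inner_commute[of ?\<beta> y] by simp_all
    then show ?thesis by linarith
  qed
  then have "beside_wall w i y" unfolding beside_wall_def using conjunct1[OF bspec[OF V' y(1)]] by (intro conjI)
  then show ?thesis using y(2) by blast
qed

lemma beside_wall_same_floors:
  assumes y: "beside_wall w i y" and z: "beside_wall w i z"
    and side: "y \<bullet> inner_normal w i > wall_height w i \<and> z \<bullet> inner_normal w i > wall_height w i \<or>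
      y \<bullet> inner_normal w i < wall_height w i \<and> z \<bullet> inner_normal w i < wall_height w i"
    and g: "\<gamma> \<in> \<Phi>"
  shows "\<lfloor>y \<bullet> \<gamma>\<rfloor> = \<lfloor>z \<bullet> \<gamma>\<rfloor>"
proof -
  let ?r = "y \<bullet> inner_normal w i" and ?t = "z \<bullet> inner_normal w i" and ?m = "wall_height w i"
  have "\<bar>?r - ?m\<bar> < 1" "\<bar>?t - ?m\<bar> < 1"
    using conjunct2[OF y[unfolded beside_wall_def]] conjunct2[OF z[unfolded beside_wall_def]] .
  then have rt: "?m - 1 < ?r" "?r < ?m + 1" "?m - 1 < ?t" "?t < ?m + 1"
    by linarith+
  have fl: "\<lfloor>r\<rfloor> = \<lfloor>t\<rfloor> \<and> \<lfloor>- r\<rfloor> = \<lfloor>- t\<rfloor>"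
    if "real_of_int m - 1 < r" "r < real_of_int m + 1" "real_of_int m - 1 < t" "t < real_of_int m + 1"
      "r > real_of_int m \<and> t > real_of_int m \<or> r < real_of_int m \<and> t < real_of_int m" for r t m
    using that(5)
  proof
    assume *: "r > real_of_int m \<and> t > real_of_int m"
    have "\<lfloor>r\<rfloor> = m" "\<lfloor>t\<rfloor> = m" "\<lfloor>- r\<rfloor> = - m - 1" "\<lfloor>- t\<rfloor> = - m - 1"
      using * that(1-4) by linarith+
    then show ?thesis by simp
  next
    assume *: "r < real_of_int m \<and> t < real_of_int m"
    have "\<lfloor>r\<rfloor> = m - 1" "\<lfloor>t\<rfloor> = m - 1" "\<lfloor>- r\<rfloor> = - m" "\<lfloor>- t\<rfloor> = - m"
      using * that(1-4) by linarith+
    then show ?thesis by simp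
  qed
  note f = fl[OF _ _ _ _ side]
  consider "\<gamma> = inner_normal w i" | "\<gamma> = - inner_normal w i" | "\<gamma> \<noteq> inner_normal w i" "\<gamma> \<noteq> - inner_normal w i"
    by blast
  then show ?thesis
  proof cases
    case 1
    show ?thesis unfolding 1 by (rule conjunct1[OF f]) (use rt in simp_all)
  next
    case 2
    show ?thesis unfolding 2 inner_minus_right by (rule conjunct2[OF f]) (use rt in simp_all)
  next
    case 3
    then have "\<lfloor>v \<bullet> \<gamma>\<rfloor> = \<lfloor>w (wall_point i) \<bullet> \<gamma>\<rfloor>" if "beside_wall w i v" for v
      using that g unfolding beside_wall_def by blast
    then show ?thesis using y z by simp
  qed
qed

section \<open>Admissible steps\<close>

lemma own_facet: "w \<in> G \<Longrightarrow> i \<le> n \<Longrightarrow> w ` wall_face i facet_of closure (w ` A0)"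
  using facet_of_image[OF affine_weyl_sym wall_face_facet(1)] closure_sym_image[OF affine_weyl_sym] by simp

lemma admissible_step_iff:
  assumes w: "w \<in> G"
  shows "admissible_step e (w ` A0) i B \<longleftrightarrow> i \<le> n \<and> B \<in> alcoves e \<and> B \<noteq> w ` A0 \<and>
    w ` wall_face i facet_of closure B \<and>
    (\<exists>\<alpha>\<in>\<Phi>. \<exists>k. w ` wall_face i \<subseteq> hyperplane \<alpha> k \<and> \<not> separates \<alpha> k (w ` A0) A0)"
  unfolding admissible_step_def facet_of_type_iff[OF w] by blast

text \<open>
  Near a generic facet point there are only two alcoves, one on each side of the wall.
\<close>

lemma alcove_across_facet:
  assumes w: "w \<in> G" and i: "i \<le> n" and B: "B \<in> alcoves e" "w ` wall_face i \<subseteq> closure B" "B \<noteq> w ` A0"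
  shows "B = neighbour w i"
proof -
  let ?\<beta> = "inner_normal w i" and ?m = "wall_height w i"
  let ?A = "w ` A0" and ?A' = "neighbour w i"
  have alc: "?A \<in> alcoves e" "?A' \<in> alcoves e"
    by (intro image_A0_alcove affine_weyl_sym w wall_reflection_group i)+
  obtain y where y: "y \<in> B" "beside_wall w i y" using beside_wall_exists[OF w i B(2)] by blast
  obtain a where a: "a \<in> ?A" "beside_wall w i a"
    using beside_wall_exists[OF w i facet_of_imp_subset[OF own_facet[OF w i]]] by blast
  obtain a' where a': "a' \<in> ?A'" "beside_wall w i a'"
    using beside_wall_exists[OF w i facet_of_imp_subset[OF neighbour_facet[OF w i]]] by blast
  have yr: "regular y" "B = region y" using alcove_is_region[OF B(1) y(1)] by auto
  have ar: "?A = region a" and ar': "?A' = region a'"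
    using alcove_is_region[OF alc(1) a(1)] alcove_is_region[OF alc(2) a'(1)] by auto
  have "y \<bullet> ?\<beta> \<notin> \<int>" using yr(1) inner_normal_root[OF w i] unfolding regular_def by blast
  then have "y \<bullet> ?\<beta> \<noteq> ?m" by (metis Ints_of_int)
  then consider "y \<bullet> ?\<beta> > ?m" | "y \<bullet> ?\<beta> < ?m" by linarith
  then show ?thesis
  proof cases
    case 1
    have "\<lfloor>y \<bullet> \<gamma>\<rfloor> = \<lfloor>a \<bullet> \<gamma>\<rfloor>" if "\<gamma> \<in> \<Phi>" for \<gamma>
      by (rule beside_wall_same_floors[OF y(2) a(2) _ that]) (use 1 alcove_above_wall[OF w i a(1)] in simp)
    then have "B = region a" unfolding yr(2) region_def by auto
    then show ?thesis using ar B(3) by simp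
  next
    case 2
    have "\<lfloor>y \<bullet> \<gamma>\<rfloor> = \<lfloor>a' \<bullet> \<gamma>\<rfloor>" if "\<gamma> \<in> \<Phi>" for \<gamma>
      by (rule beside_wall_same_floors[OF y(2) a'(2) _ that]) (use 2 neighbour_below_wall[OF w i a'(1)] in simp)
    then have "B = region a'" unfolding yr(2) region_def by auto
    then show ?thesis using ar' by simp
  qed
qed

lemma admissible_target:
  assumes w: "w \<in> G" and adm: "admissible_step e (w ` A0) i B"
  shows "i \<le> n" "B = neighbour w i"
proof -
  show i: "i \<le> n" using adm admissible_step_iff[OF w] by blast
  show "B = neighbour w i"
    using adm unfolding admissible_step_iff[OF w]
    by (intro alcove_across_facet[OF w i]) (auto dest: facet_of_imp_subset)
qed

text \<open>
  In the chamber a negative inner normal pairs negatively with the alcove, so the wall has a level of at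
  most \<open>-1\<close> and \<open>A0\<close> lies on the same side.  As the level is not \<open>0\<close>, no wall of the chamber is crossed.
\<close>

lemma outward_step_admissible:
  assumes w: "w \<in> G" and i: "i \<le> n" and C: "w ` A0 \<subseteq> identity_chamber e"
    and neg: "inner_normal w i \<bullet> rho < 0"
  shows "admissible_step e (w ` A0) i (neighbour w i)"
    and "neighbour w i \<subseteq> identity_chamber e"
proof -
  let ?\<beta> = "inner_normal w i" and ?m = "wall_height w i"
  let ?A = "w ` A0" and ?A' = "neighbour w i"
  have alc: "?A \<in> alcoves e" "?A' \<in> alcoves e"
    by (intro image_A0_alcove affine_weyl_sym w wall_reflection_group i)+
  have beta: "?\<beta> \<in> \<Phi>" "- ?\<beta> \<in> \<Phi>" "- ?\<beta> \<bullet> rho > 0"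
    using inner_normal_root[OF w i] roots_uminus neg by auto
  have wb: "w base \<in> ?A" using base_in_A0 by blast
  have "w base \<bullet> ?\<beta> < 0" using chamber_positive_root[OF _ beta(2,3), of "w base"] C wb by auto
  then have m: "?m \<le> -1" using alcove_above_wall[OF w i wb] by linarith
  have "\<not> separates ?\<beta> ?m ?A A0"
  proof
    assume "separates ?\<beta> ?m ?A A0"
    then have "base \<bullet> ?\<beta> < ?m"
      using alcove_above_wall[OF w i wb] wb base_in_A0 unfolding separates_def by force
    moreover have "base \<bullet> ?\<beta> > -1" using A0_positive_root(2)[OF base_in_A0 beta(2,3)] by simp
    ultimately show False using m by linarith
  qed
  moreover have "w ` wall_face i \<subseteq> hyperplane ?\<beta> ?m"
    using face_at_height[OF w i] by (auto simp: hyperplane_def simp del: image_iff)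
  ultimately show "admissible_step e ?A i ?A'"
    unfolding admissible_step_iff[OF w]
    using i alc(2) neighbour_ne[OF w i] neighbour_facet[OF w i] beta(1) by blast
  obtain a where a: "a \<in> ?A" "beside_wall w i a"
    using beside_wall_exists[OF w i facet_of_imp_subset[OF own_facet[OF w i]]] by blast
  obtain a' where a': "a' \<in> ?A'" "beside_wall w i a'"
    using beside_wall_exists[OF w i facet_of_imp_subset[OF neighbour_facet[OF w i]]] by blast
  have fl: "\<lfloor>a' \<bullet> \<gamma>\<rfloor> \<ge> 0" if g: "\<gamma> \<in> \<Phi>" and ag: "a \<bullet> \<gamma> > 0" for \<gamma>
  proof -
    consider "\<gamma> = ?\<beta>" | "\<gamma> = - ?\<beta>" | "\<gamma> \<noteq> ?\<beta>" "\<gamma> \<noteq> - ?\<beta>" by blast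
    then show ?thesis
    proof cases
      case 1
      then show ?thesis using a(2) ag m unfolding beside_wall_def by auto
    next
      case 2
      have "a' \<bullet> \<gamma> > 0" using 2 neighbour_below_wall[OF w i a'(1)] m by simp
      then show ?thesis by simp
    next
      case 3
      then have "\<lfloor>a' \<bullet> \<gamma>\<rfloor> = \<lfloor>a \<bullet> \<gamma>\<rfloor>" using a(2) a'(2) g by (simp add: beside_wall_def)
      then show ?thesis using ag by simp
    qed
  qed
  have r': "?A' = region a'" using alcove_is_region[OF alc(2) a'(1)] by simp
  show "?A' \<subseteq> identity_chamber e"
    unfolding identity_chamber_def n_card[symmetric]
  proof (intro subsetI CollectI allI impI)
    fix z j assume z: "z \<in> ?A'" and j: "j < n"
    have g: "simple_root e j \<in> \<Phi>" using wall_root_in_roots[of j] j by (simp add: wall_root_def)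
    have "a \<bullet> simple_root e j > 0" using a(1) C j by (auto simp: identity_chamber_def n_card)
    then have "\<lfloor>a' \<bullet> simple_root e j\<rfloor> \<ge> 0" by (rule fl[OF g])
    then have "\<lfloor>z \<bullet> simple_root e j\<rfloor> \<ge> 0" "z \<bullet> simple_root e j \<notin> \<int>"
      using z g unfolding r' region_def regular_def by auto
    then show "z \<bullet> simple_root e j > 0" by (metis Ints_0 order_le_less zero_le_floor)
  qed
qed

text \<open>
  If the inner normal were positive and the target still in the chamber, the wall would have a
  positive level and so separate the alcove from \<open>A0\<close>.
\<close>

lemma step_within_chamber_outward:
  assumes w: "w \<in> G" and C: "w ` A0 \<subseteq> identity_chamber e" "B \<subseteq> identity_chamber e"
    and adm: "admissible_step e (w ` A0) i B"
  shows "inner_normal w i \<bullet> rho < 0"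
proof (rule ccontr)
  let ?\<beta> = "inner_normal w i"
  note t = admissible_target[OF w adm]
  assume "\<not> ?\<beta> \<bullet> rho < 0"
  then have pos: "?\<beta> \<bullet> rho > 0" using root_rho_sign[OF inner_normal_root[OF w t(1)]] by simp
  let ?m = "wall_height w i"
  have "(w \<circ> wall_reflection i) base \<in> B" unfolding t(2) using base_in_A0 by blast
  moreover from this have "(w \<circ> wall_reflection i) base \<bullet> ?\<beta> > 0"
    using chamber_positive_root[OF _ inner_normal_root[OF w t(1)] pos] C(2) by blast
  moreover have "(w \<circ> wall_reflection i) base \<bullet> ?\<beta> < ?m"
    using neighbour_below_wall[OF w t(1)] base_in_A0 by blast
  ultimately have m: "?m \<ge> 1" by linarith
  have A0m: "x \<bullet> ?\<beta> < ?m" if "x \<in> A0" for x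
    using A0_positive_root(2)[OF that inner_normal_root[OF w t(1)] pos] m by linarith
  obtain \<alpha> k where ak: "\<alpha> \<in> \<Phi>" "w ` wall_face i \<subseteq> hyperplane \<alpha> k" "\<not> separates \<alpha> k (w ` A0) A0"
    using adm unfolding admissible_step_iff[OF w] by blast
  have "w ` A0 \<subseteq> {x. x \<bullet> ?\<beta> > ?m}" "A0 \<subseteq> {x. x \<bullet> ?\<beta> < ?m}"
    using alcove_above_wall[OF w t(1)] A0m by blast+
  moreover have "(\<alpha> = ?\<beta> \<and> k = ?m) \<or> (\<alpha> = - ?\<beta> \<and> k = - ?m)" by (rule facet_hyperplane[OF w t(1) ak(1,2)])
  ultimately have "separates \<alpha> k (w ` A0) A0"
    unfolding separates_def by (elim disjE conjE) simp_all
  then show False using ak(3) by simp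
qed

section \<open>Labels, words and heights\<close>

definition label :: "(real ^ 'n \<Rightarrow> real ^ 'n) \<Rightarrow> int list" where
  "label w = map (\<lambda>j. \<lfloor>lin w (e j) \<bullet> rho\<rfloor>) [1..<Suc n]"

lemma length_label [simp]: "length (label w) = n"
  by (simp add: label_def)

lemma axis_rho_int: "b \<in> axis_vectors \<Longrightarrow> real_of_int \<lfloor>b \<bullet> rho\<rfloor> = b \<bullet> rho"
  by (elim axis_cases) (simp_all add: rho_e inner_commute[of _ rho])

lemma label_nth:
  assumes "w \<in> G" "k < n"
  shows "real_of_int (label w ! k) = lin w (e (Suc k)) \<bullet> rho"
proof -
  have "lin w (e (Suc k)) \<in> axis_vectors"
    using sym_facts(7)[OF affine_weyl_sym[OF assms(1)] e_axis] assms(2) by simp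
  then have "real_of_int \<lfloor>lin w (e (Suc k)) \<bullet> rho\<rfloor> = lin w (e (Suc k)) \<bullet> rho" by (rule axis_rho_int)
  then show ?thesis using assms(2) by (simp add: label_def del: upt_Suc)
qed

lemma active_label:
  assumes w: "w \<in> G" and i: "i \<le> n"
  shows "active i (label w) \<longleftrightarrow> inner_normal w i \<bullet> rho < 0"
proof -
  note l = sym_facts(1)[OF affine_weyl_sym[OF w]]
  consider "i = 0" | "0 < i" "i < n" | "i = n" using i by linarith
  then show ?thesis
  proof cases
    case 1
    have "real_of_int (label w ! 0) = inner_normal w i \<bullet> rho"
      using label_nth[OF w, of 0] n2 1 by (simp add: inner_normal_def wall_root_simps)
    then show ?thesis using 1 unfolding active_def by (metis of_int_less_0_iff)
  next
    case 2
    have "real_of_int (label w ! i - label w ! (i - 1)) = inner_normal w i \<bullet> rho"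
      using label_nth[OF w, of i] label_nth[OF w, of "i - 1"] 2
      by (simp add: inner_normal_def wall_root_simps linear_diff[OF l] inner_diff_left)
    moreover have "active i (label w) \<longleftrightarrow> label w ! i - label w ! (i - 1) < 0" using 2 by (simp add: active_def)
    ultimately show ?thesis by (metis of_int_less_0_iff)
  next
    case 3
    have "lin w (wall_root n) = - lin w (e (n - 1)) - lin w (e n)"
      by (simp add: wall_root_simps linear_diff[OF l] linear_neg[OF l])
    then have "- real_of_int (label w ! (n - 2) + label w ! (n - 1)) = inner_normal w i \<bullet> rho"
      using label_nth[OF w, of "n - 2"] label_nth[OF w, of "n - 1"] 3 n2
      by (simp add: inner_normal_def inner_diff_left numeral_2_eq_2 Suc_diff_Suc)
    moreover have "active i (label w) \<longleftrightarrow> label w ! (n - 2) + label w ! (n - 1) > 0" using 3 n2 by (simp add: active_def)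
    ultimately show ?thesis by (metis neg_less_0_iff_less of_int_0_less_iff)
  qed
qed

lemma linear_wall_reflection:
  assumes j: "j \<in> {1..n}" and i: "i \<le> n"
  shows "affine_reflection (wall_root i) 0 (e j) =
    (if i = 0 then (if j = 1 then - e 1 else e j)
     else if i < n then (if j = i then e (Suc i) else if j = Suc i then e i else e j)
     else (if j = n - 1 then - e n else if j = n then - e (n - 1) else e j))"
proof -
  consider "i = 0" | "0 < i" "i < n" | "i = n" using i by linarith
  then show ?thesis
  proof cases
    case 1
    have "e 1 \<bullet> e 1 = 1" "e j \<bullet> e 1 = (if j = 1 then 1 else 0)" using inner_e[of 1 1] inner_e[of j 1] j n2 by auto
    then show ?thesis using 1 by (auto simp: affine_reflection_def wall_root_simps scaleR_2)
  next
    case 2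
    have "wall_root i \<bullet> wall_root i = 2" "e j \<bullet> wall_root i = (if j = Suc i then 1 else if j = i then -1 else 0)"
      using 2 j by (auto simp: wall_root_simps inner_diff_left inner_diff_right inner_e)
    then show ?thesis using 2 by (auto simp: affine_reflection_def wall_root_simps)
  next
    case 3
    have "wall_root n \<bullet> wall_root n = 2" "e j \<bullet> wall_root n = (if j = n then -1 else if j = n - 1 then -1 else 0)"
      using n2 j by (auto simp: wall_root_simps inner_diff_left inner_diff_right inner_e)
    then show ?thesis using 3 n2 by (auto simp: affine_reflection_def wall_root_simps)
  qed
qed

lemma lin_comp_reflection:
  assumes "w \<in> G"
  shows "lin (w \<circ> wall_reflection i) x = lin w (affine_reflection (wall_root i) 0 x)"
proof -
  have "lin (w \<circ> wall_reflection i) x = lin w (wall_reflection i x) - lin w (wall_reflection i 0)"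
    by (simp add: lin_def)
  also have "\<dots> = lin w (wall_reflection i x - wall_reflection i 0)"
    using linear_diff[OF sym_facts(1)[OF affine_weyl_sym[OF assms]]] by simp
  also have "wall_reflection i x - wall_reflection i 0 = affine_reflection (wall_root i) 0 x"
    unfolding wall_reflection_def reflection_shape[of _ "wall_level i"]
    by (simp add: affine_reflection_def)
  finally show ?thesis .
qed

text \<open>
  The linear part of a wall reflection permutes the basis vectors up to sign in the way the move
  permutes the entries.
\<close>

lemma label_step:
  assumes w: "w \<in> G" and i: "i \<le> n"
  shows "label (w \<circ> wall_reflection i) = move i (label w)"
proof (rule nth_equalityI)
  fix k assume "k < length (label (w \<circ> wall_reflection i))"
  then have k: "k < n" by simp
  note l = sym_facts(1)[OF affine_weyl_sym[OF w]]
  have w': "w \<circ> wall_reflection i \<in> G" by (rule wall_reflection_group[OF w i])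
  have L: "real_of_int (label (w \<circ> wall_reflection i) ! k) = lin w (affine_reflection (wall_root i) 0 (e (Suc k))) \<bullet> rho"
    using label_nth[OF w' k] lin_comp_reflection[OF w] by simp
  have R: "real_of_int (move i (label w) ! k) = lin w (affine_reflection (wall_root i) 0 (e (Suc k))) \<bullet> rho"
  proof -
    consider "i = 0" | "0 < i" "i < n" | "i = n" using i by linarith
    then show ?thesis
    proof cases
      case 1
      then show ?thesis using k label_nth[OF w k] linear_neg[OF l]
        by (subst linear_wall_reflection) (auto simp: move_def)
    next
      case 2
      then show ?thesis using k label_nth[OF w, of k] label_nth[OF w, of i] label_nth[OF w, of "i - 1"]
        by (subst linear_wall_reflection) (auto simp: move_def nth_list_update)
    next
      case 3
      have "Suc (n - 2) = n - 1" "Suc (n - 1) = n" using n2 by auto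
      then show ?thesis using 3 k n2 label_nth[OF w, of k] label_nth[OF w, of "n - 2"] label_nth[OF w, of "n - 1"] linear_neg[OF l]
        by (subst linear_wall_reflection) (auto simp: move_def nth_list_update)
    qed
  qed
  have "real_of_int (label (w \<circ> wall_reflection i) ! k) = real_of_int (move i (label w) ! k)" unfolding L R ..
  then show "label (w \<circ> wall_reflection i) ! k = move i (label w) ! k" by (simp only: of_int_eq_iff)
qed simp

definition word :: "nat \<Rightarrow> (real ^ 'n \<Rightarrow> real ^ 'n) \<Rightarrow> int list" where
  "word k w = map (coarsen k) (label w)"

lemma length_word [simp]: "length (word k w) = n"
  by (simp add: word_def)

lemma word_letters: "set (word k w) \<subseteq> {-1,0,1}"
  using coarsen_letter by (auto simp: word_def)

lemma word_step: "w \<in> G \<Longrightarrow> i \<le> n \<Longrightarrow> word k (w \<circ> wall_reflection i) = move i (word k w)"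
  using n2 by (simp add: word_def label_step move_coarsen)

lemma abs_labels:
  assumes w: "w \<in> G"
  shows "distinct (map abs (label w))" "set (map abs (label w)) = {1..int n}"
proof -
  note f = sym_facts[OF affine_weyl_sym[OF w]]
  have ex: "\<exists>a\<in>{1..n}. (lin w (e (Suc j)) = e a \<or> lin w (e (Suc j)) = - e a) \<and> \<bar>label w ! j\<bar> = int a" if j: "j < n" for j
  proof (cases rule: axis_cases[OF f(7)[OF e_axis[of "Suc j"]]])
    case 1
    then show ?case using j by simp
  next
    case (2 a)
    have "real_of_int (label w ! j) = real a" using label_nth[OF w j] 2 by (simp add: rho_e inner_commute[of _ rho])
    then have "label w ! j = int a" by (metis of_int_eq_iff of_int_of_nat_eq)
    then show ?thesis using 2 by auto
  next
    case (3 a)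
    have "real_of_int (label w ! j) = real_of_int (- int a)" using label_nth[OF w j] 3 by (simp add: rho_e inner_commute[of _ rho])
    then have "label w ! j = - int a" by (simp only: of_int_eq_iff)
    then show ?thesis using 3 by auto
  qed
  show d: "distinct (map abs (label w))"
    unfolding distinct_conv_nth
  proof (intro allI impI)
    fix j j' assume jj: "j < length (map abs (label w))" "j' < length (map abs (label w))" "j \<noteq> j'"
    then have jn: "j < n" "j' < n" by auto
    obtain a where a: "lin w (e (Suc j)) = e a \<or> lin w (e (Suc j)) = - e a" "a \<in> {1..n}" "\<bar>label w ! j\<bar> = int a" using ex[OF jn(1)] by blast
    obtain b where b: "lin w (e (Suc j')) = e b \<or> lin w (e (Suc j')) = - e b" "b \<in> {1..n}" "\<bar>label w ! j'\<bar> = int b" using ex[OF jn(2)] by blast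
    have "lin w (e (Suc j)) \<bullet> lin w (e (Suc j')) = 0" unfolding f(2) using jj by (simp add: inner_e)
    then have "a \<noteq> b" using a b by (auto simp: inner_e)
    then show "map abs (label w) ! j \<noteq> map abs (label w) ! j'" using a b jj by simp
  qed
  have "set (map abs (label w)) \<subseteq> {1..int n}"
  proof
    fix x assume "x \<in> set (map abs (label w))"
    then obtain j where "j < n" "x = \<bar>label w ! j\<bar>" by (auto simp: in_set_conv_nth)
    then show "x \<in> {1..int n}" using ex[of j] by auto
  qed
  moreover have "card (set (map abs (label w))) = card {1..int n}" using distinct_card[OF d] by simp
  ultimately show "set (map abs (label w)) = {1..int n}" by (intro card_subset_eq) auto
qed

lemma word_in_words:
  assumes w: "w \<in> G" and k: "1 \<le> k" "k \<le> n"
  shows "word k w \<in> words n (k - 1)"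
proof -
  have "count_list (map (coarsen k) u) 0 = length (filter (\<lambda>a. a < int k) (map abs u))" for u
    by (induction u) (auto simp: coarsen_eq_0[OF k(1)])
  then have "count_list (word k w) 0 = length (filter (\<lambda>a. a < int k) (map abs (label w)))" by (simp add: word_def)
  also have "\<dots> = card (set (filter (\<lambda>a. a < int k) (map abs (label w))))"
    by (rule distinct_card[symmetric], rule distinct_filter, rule abs_labels(1)[OF w])
  also have "set (filter (\<lambda>a. a < int k) (map abs (label w))) = {a \<in> {1..int n}. a < int k}"
    unfolding set_filter abs_labels(2)[OF w] ..
  also have "\<dots> = {1..int (k - 1)}" using k by auto
  finally have "count_list (word k w) 0 = k - 1" by simp
  then show ?thesis using word_letters by (auto simp: words_def)
qed

definition tail :: "nat \<Rightarrow> real ^ 'n" where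
  "tail k = (\<Sum>j=k..n. e j)"

text \<open>
  The net number of times a label \<open>-j\<close> with \<open>j \<ge> k\<close> has become \<open>j\<close> at the left end, expressed through
  the current alcove.  The lattice part counts the net sign changes from \<open>j\<close> to \<open>-j\<close> at the right
  end, and the labels that are negative now have not yet been changed back at the left end.
\<close>

definition height :: "nat \<Rightarrow> (real ^ 'n \<Rightarrow> real ^ 'n) \<Rightarrow> real" where
  "height k w = w 0 \<bullet> tail k - minus_count (word k w)"

lemma axis_tail:
  assumes "b \<in> axis_vectors" "k \<ge> 1"
  shows "b \<bullet> tail k = of_int (coarsen k \<lfloor>b \<bullet> rho\<rfloor>)"
proof -
  have t: "e a \<bullet> tail k = (if a \<ge> k then 1 else 0)" if "a \<in> {1..n}" for a
  proof -
    have "e a \<bullet> tail k = (\<Sum>j=k..n. if j = a then 1 else 0)"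
      unfolding tail_def inner_sum_right using that assms(2) by (intro sum.cong) (auto simp: inner_e)
    then show ?thesis using that by simp
  qed
  show ?thesis using assms(1)
  proof (cases rule: axis_cases)
    case (1 a)
    then have "\<lfloor>b \<bullet> rho\<rfloor> = int a" by (simp add: rho_e inner_commute[of _ rho])
    then show ?thesis using 1 t[OF 1(1)] assms(2) by (auto simp: coarsen_def)
  next
    case (2 a)
    then have "b \<bullet> rho = real_of_int (- int a)" by (simp add: rho_e inner_commute[of _ rho])
    then have "\<lfloor>b \<bullet> rho\<rfloor> = - int a" by (simp only: floor_of_int)
    then show ?thesis using 2 t[OF 2(1)] assms(2) by (auto simp: coarsen_def)
  qed
qed

lemma word_nth:
  assumes "w \<in> G" "j < n" "k \<ge> 1"
  shows "real_of_int (word k w ! j) = lin w (e (Suc j)) \<bullet> tail k"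
proof -
  have "lin w (e (Suc j)) \<in> axis_vectors"
    using sym_facts(7)[OF affine_weyl_sym[OF assms(1)] e_axis] assms(2) by simp
  moreover from this have "label w ! j = \<lfloor>lin w (e (Suc j)) \<bullet> rho\<rfloor>"
    using label_nth[OF assms(1,2)] axis_rho_int by (metis of_int_eq_iff)
  ultimately show ?thesis using assms axis_tail by (simp add: word_def)
qed

text \<open>
  At the right end the lattice part and the number of negative letters change by the same amount; only
  the sign change at the left end is visible.
\<close>

lemma height_step:
  assumes w: "w \<in> G" and i: "i \<le> n" and k: "k \<ge> 1"
  shows "height k (w \<circ> wall_reflection i) = height k w - (if i = 0 then of_int (word k w ! 0) else 0)"
proof -
  note l = sym_facts(1)[OF affine_weyl_sym[OF w]]
  have c: "minus_count (move i (word k w)) = minus_count (word k w) +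
    (if i = 0 then word k w ! 0 else if i < n then 0 else word k w ! (n - 2) + word k w ! (n - 1))"
    using minus_count_move[of "word k w" i] n2 i word_letters by simp
  consider "i < n" | "i = n" using i by linarith
  then show ?thesis
  proof cases
    case 1
    then have "wall_reflection i 0 = 0" by (simp add: wall_reflection_def affine_reflection_def wall_level_def)
    then show ?thesis using c 1 by (simp add: height_def word_step[OF w i])
  next
    case 2
    have "wall_root n \<bullet> wall_root n = 2" using n2 by (simp add: wall_root_simps inner_diff_left inner_diff_right inner_e)
    then have "wall_reflection n 0 = e (n - 1) + e n"
      by (simp add: wall_reflection_def affine_reflection_def wall_level_def) (simp add: wall_root_simps)
    then have "w (wall_reflection n 0) = w 0 + lin w (e (n - 1)) + lin w (e n)"
      using linear_add[OF l, of "e (n - 1)" "e n"] by (simp add: lin_def algebra_simps)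
    moreover have "lin w (e (n - 1)) \<bullet> tail k = word k w ! (n - 2)" "lin w (e n) \<bullet> tail k = word k w ! (n - 1)"
      using word_nth[OF w, of "n - 2" k] word_nth[OF w, of "n - 1" k] n2 k by (simp_all add: numeral_2_eq_2 Suc_diff_Suc)
    ultimately show ?thesis using c 2 n2 word_step[OF w, of n k] by (simp add: height_def inner_add_left)
  qed
qed

lemma A0_coord_bounds:
  assumes "x \<in> A0" "b \<in> axis_vectors"
  shows "\<bar>x \<bullet> b\<bar> < 1"
  using assms(2)
proof (cases rule: axis_cases)
  case (1 i)
  have "e i \<in> \<Phi>" "e i \<bullet> rho > 0" using 1 e_axis by (auto simp: roots_eq rho_e inner_commute[of _ rho])
  then show ?thesis using A0_positive_root[OF assms(1), of "e i"] 1 by simp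
next
  case (2 i)
  have "e i \<in> \<Phi>" "e i \<bullet> rho > 0" using 2 e_axis by (auto simp: roots_eq rho_e inner_commute[of _ rho])
  then show ?thesis using A0_positive_root[OF assms(1), of "e i"] 2 by simp
qed

text \<open>
  All coordinates of a point of the fundamental alcove, and hence of its image under a signed
  permutation, have absolute value below \<open>1\<close>.
\<close>

lemma height_near:
  assumes w: "w \<in> G" and x: "x \<in> w ` A0" and k: "k \<ge> 1"
  shows "\<bar>x \<bullet> tail k - height k w\<bar> \<le> 2 * real n"
proof -
  note f = sym_facts[OF affine_weyl_sym[OF w]]
  obtain y where y: "x = w y" "y \<in> A0" using x by blast
  have "\<bar>lin w y \<bullet> e j\<bar> \<le> 1" if j: "j \<in> {k..n}" for j
  proof -
    have "e j \<in> lin w ` axis_vectors" using f(8) e_axis[of j] j k by auto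
    then obtain b where b: "b \<in> axis_vectors" "e j = lin w b" by blast
    then have "lin w y \<bullet> e j = y \<bullet> b" using f(2) by simp
    then show ?thesis using A0_coord_bounds[OF y(2) b(1)] by simp
  qed
  then have "\<bar>lin w y \<bullet> tail k\<bar> \<le> (\<Sum>j=k..n. 1)"
    unfolding tail_def inner_sum_right by (intro order.trans[OF sum_abs] sum_mono) auto
  also have "\<dots> \<le> real n" using k by simp
  finally have "\<bar>lin w y \<bullet> tail k\<bar> \<le> real n" .
  moreover have "x \<bullet> tail k - height k w = lin w y \<bullet> tail k + minus_count (word k w)"
    by (simp add: y(1) height_def lin_def inner_diff_left)
  moreover have "0 \<le> minus_count (word k w)" "minus_count (word k w) \<le> real n"
    using minus_count_bounds[of "word k w"] by auto
  ultimately show ?thesis by linarith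
qed

text \<open>
  The height grows at rate \<open>2\<close> when the first letter is \<open>-1\<close> (\<open>kac_label n 0 = 2\<close>); adding the solution
  of the Poisson equation replaces this rate by its mean.
\<close>

lemma drift:
  assumes w: "w \<in> G" and k: "1 \<le> k" "k \<le> n"
    and h: "solves_poisson n (k - 1) h"
  shows "(\<Sum>i\<le>n. if active i (label w) then kac_label n i *
     (height k (w \<circ> wall_reflection i) - height k w + (h (word k (w \<circ> wall_reflection i)) - h (word k w))) else 0)
     = current n (k - 1)"
proof -
  let ?u = "word k w"
  have nth0: "?u ! 0 = coarsen k (label w ! 0)" using n2 by (simp add: word_def)
  have "(\<Sum>i\<le>n. if active i (label w) then kac_label n i *
     (height k (w \<circ> wall_reflection i) - height k w + (h (word k (w \<circ> wall_reflection i)) - h (word k w))) else 0) =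
    (\<Sum>i\<le>n. (if i = 0 then (if ?u ! 0 = -1 then 2 else 0) else 0) +
       (if active i ?u then kac_label n i * (h (move i ?u) - h ?u) else 0))"
  proof (rule sum.cong[OF refl])
    fix i assume "i \<in> {..n}"
    then have i: "i \<le> n" by simp
    have imp: "active i ?u \<Longrightarrow> active i (label w)" using active_coarsen[of "label w" i k] n2 i by (simp add: word_def)
    have cs: "active i ?u \<or> move i ?u = ?u" if "active i (label w)"
      using coarse_step_cases[of "label w" i k] that n2 i by (simp add: word_def move_coarsen)
    have first: "(if active 0 (label w) then - kac_label n 0 * real_of_int (?u ! 0) else 0) = (if ?u ! 0 = -1 then 2 else 0)"
      using n2 unfolding nth0 by (auto simp: active_def kac_label_def coarsen_def sgn_if split: if_splits)
    show "(if active i (label w) then kac_label n i *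
       (height k (w \<circ> wall_reflection i) - height k w + (h (word k (w \<circ> wall_reflection i)) - h (word k w))) else 0) =
      (if i = 0 then (if ?u ! 0 = -1 then 2 else 0) else 0) +
       (if active i ?u then kac_label n i * (h (move i ?u) - h ?u) else 0)"
      unfolding height_step[OF w i k(1)] word_step[OF w i]
      using imp cs first by (cases "active i (label w)"; cases "active i ?u"; cases "i = 0") (auto simp: algebra_simps)
  qed
  also have "\<dots> = (if ?u ! 0 = -1 then 2 else 0) + (current n (k - 1) - (if ?u ! 0 = -1 then 2 else 0))"
    unfolding sum.distrib using h[unfolded solves_poisson_def, rule_format, OF word_in_words[OF w k]] by simp
  finally show ?thesis by simp
qed

text \<open>
  Labels that are positive and increasing have a positive sum at the right end.
\<close>

lemma some_move_active:
  assumes "w \<in> G"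
  shows "\<exists>i\<le>n. active i (label w)"
proof (rule ccontr)
  let ?l = "label w"
  assume "\<not> ?thesis"
  then have na: "\<And>i. i \<le> n \<Longrightarrow> \<not> active i ?l" by blast
  have nz: "?l ! j \<noteq> 0" if "j < n" for j
  proof -
    have "\<bar>?l ! j\<bar> \<in> set (map abs ?l)" using that by simp
    then show ?thesis unfolding abs_labels(2)[OF assms] by auto
  qed
  have pos: "?l ! j > 0" if "j < n" for j using that
  proof (induction j)
    case 0
    then show ?case using na[of 0] nz[of 0] by (auto simp: active_def)
  next
    case (Suc j)
    then show ?case using na[of "Suc j"] by (auto simp: active_def)
  qed
  show False using na[of n] pos[of "n - 2"] pos[of "n - 1"] n2 by (auto simp: active_def)
qed

section \<open>The walk in the identity chamber\<close>

lemma countable_alcoves: "countable (alcoves e)"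
proof -
  have "alcoves e \<subseteq> (\<lambda>f. {y. regular y \<and> (\<forall>\<gamma>\<in>\<Phi>. \<lfloor>y \<bullet> \<gamma>\<rfloor> = f \<gamma>)}) ` (\<Pi>\<^sub>E \<gamma>\<in>\<Phi>. (UNIV :: int set))"
  proof
    fix B assume B: "B \<in> alcoves e"
    then obtain x where x: "x \<in> B" using in_components_nonempty unfolding alcoves_def by blast
    have "B = region x" using alcove_is_region[OF B x] by simp
    also have "\<dots> = {y. regular y \<and> (\<forall>\<gamma>\<in>\<Phi>. \<lfloor>y \<bullet> \<gamma>\<rfloor> = restrict (\<lambda>\<gamma>. \<lfloor>x \<bullet> \<gamma>\<rfloor>) \<Phi> \<gamma>)}"
      by (auto simp: region_def)
    finally have B_eq: "B = {y. regular y \<and> (\<forall>\<gamma>\<in>\<Phi>. \<lfloor>y \<bullet> \<gamma>\<rfloor> = restrict (\<lambda>\<gamma>. \<lfloor>x \<bullet> \<gamma>\<rfloor>) \<Phi> \<gamma>)}" .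
    show "B \<in> (\<lambda>f. {y. regular y \<and> (\<forall>\<gamma>\<in>\<Phi>. \<lfloor>y \<bullet> \<gamma>\<rfloor> = f \<gamma>)}) ` (\<Pi>\<^sub>E \<gamma>\<in>\<Phi>. (UNIV :: int set))"
      by (rule image_eqI[where x = "restrict (\<lambda>\<gamma>. \<lfloor>x \<bullet> \<gamma>\<rfloor>) \<Phi>"], rule B_eq) simp
  qed
  moreover have "countable (\<Pi>\<^sub>E \<gamma>\<in>\<Phi>. (UNIV :: int set))"
    by (rule countable_PiE[OF finite_roots]) auto
  ultimately show ?thesis by (meson countable_image countable_subset)
qed

abbreviation C :: "(real ^ 'n) set" where "C \<equiv> identity_chamber e"
abbreviation K :: "(real ^ 'n) set \<Rightarrow> (real ^ 'n) set \<Rightarrow> real" where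
  "K \<equiv> transition_prob e (kac_label n)"

definition group_alcoves :: "(real ^ 'n) set set" where
  "group_alcoves = (\<lambda>w. w ` A0) ` G"

definition rep :: "(real ^ 'n) set \<Rightarrow> real ^ 'n \<Rightarrow> real ^ 'n" where
  "rep A = (SOME w. w \<in> G \<and> A = w ` A0)"

lemma rep: "A \<in> group_alcoves \<Longrightarrow> rep A \<in> G" "A \<in> group_alcoves \<Longrightarrow> A = rep A ` A0"
  unfolding group_alcoves_def rep_def using someI_ex[of "\<lambda>w. w \<in> G \<and> A = w ` A0"] by blast+

lemma rep_image:
  assumes "w \<in> G"
  shows "rep (w ` A0) = w"
proof -
  have "w ` A0 \<in> group_alcoves" using assms by (simp add: group_alcoves_def)
  then show ?thesis using rep alcove_representation_unique assms by metis
qed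

definition neighbours :: "(real ^ 'n) set \<Rightarrow> (real ^ 'n) set set" where
  "neighbours A = {B. K A B \<noteq> 0}"

lemma positive_step:
  assumes "w \<in> G" "K (w ` A0) B \<noteq> 0"
  obtains i where "i \<le> n" "admissible_step e (w ` A0) i B" "B = neighbour w i"
proof -
  have "\<exists>i. i \<le> n \<and> admissible_step e (w ` A0) i B"
  proof (rule ccontr)
    assume "\<not> ?thesis"
    then have empty: "{i. i \<le> CARD('n) \<and> admissible_step e (w ` A0) i B} = {}" by (auto simp: n_card)
    show False using assms(2) unfolding transition_prob_def empty by simp
  qed
  then obtain i where i: "i \<le> n" "admissible_step e (w ` A0) i B" by blast
  show ?thesis by (rule that[OF i admissible_target(2)[OF assms(1) i(2)]])
qed

lemma neighbours_subset: "w \<in> G \<Longrightarrow> neighbours (w ` A0) \<subseteq> (\<lambda>i. neighbour w i) ` {..n}"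
proof
  fix B assume "w \<in> G" "B \<in> neighbours (w ` A0)"
  then have "K (w ` A0) B \<noteq> 0" by (simp add: neighbours_def)
  then obtain i where "i \<le> n" "B = neighbour w i" by (rule positive_step[OF \<open>w \<in> G\<close>])
  then show "B \<in> (\<lambda>i. neighbour w i) ` {..n}" by (intro image_eqI[of _ _ i]) simp_all
qed

definition total_rate :: "(real ^ 'n \<Rightarrow> real ^ 'n) \<Rightarrow> real" where
  "total_rate w = (\<Sum>i\<le>n. if active i (label w) then kac_label n i else 0)"

lemma total_rate_bounds:
  assumes "w \<in> G"
  shows "1 \<le> total_rate w" "total_rate w \<le> 2 * (real n + 1)"
proof -
  obtain i where i: "i \<le> n" "active i (label w)" using some_move_active[OF assms] by blast
  have "1 \<le> (if active i (label w) then kac_label n i else 0)" using i by (simp add: kac_label_def)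
  also have "\<dots> \<le> total_rate w"
    unfolding total_rate_def by (rule member_le_sum) (use i in \<open>auto simp: kac_label_def\<close>)
  finally show "1 \<le> total_rate w" .
  have "total_rate w \<le> (\<Sum>i\<le>n. 2)"
    unfolding total_rate_def by (rule sum_mono) (simp add: kac_label_def)
  then show "total_rate w \<le> 2 * (real n + 1)" by simp
qed

text \<open>
  The divisor is the normalisation of the transition probabilities, which also counts the steps that leave
  the chamber.  It is the same for all steps, so a vanishing rate-weighted sum over the active moves makes the
  conditional mean vanish.
\<close>

lemma chamber_transition_sum:
  fixes f :: "(real ^ 'n) set \<Rightarrow> real"
  assumes w: "w \<in> G" and wC: "w ` A0 \<subseteq> C"
  shows "\<exists>D. (\<Sum>B\<in>neighbours (w ` A0). K (w ` A0) B * (if B \<subseteq> C then f B else 0)) =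
    (\<Sum>i\<le>n. if active i (label w) then kac_label n i * f (neighbour w i) else 0) / D"
proof -
  let ?A = "w ` A0" and ?N = "\<lambda>i. neighbour w i"
  let ?g = "\<lambda>B. if B \<subseteq> C then f B else 0"
  let ?adm = "admissible_step e ?A"
  define D where "D = (\<Sum>i | i \<le> CARD('n) \<and> (\<exists>B'. ?adm i B'). kac_label n i)"
  have K: "K ?A B = (\<Sum>i\<le>n. if ?adm i B then kac_label n i else 0) / D" for B
  proof -
    have set: "{i. i \<le> CARD('n) \<and> ?adm i B} = {i \<in> {..n}. ?adm i B}" by (auto simp: n_card)
    have "(\<Sum>i | i \<le> CARD('n) \<and> ?adm i B. kac_label n i) = (\<Sum>i\<le>n. if ?adm i B then kac_label n i else 0)"
      unfolding set by (rule sum.inter_filter) simp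
    then show ?thesis unfolding transition_prob_def D_def by simp
  qed
  have "(\<Sum>B\<in>neighbours ?A. K ?A B * ?g B) = (\<Sum>B\<in>?N ` {..n}. K ?A B * ?g B)"
    using neighbours_subset[OF w] by (intro sum.mono_neutral_left) (auto simp: neighbours_def)
  also have "\<dots> = (\<Sum>B\<in>?N ` {..n}. \<Sum>i\<le>n. if ?adm i B then kac_label n i * ?g B / D else 0)"
    unfolding K sum_divide_distrib sum_distrib_right by (intro sum.cong refl) simp
  also have "\<dots> = (\<Sum>i\<le>n. \<Sum>B\<in>?N ` {..n}. if ?adm i B then kac_label n i * ?g B / D else 0)"
    by (rule sum.swap)
  also have "\<dots> = (\<Sum>i\<le>n. (if active i (label w) then kac_label n i * f (?N i) else 0) / D)"
  proof (rule sum.cong[OF refl])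
    fix i assume "i \<in> {..n}"
    then have i: "i \<le> n" by simp
    have "(\<Sum>B\<in>?N ` {..n}. if ?adm i B then kac_label n i * ?g B / D else 0) =
      (\<Sum>B\<in>?N ` {..n}. if B = ?N i then (if ?adm i (?N i) then kac_label n i * ?g (?N i) / D else 0) else 0)"
    proof (rule sum.cong[OF refl])
      fix B
      show "(if ?adm i B then kac_label n i * ?g B / D else 0) =
        (if B = ?N i then (if ?adm i (?N i) then kac_label n i * ?g (?N i) / D else 0) else 0)"
      proof (cases "B = ?N i")
        case False
        then have "\<not> ?adm i B" using admissible_target(2)[OF w, of i B] by blast
        then show ?thesis by (simp only: False if_False)
      qed (simp only: if_True simp_thms)
    qed
    also have "\<dots> = (if ?adm i (?N i) then kac_label n i * ?g (?N i) / D else 0)"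
      using i by (subst sum.delta) auto
    also have "\<dots> = (if active i (label w) then kac_label n i * f (?N i) else 0) / D"
    proof (cases "active i (label w)")
      case True
      then have "?adm i (?N i)" "?N i \<subseteq> C"
        using outward_step_admissible[OF w i wC] active_label[OF w i] by auto
      then show ?thesis using True by simp
    next
      case False
      then have "\<not> (?adm i (?N i) \<and> ?N i \<subseteq> C)"
        using step_within_chamber_outward[OF w wC] active_label[OF w i] by blast
      then show ?thesis using False by auto
    qed
    finally show "(\<Sum>B\<in>?N ` {..n}. if ?adm i B then kac_label n i * ?g B / D else 0) =
      (if active i (label w) then kac_label n i * f (?N i) else 0) / D" .
  qed
  finally show ?thesis unfolding sum_divide_distrib by blast
qed

text \<open>
  The martingale increment for the \<open>k\<close>-th height.  The inverse total rate is the mean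
  holding time of the continuous-time process with rates \<open>kac_label n i\<close>; it converts the current per
  unit of time into a current per step.
\<close>

definition increment :: "(nat \<Rightarrow> int list \<Rightarrow> real) \<Rightarrow> nat \<Rightarrow> (real ^ 'n) set \<Rightarrow> (real ^ 'n) set \<Rightarrow> real" where
  "increment h k A B =
     (if A \<in> group_alcoves \<and> A \<subseteq> C \<and> B \<subseteq> C \<and> K A B \<noteq> 0
      then height k (rep B) - height k (rep A) + (h k (word k (rep B)) - h k (word k (rep A)))
        - current n (k - 1) / total_rate (rep A)
      else 0)"

lemma increment_centred:
  assumes A: "A \<in> group_alcoves" and k: "1 \<le> k" "k \<le> n"
    and h: "solves_poisson n (k - 1) (h k)"
  shows "(\<Sum>B\<in>neighbours A. K A B * increment h k A B) = 0"
proof (cases "A \<subseteq> C")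
  case False
  then show ?thesis by (simp add: increment_def)
next
  case True
  define w where "w = rep A"
  have w: "w \<in> G" "A = w ` A0" using rep[OF A] by (simp_all add: w_def)
  define f where "f B = height k (rep B) - height k w + (h k (word k (rep B)) - h k (word k w))
    - current n (k - 1) / total_rate w" for B
  have "(\<Sum>B\<in>neighbours A. K A B * increment h k A B) = (\<Sum>B\<in>neighbours A. K A B * (if B \<subseteq> C then f B else 0))"
    using A True by (intro sum.cong refl) (auto simp: increment_def f_def w_def neighbours_def)
  moreover obtain D where "(\<Sum>B\<in>neighbours A. K A B * (if B \<subseteq> C then f B else 0)) =
    (\<Sum>i\<le>n. if active i (label w) then kac_label n i * f (neighbour w i) else 0) / D"
    using chamber_transition_sum[OF w(1), of f] True unfolding w(2) by blast
  moreover have "(\<Sum>i\<le>n. if active i (label w) then kac_label n i * f (neighbour w i) else 0) = 0"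
  proof -
    let ?w' = "\<lambda>i. w \<circ> wall_reflection i"
    have r: "rep (?w' i ` A0) = ?w' i" if "i \<le> n" for i
      using rep_image[OF wall_reflection_group[OF w(1) that]] .
    have "(\<Sum>i\<le>n. if active i (label w) then kac_label n i * f (?w' i ` A0) else 0) =
      (\<Sum>i\<le>n. (if active i (label w) then kac_label n i *
        (height k (?w' i) - height k w + (h k (word k (?w' i)) - h k (word k w))) else 0)
        - (if active i (label w) then kac_label n i else 0) * (current n (k - 1) / total_rate w))"
      using r by (intro sum.cong refl) (auto simp: f_def algebra_simps)
    also have "\<dots> = current n (k - 1) - total_rate w * (current n (k - 1) / total_rate w)"
      unfolding sum_subtractf drift[OF w(1) k h] sum_distrib_right[symmetric] total_rate_def ..
    also have "\<dots> = 0" using total_rate_bounds[OF w(1)] by simp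
    finally show ?thesis .
  qed
  ultimately show ?thesis by simp
qed

lemma increment_bounded:
  assumes k: "1 \<le> k" "k \<le> n"
  shows "\<exists>c. \<forall>A B. \<bar>increment h k A B\<bar> \<le> c"
proof -
  define c where "c = (\<Sum>u\<in>words n (k - 1). \<bar>h k u\<bar>)"
  have c: "\<bar>h k (word k w)\<bar> \<le> c" if "w \<in> G" for w
    unfolding c_def using word_in_words[OF that k] by (intro member_le_sum) auto
  have c0: "0 \<le> c" unfolding c_def by (rule sum_nonneg) simp
  have "\<bar>increment h k A B\<bar> \<le> 1 + 2 * c + \<bar>current n (k - 1)\<bar>" for A B
  proof (cases "A \<in> group_alcoves \<and> A \<subseteq> C \<and> B \<subseteq> C \<and> K A B \<noteq> 0")
    case True
    define w where "w = rep A"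
    have w: "w \<in> G" "A = w ` A0" using rep True by (auto simp: w_def)
    obtain i where i: "i \<le> n" "B = neighbour w i"
      using True positive_step[OF w(1)] unfolding w(2) by metis
    have w': "w \<circ> wall_reflection i \<in> G" by (rule wall_reflection_group[OF w(1) i(1)])
    then have rB: "rep B = w \<circ> wall_reflection i" unfolding i(2) by (rule rep_image)
    have "word k w ! 0 \<in> {-1,0,1}" by (rule subsetD[OF word_letters nth_mem]) (use n2 in simp)
    then have "\<bar>height k (rep B) - height k w\<bar> \<le> 1"
      unfolding rB height_step[OF w(1) i(1) k(1)] by auto
    moreover have "\<bar>h k (word k (rep B))\<bar> \<le> c" "\<bar>h k (word k w)\<bar> \<le> c" using c w(1) w' rB by auto
    moreover define q where "q = current n (k - 1) / total_rate w"
    have "\<bar>q\<bar> \<le> \<bar>current n (k - 1)\<bar>" unfolding q_def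
      using total_rate_bounds(1)[OF w(1)] by (simp add: abs_divide divide_le_eq mult_left_le_one_le mult_le_cancel_left1)
    moreover have "increment h k A B = height k (rep B) - height k w + (h k (word k (rep B)) - h k (word k w)) - q"
      using True unfolding increment_def w_def[symmetric] q_def[symmetric] by (simp only: if_True simp_thms)
    ultimately show ?thesis by linarith
  next
    case False
    have "increment h k A B = 0" unfolding increment_def by (rule if_not_P[OF False])
    then show ?thesis using c0 by simp
  qed
  then show ?thesis by blast
qed

text \<open>
  The source of the coordinates \<open>2 k - 1\<close>.
\<close>

lemma current_diff:
  assumes "k \<ge> 1"
  shows "current n (k - 1) - current n k = (2 * real k - 1) / (real n * (2 * real n - 1))"
proof -
  have "real (k - 1) = real k - 1" using assms by simp
  then have "((real n)\<^sup>2 - (real (k - 1))\<^sup>2) - ((real n)\<^sup>2 - (real k)\<^sup>2) = 2 * real k - 1"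
    by (simp add: power2_diff)
  then show ?thesis unfolding current_def diff_divide_distrib[symmetric] by (rule arg_cong)
qed

lemma tail_diff: "k \<le> n \<Longrightarrow> tail k - tail (Suc k) = e k"
  by (simp add: tail_def sum.atLeast_Suc_atMost)

text \<open>
  From the time on when the path stays in the chamber, the increments telescope.  So the product with
  \<open>tail k\<close> is \<open>current n (k - 1)\<close> times the common clock \<open>T\<close>, up to \<open>o(t)\<close>.  The clock grows
  linearly, and differences of successive \<open>k\<close> give the coordinates.
\<close>

lemma confined_path_direction:
  fixes P :: "nat \<Rightarrow> (real ^ 'n) set"
  assumes alc: "\<And>t. P t \<in> group_alcoves" and steps: "\<And>t. K (P t) (P (Suc t)) \<noteq> 0"
    and conf: "\<forall>\<^sub>F t in sequentially. P t \<subseteq> C" and x: "\<And>t. x t \<in> P t"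
    and lln: "\<And>k. k \<in> {1..n} \<Longrightarrow> (\<lambda>t. (\<Sum>s<t. increment h k (P s) (P (Suc s))) / real t) \<longlonglongrightarrow> 0"
  shows "(\<lambda>t. sgn (x t)) \<longlonglongrightarrow> sgn (\<Sum>i=1..n. (2 * real i - 1) *\<^sub>R e i)"
proof -
  define w where "w t = rep (P t)" for t
  have w: "w t \<in> G" "P t = w t ` A0" for t using rep[OF alc] by (simp_all add: w_def)
  obtain t0 where t0: "\<And>t. t \<ge> t0 \<Longrightarrow> P t \<subseteq> C" using conf unfolding eventually_sequentially by blast
  define T where "T t = (\<Sum>s<t. 1 / total_rate (w s))" for t
  have T: "real t / (2 * (real n + 1)) \<le> T t" for t
  proof -
    have "(\<Sum>s<t. 1 / (2 * (real n + 1))) \<le> T t"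
      unfolding T_def using total_rate_bounds[OF w(1)]
      by (intro sum_mono frac_le) (auto intro: less_le_trans[OF zero_less_one])
    then show ?thesis by simp
  qed
  have Tpos: "T t > 0" if "t > 0" for t
  proof -
    have "0 < real t / (2 * (real n + 1))" using that by simp
    then show ?thesis using T[of t] by linarith
  qed
  have tail_lim: "(\<lambda>t. (x t \<bullet> tail k - current n (k - 1) * T t) / real t) \<longlonglongrightarrow> 0" if k: "k \<in> {1..n}" for k
  proof -
    define S where "S t = (\<Sum>s<t. increment h k (P s) (P (Suc s)))" for t
    define g where "g t = height k (w t) + h k (word k (w t)) - current n (k - 1) * T t - S t" for t
    have g: "g t = g t0" if "t \<ge> t0" for t
      using that
    proof (induction t rule: dec_induct)
      case (step t)
      have "increment h k (P t) (P (Suc t)) = height k (w (Suc t)) - height k (w t) +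
          (h k (word k (w (Suc t))) - h k (word k (w t))) - current n (k - 1) / total_rate (w t)"
        using alc[of t] steps[of t] t0[of t] t0[of "Suc t"] step.hyps by (simp add: increment_def w_def)
      then have "g (Suc t) = g t" by (simp add: g_def S_def T_def algebra_simps)
      then show ?case using step.IH by simp
    qed simp
    define c where "c = (\<Sum>u\<in>words n (k - 1). \<bar>h k u\<bar>)"
    have c: "\<bar>h k (word k (w t))\<bar> \<le> c" for t
      unfolding c_def using word_in_words[OF w(1)] k by (intro member_le_sum) auto
    have "\<bar>x t \<bullet> tail k - current n (k - 1) * T t - S t\<bar> \<le> 2 * real n + c + \<bar>g t0\<bar>" if "t \<ge> t0" for t
    proof -
      have "\<bar>x t \<bullet> tail k - height k (w t)\<bar> \<le> 2 * real n"
        using height_near[OF w(1), of "x t" t k] x[of t] w(2)[of t] k by simp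
      moreover have "x t \<bullet> tail k - current n (k - 1) * T t - S t = (x t \<bullet> tail k - height k (w t)) - h k (word k (w t)) + g t0"
        using g[OF that] by (simp add: g_def)
      ultimately show ?thesis using c[of t] by linarith
    qed
    then have "(\<lambda>t. (x t \<bullet> tail k - current n (k - 1) * T t - S t) / real t) \<longlonglongrightarrow> 0"
      by (intro bounded_over_index_tendsto_0) (auto simp: eventually_sequentially)
    moreover have "(\<lambda>t. S t / real t) \<longlonglongrightarrow> 0" unfolding S_def by (rule lln[OF k])
    ultimately have "(\<lambda>t. (x t \<bullet> tail k - current n (k - 1) * T t - S t) / real t + S t / real t) \<longlonglongrightarrow> 0 + 0"
      by (rule tendsto_add)
    then show ?thesis by (simp add: diff_divide_distrib)
  qed
  \<comment> \<open>for \<open>k = n + 1\<close> both the tail and the current vanish\<close>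
  have tail_end: "(\<lambda>t. (x t \<bullet> tail (Suc n) - current n n * T t) / real t) \<longlonglongrightarrow> 0"
    by (simp add: tail_def current_def)
  have tail_lim': "(\<lambda>t. (x t \<bullet> tail (Suc k) - current n k * T t) / real t) \<longlonglongrightarrow> 0" if "k \<in> {1..n}" for k
    using tail_lim[of "Suc k"] tail_end that by (cases "k = n") auto
  define \<kappa> where "\<kappa> = 1 / (real n * (2 * real n - 1))"
  have \<kappa>: "\<kappa> > 0" using n2 by (simp add: \<kappa>_def)
  have coord: "(\<lambda>t. (x t \<bullet> e k) / T t) \<longlonglongrightarrow> \<kappa> * (2 * real k - 1)" if k: "k \<in> {1..n}" for k
  proof -
    define d where "d t = (x t \<bullet> e k - \<kappa> * (2 * real k - 1) * T t) / real t" for t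
    have "d t = (x t \<bullet> tail k - current n (k - 1) * T t) / real t - (x t \<bullet> tail (Suc k) - current n k * T t) / real t" for t
    proof -
      have "x t \<bullet> e k = x t \<bullet> tail k - x t \<bullet> tail (Suc k)" using tail_diff[of k] k by (simp flip: inner_diff_right)
      moreover have "\<kappa> * (2 * real k - 1) = current n (k - 1) - current n k" using current_diff[of k] k by (simp add: \<kappa>_def)
      ultimately show ?thesis unfolding d_def by (simp add: diff_divide_distrib[symmetric] left_diff_distrib)
    qed
    then have d_eq: "d = (\<lambda>t. (x t \<bullet> tail k - current n (k - 1) * T t) / real t - (x t \<bullet> tail (Suc k) - current n k * T t) / real t)"
      by (rule ext)
    have "d \<longlonglongrightarrow> 0" unfolding d_eq using tendsto_diff[OF tail_lim[OF k] tail_lim'[OF k]] by simp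
    then have "(\<lambda>t. 2 * (real n + 1) * \<bar>d t\<bar>) \<longlonglongrightarrow> 0"
      by (intro tendsto_mult_right_zero tendsto_rabs_zero)
    moreover have "\<forall>\<^sub>F t in sequentially. norm ((x t \<bullet> e k) / T t - \<kappa> * (2 * real k - 1)) \<le> 2 * (real n + 1) * \<bar>d t\<bar>"
      using eventually_gt_at_top[of 0]
    proof eventually_elim
      case (elim t)
      have "(x t \<bullet> e k) / T t - \<kappa> * (2 * real k - 1) = d t * (real t / T t)"
        using Tpos[OF elim] elim by (simp add: d_def field_simps)
      moreover have "\<bar>real t / T t\<bar> \<le> 2 * (real n + 1)"
        using T[of t] Tpos[OF elim] elim by (simp add: field_simps)
      then have "\<bar>d t\<bar> * \<bar>real t / T t\<bar> \<le> \<bar>d t\<bar> * (2 * (real n + 1))" by (rule mult_left_mono) simp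
      ultimately show ?case unfolding real_norm_def by (simp only: abs_mult mult.commute)
    qed
    ultimately have "(\<lambda>t. (x t \<bullet> e k) / T t - \<kappa> * (2 * real k - 1)) \<longlonglongrightarrow> 0"
      by (rule Lim_null_comparison[rotated])
    then show ?thesis by (rule LIM_zero_cancel)
  qed
  let ?v = "\<Sum>i=1..n. (2 * real i - 1) *\<^sub>R e i"
  have "(\<lambda>t. \<Sum>k=1..n. ((x t \<bullet> e k) / T t) *\<^sub>R e k) \<longlonglongrightarrow> (\<Sum>k=1..n. (\<kappa> * (2 * real k - 1)) *\<^sub>R e k)"
    by (intro tendsto_sum tendsto_scaleR coord tendsto_const)
  moreover have "(\<Sum>k=1..n. ((x t \<bullet> e k) / T t) *\<^sub>R e k) = (1 / T t) *\<^sub>R x t" for t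
    by (subst (2) expand) (simp add: scaleR_sum_right)
  moreover have "(\<Sum>k=1..n. (\<kappa> * (2 * real k - 1)) *\<^sub>R e k) = \<kappa> *\<^sub>R ?v"
    by (simp add: scaleR_sum_right)
  ultimately have lim: "(\<lambda>t. (1 / T t) *\<^sub>R x t) \<longlonglongrightarrow> \<kappa> *\<^sub>R ?v" by simp
  have "?v \<bullet> e 1 = 1" using coordinate_sum[of 1 "\<lambda>i. 2 * real i - 1"] n2 by simp
  then have "?v \<noteq> 0" by auto
  then have "(\<lambda>t. sgn ((1 / T t) *\<^sub>R x t)) \<longlonglongrightarrow> sgn (\<kappa> *\<^sub>R ?v)"
    using \<kappa> by (intro tendsto_sgn lim) auto
  moreover have "\<forall>\<^sub>F t in sequentially. sgn ((1 / T t) *\<^sub>R x t) = sgn (x t)"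
    using eventually_gt_at_top[of 0] by eventually_elim (use Tpos in \<open>simp add: sgn_scaleR\<close>)
  ultimately have "(\<lambda>t. sgn (x t)) \<longlonglongrightarrow> sgn (\<kappa> *\<^sub>R ?v)" by (rule Lim_transform_eventually)
  also have "sgn (\<kappa> *\<^sub>R ?v) = sgn ?v" using \<kappa> by (simp add: sgn_scaleR)
  finally show ?thesis .
qed

lemma walk_direction:
  fixes M :: "'w measure" and X :: "nat \<Rightarrow> 'w \<Rightarrow> (real ^ 'n) set"
  assumes walk: "reduced_random_walk e (kac_label n) M X"
  shows "limiting_direction e M X (sgn (\<Sum>i=1..n. (2 * real i - 1) *\<^sub>R e i))"
proof -
  have "\<forall>k\<in>{1..n}. \<exists>h. solves_poisson n (k - 1) h"
    using n2 by (intro ballI words_poisson_equation) auto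
  from bchoice[OF this] obtain h where h: "\<forall>k\<in>{1..n}. solves_poisson n (k - 1) (h k)" ..
  interpret prob_space M using walk by (simp add: reduced_random_walk_def)
  interpret markov_path M X "alcoves e" K A0 group_alcoves neighbours
  proof unfold_locales
    show "X t \<in> measurable M (count_space (alcoves e))" for t using walk by (simp add: reduced_random_walk_def)
    show "measure M {\<omega> \<in> space M. \<forall>s\<le>Suc t. X s \<omega> = A s} =
        measure M {\<omega> \<in> space M. \<forall>s\<le>t. X s \<omega> = A s} * K (A t) (A (Suc t))" for t A
      using walk unfolding reduced_random_walk_def by blast
    show "AE \<omega> in M. X 0 \<omega> = A0" using walk by (simp add: reduced_random_walk_def)
    show "A0 \<in> group_alcoves" unfolding group_alcoves_def by (rule image_eqI[OF _ affine_weyl_group.one]) simp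
    fix A assume "A \<in> group_alcoves"
    then obtain w where w: "w \<in> G" "A = w ` A0" by (auto simp: group_alcoves_def)
    note sub = neighbours_subset[OF w(1), folded w(2)]
    show "finite (neighbours A)" by (rule finite_subset[OF sub]) simp
    have "neighbour w i \<in> group_alcoves" if "i \<le> n" for i
      unfolding group_alcoves_def by (rule imageI) (rule wall_reflection_group[OF w(1) that])
    then show "neighbours A \<subseteq> group_alcoves" using sub by blast
  qed (auto simp: countable_alcoves neighbours_def)
  have "AE \<omega> in M. \<forall>k\<in>{1..n}. (\<lambda>t. (\<Sum>s<t. increment h k (X s \<omega>) (X (Suc s) \<omega>)) / real t) \<longlonglongrightarrow> 0"
  proof (rule AE_finite_allI)
    fix k assume k: "k \<in> {1..n}"
    then have k': "1 \<le> k" "k \<le> n" by auto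
    obtain c where c: "\<forall>A B. \<bar>increment h k A B\<bar> \<le> c" using increment_bounded[OF k'] ..
    show "AE \<omega> in M. (\<lambda>t. (\<Sum>s<t. increment h k (X s \<omega>) (X (Suc s) \<omega>)) / real t) \<longlonglongrightarrow> 0"
      by (rule strong_law[OF c[rule_format] increment_centred[where h = h, OF _ k' bspec[OF h k]]])
  qed simp
  then show ?thesis using AE_path unfolding limiting_direction_def
  proof eventually_elim
    case (elim \<omega>)
    show ?case
    proof (intro impI allI)
      fix x assume conf: "\<forall>\<^sub>F t in sequentially. X t \<omega> \<subseteq> C" and x: "\<forall>t. x t \<in> X t \<omega>"
      have "(\<lambda>t. sgn (x t)) \<longlonglongrightarrow> sgn (\<Sum>i=1..n. (2 * real i - 1) *\<^sub>R e i)"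
        by (rule confined_path_direction[OF _ _ conf, where h = h]) (use elim x in \<open>auto simp: neighbours_def\<close>)
      then show "(\<lambda>t. x t /\<^sub>R norm (x t)) \<longlonglongrightarrow> sgn (\<Sum>i=1..n. (2 * real i - 1) *\<^sub>R e i)"
        by (simp add: sgn_div_norm)
    qed
  qed
qed

end

theorem theorem3p3:
  fixes e :: "nat \<Rightarrow> real ^ 'n"
    and M :: "'w measure"
    and X :: "nat \<Rightarrow> 'w \<Rightarrow> (real ^ 'n) set"
  assumes "CARD('n) \<ge> 2"
    and "bij_betw e {1..CARD('n)} Basis"
    and "reduced_random_walk e (kac_label (CARD('n))) M X"
  shows "\<exists>c>0. limiting_direction e M X (c *\<^sub>R (\<Sum>i=1..CARD('n). (2 * real i - 1) *\<^sub>R e i))"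
proof -
  interpret root_frame e "CARD('n)" by unfold_locales (use assms in auto)
  let ?v = "\<Sum>i=1..CARD('n). (2 * real i - 1) *\<^sub>R e i"
  have "?v \<bullet> e 1 = 1" using coordinate_sum[of 1 "\<lambda>i. 2 * real i - 1"] assms(1) by simp
  then have "norm ?v > 0" by auto
  moreover have "limiting_direction e M X (sgn ?v)" by (rule walk_direction[OF assms(3)])
  ultimately show ?thesis by (intro exI[of _ "inverse (norm ?v)"]) (simp add: sgn_div_norm)
qed

end
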